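(* Let $f:S^n\to S^m$ be an LOMSE of $(n,p,k)$-type with $(n,p)=(3,2)$, $k\ge4$, or $(n,p)=(5,4)$, $k\ge6$, and let $$\varphi_0=\sqrt{\frac{p-n\lambda^{-2}}{n-p}},\qquad \lambda^2=\frac{k(k+n-1)}{p}.$$ Then there exists $\epsilon>0$ such that for every $\varphi\in(\varphi_0,\varphi_0+\epsilon)$ the Dirichlet problem for the minimal surface equations on the open unit disk $\mathbb D^{n+1}\subset\mathbb R^{n+1}$ with boundary data $f_\varphi:=\varphi\cdot f$ on $\partial\mathbb D^{n+1}=S^n$ has analytic solutions.
   Context: $S^d\subset\mathbb R^{d+1}$ is the unit sphere with its canonical metric $g_d$. For a smooth map $f:S^n\to S^m$ and $\theta\in(0,\pi/2)$ put $M_{f,\theta}=\{(\cos\theta\cdot x,\ \sin\theta\cdot f(x)):x\in S^n\}\subset S^{n+m+1}$. The map $f$ is a Lawson-Osserman map (LOM) if there is some $\theta\in(0,\pi/2)$ such that $M_{f,\theta}$ is a minimal submanifold of $S^{n+m+1}$. An LOMSE is an LOM which is not a totally geodesic isometric embedding and such that for each $x\in S^n$ all nonzero singular values of $(f_* )_x:(T_xS^n,g_n)\to(T_{f(x)}S^m,g_m)$ are equal. It is a fact that for an LOMSE the common nonzero singular value $\lambda$ and its multiplicity $p$ are constant, that there is an integer $k\ge2$ such that all components of $f$ are spherical harmonics of degree $k$ on $S^n$, that $\lambda^2=k(k+n-1)/p$, and that $\theta$ is unique, with $\tan\theta=\varphi_0$; such $f$ is said to be of $(n,p,k)$-type. An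 analytic solution to the Dirichlet problem with boundary data $b:\partial\mathbb D^{n+1}\to\mathbb R^{m+1}$ is a map $F\in C^0(\overline{\mathbb D^{n+1}};\mathbb R^{m+1})$, real analytic in $\mathbb D^{n+1}$, with $F=b$ on $\partial\mathbb D^{n+1}$, whose graph over $\mathbb D^{n+1}$ is a minimal submanifold of $\mathbb R^{n+1}\times\mathbb R^{m+1}$. *)

theory Defs
  imports "HOL-Analysis.Analysis"
begin

text \<open>
  The sphere \<open>S^n\<close> is \<open>sphere 0 1\<close> in a Euclidean space of dimension \<open>n + 1\<close>, and
  \<open>S^(n+m+1)\<close> is \<open>sphere 0 1\<close> in the product of the spaces that contain \<open>S^n\<close> and \<open>S^m\<close>.
  Submanifolds are subsets of a Euclidean space and carry the induced metric.
\<close>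

section \<open>Smooth and real analytic maps\<close>

text \<open>The domain is meant to be open, here and for \<open>smooth_on\<close>.\<close>

fun Ck_on :: "nat \<Rightarrow> 'a::real_normed_vector set \<Rightarrow> ('a \<Rightarrow> 'b::real_normed_vector) \<Rightarrow> bool" where
  "Ck_on 0 U f \<longleftrightarrow> continuous_on U f"
| "Ck_on (Suc k) U f \<longleftrightarrow>
     (\<forall>x\<in>U. f differentiable (at x)) \<and> (\<forall>v. Ck_on k U (\<lambda>x. frechet_derivative f (at x) v))"

definition smooth_on :: "'a::real_normed_vector set \<Rightarrow> ('a \<Rightarrow> 'b::real_normed_vector) \<Rightarrow> bool" where
  "smooth_on U f \<longleftrightarrow> (\<forall>k. Ck_on k U f)"

text \<open>Smoothness on an arbitrary set means smooth extendability near each of its points.\<close>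

definition smooth_map ::
  "'a::real_normed_vector set \<Rightarrow> 'b::real_normed_vector set \<Rightarrow> ('a \<Rightarrow> 'b) \<Rightarrow> bool" where
  "smooth_map S T f \<longleftrightarrow> f ` S \<subseteq> T \<and>
     (\<forall>x\<in>S. \<exists>U g. open U \<and> x \<in> U \<and> smooth_on U g \<and> (\<forall>y\<in>S \<inter> U. g y = f y))"

text \<open>
  Local expansion in a multivariate power series. A multi-index assigns an exponent to each
  element of \<open>Basis\<close>.
\<close>

definition real_analytic_on :: "'a::euclidean_space set \<Rightarrow> ('a \<Rightarrow> 'b::euclidean_space) \<Rightarrow> bool" where
  "real_analytic_on U f \<longleftrightarrow>
     (\<forall>a\<in>U. \<exists>r>0. \<exists>c :: ('a \<Rightarrow> nat) \<Rightarrow> 'b. \<forall>x\<in>ball a r.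
        ((\<lambda>\<alpha>. (\<Prod>b\<in>Basis. ((x - a) \<bullet> b) ^ \<alpha> b) *\<^sub>R c \<alpha>) has_sum f x) (Basis \<rightarrow>\<^sub>E UNIV))"

section \<open>Submanifolds and mean curvature\<close>

definition smooth_submanifold :: "nat \<Rightarrow> 'a::euclidean_space set \<Rightarrow> bool" where
  "smooth_submanifold d M \<longleftrightarrow>
     (\<forall>x\<in>M. \<exists>U V \<Phi> \<Psi> L. open U \<and> x \<in> U \<and> open V \<and> homeomorphism U V \<Phi> \<Psi> \<and>
        smooth_on U \<Phi> \<and> smooth_on V \<Psi> \<and> subspace (L :: 'a set) \<and> dim L = d \<and>
        \<Phi> ` (U \<inter> M) = V \<inter> L)"

definition tangent_space :: "'a::euclidean_space set \<Rightarrow> 'a \<Rightarrow> 'a set" where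
  "tangent_space M x =
     {v. \<exists>e>0. \<exists>\<gamma>. smooth_on {-e<..<e} \<gamma> \<and> \<gamma> ` {-e<..<e} \<subseteq> M \<and> \<gamma> 0 = x \<and>
           (\<gamma> has_vector_derivative v) (at (0::real))}"

definition normal_space :: "'a::euclidean_space set \<Rightarrow> 'a set \<Rightarrow> 'a \<Rightarrow> 'a set" where
  "normal_space N M x = {w \<in> tangent_space N x. \<forall>v\<in>tangent_space M x. w \<bullet> v = 0}"

definition orth_proj :: "'a::euclidean_space set \<Rightarrow> 'a \<Rightarrow> 'a" where
  "orth_proj L v = (THE u. u \<in> L \<and> (\<forall>w\<in>L. (v - u) \<bullet> w = 0))"

definition tangent_extension ::
  "'a::euclidean_space set \<Rightarrow> 'a \<Rightarrow> 'a \<Rightarrow> ('a \<Rightarrow> 'a) \<Rightarrow> bool" where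
  "tangent_extension M x w W \<longleftrightarrow> W x = w \<and>
     (\<exists>U. open U \<and> x \<in> U \<and> smooth_on U W \<and> (\<forall>y\<in>U \<inter> M. W y \<in> tangent_space M y))"

text \<open>
  The second fundamental form of \<open>M\<close> in \<open>N\<close>: the part normal to \<open>M\<close> of the Levi-Civita derivative
  in \<open>N\<close> of a tangent field \<open>W\<close> of \<open>M\<close> extending \<open>w\<close>. That derivative is the \<open>N\<close>-tangential part of
  the flat derivative, so a single projection of the flat derivative to the normal space of \<open>M\<close>
  in \<open>N\<close> suffices. For \<open>v\<close>, \<open>w\<close> tangent to \<open>M\<close> the value does not depend on the choice of \<open>W\<close>.
\<close>

definition second_fundamental_form ::
  "'a::euclidean_space set \<Rightarrow> 'a set \<Rightarrow> 'a \<Rightarrow> 'a \<Rightarrow> 'a \<Rightarrow> 'a" where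
  "second_fundamental_form N M x v w =
     orth_proj (normal_space N M x)
       (frechet_derivative (SOME W. tangent_extension M x w W) (at x) v)"

definition orthonormal_basis_of :: "'a::euclidean_space set \<Rightarrow> 'a set \<Rightarrow> bool" where
  "orthonormal_basis_of L B \<longleftrightarrow>
     B \<subseteq> L \<and> span B = L \<and> pairwise orthogonal B \<and> (\<forall>b\<in>B. norm b = 1)"

text \<open>The unnormalised trace of the second fundamental form.\<close>

definition mean_curvature_vector :: "'a::euclidean_space set \<Rightarrow> 'a set \<Rightarrow> 'a \<Rightarrow> 'a" where
  "mean_curvature_vector N M x =
     (\<Sum>e\<in>(SOME B. orthonormal_basis_of (tangent_space M x) B). second_fundamental_form N M x e e)"

definition minimal_submanifold :: "nat \<Rightarrow> 'a::euclidean_space set \<Rightarrow> 'a set \<Rightarrow> bool" where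
  "minimal_submanifold d N M \<longleftrightarrow>
     (\<exists>d'. smooth_submanifold d' N) \<and> smooth_submanifold d M \<and> M \<subseteq> N \<and>
     (\<forall>x\<in>M. mean_curvature_vector N M x = 0)"

section \<open>Lawson-Osserman maps\<close>

definition M_graph :: "('a::euclidean_space \<Rightarrow> 'b::euclidean_space) \<Rightarrow> real \<Rightarrow> ('a \<times> 'b) set" where
  "M_graph f \<theta> = (\<lambda>x. (cos \<theta> *\<^sub>R x, sin \<theta> *\<^sub>R f x)) ` sphere 0 1"

definition LOM :: "('a::euclidean_space \<Rightarrow> 'b::euclidean_space) \<Rightarrow> bool" where
  "LOM f \<longleftrightarrow> smooth_map (sphere 0 1) (sphere 0 1) f \<and>
     (\<exists>\<theta>. 0 < \<theta> \<and> \<theta> < pi / 2 \<and>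
        minimal_submanifold (DIM('a) - 1) (sphere 0 1) (M_graph f \<theta>))"

text \<open>
  The differential of a map on the sphere. A derivative within the sphere is determined only on
  the tangent space, so this is to be applied to tangent vectors only.
\<close>

definition sphere_differential ::
  "('a::euclidean_space \<Rightarrow> 'b::euclidean_space) \<Rightarrow> 'a \<Rightarrow> 'a \<Rightarrow> 'b" where
  "sphere_differential f x = frechet_derivative f (at x within sphere 0 1)"

text \<open>
  The eigenspace of \<open>A* A\<close> for the eigenvalue \<open>s\<^sup>2\<close>, where \<open>A*\<close> is the adjoint of \<open>A\<close>
  as a linear map on the subspace \<open>T\<close>: the condition says \<open>\<langle>A* A v, u\<rangle> = s\<^sup>2 \<langle>v, u\<rangle>\<close>.
\<close>

definition singular_space ::
  "'a::euclidean_space set \<Rightarrow> ('a \<Rightarrow> 'b::euclidean_space) \<Rightarrow> real \<Rightarrow> 'a set" where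
  "singular_space T A s = {v \<in> T. \<forall>u\<in>T. A v \<bullet> A u = s\<^sup>2 * (v \<bullet> u)}"

definition singular_value ::
  "'a::euclidean_space set \<Rightarrow> ('a \<Rightarrow> 'b::euclidean_space) \<Rightarrow> real \<Rightarrow> bool" where
  "singular_value T A s \<longleftrightarrow> s \<ge> 0 \<and> (\<exists>v\<in>singular_space T A s. v \<noteq> 0)"

text \<open>By compactness of the sphere, an injective immersion is an embedding.\<close>

definition totally_geodesic_isometric_embedding ::
  "('a::euclidean_space \<Rightarrow> 'b::euclidean_space) \<Rightarrow> bool" where
  "totally_geodesic_isometric_embedding f \<longleftrightarrow>
     smooth_map (sphere 0 1) (sphere 0 1) f \<and> inj_on f (sphere 0 1) \<and>
     (\<forall>x\<in>sphere 0 1. \<forall>u\<in>tangent_space (sphere 0 1) x. \<forall>v\<in>tangent_space (sphere 0 1) x.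
        sphere_differential f x u \<bullet> sphere_differential f x v = u \<bullet> v) \<and>
     (\<forall>y\<in>f ` sphere 0 1.
        \<forall>u\<in>tangent_space (f ` sphere 0 1) y. \<forall>v\<in>tangent_space (f ` sphere 0 1) y.
          second_fundamental_form (sphere 0 1) (f ` sphere 0 1) y u v = 0)"

definition LOMSE :: "('a::euclidean_space \<Rightarrow> 'b::euclidean_space) \<Rightarrow> bool" where
  "LOMSE f \<longleftrightarrow> LOM f \<and> \<not> totally_geodesic_isometric_embedding f \<and>
     (\<forall>x\<in>sphere 0 1. \<forall>s t. s \<noteq> 0 \<longrightarrow> t \<noteq> 0 \<longrightarrow>
        singular_value (tangent_space (sphere 0 1) x) (sphere_differential f x) s \<longrightarrow>
        singular_value (tangent_space (sphere 0 1) x) (sphere_differential f x) t \<longrightarrow> s = t)"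

definition laplacian :: "('a::euclidean_space \<Rightarrow> real) \<Rightarrow> 'a \<Rightarrow> real" where
  "laplacian P x =
     (\<Sum>b\<in>Basis. frechet_derivative (\<lambda>y. frechet_derivative P (at y) b) (at x) b)"

text \<open>Restrictions to the sphere of harmonic homogeneous polynomials.\<close>

definition spherical_harmonic :: "nat \<Rightarrow> ('a::euclidean_space \<Rightarrow> real) \<Rightarrow> bool" where
  "spherical_harmonic k h \<longleftrightarrow>
     (\<exists>P. real_polynomial_function P \<and> (\<forall>t x. P (t *\<^sub>R x) = t ^ k * P x) \<and>
          (\<forall>x. laplacian P x = 0) \<and> (\<forall>x\<in>sphere 0 1. h x = P x))"

definition LOMSE_of_type ::
  "nat \<Rightarrow> nat \<Rightarrow> nat \<Rightarrow> ('a::euclidean_space \<Rightarrow> 'b::euclidean_space) \<Rightarrow> bool" where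
  "LOMSE_of_type n p k f \<longleftrightarrow> DIM('a) = n + 1 \<and> LOMSE f \<and>
     (\<forall>x\<in>sphere 0 1. \<exists>s. s \<noteq> 0 \<and>
        singular_value (tangent_space (sphere 0 1) x) (sphere_differential f x) s \<and>
        dim (singular_space (tangent_space (sphere 0 1) x) (sphere_differential f x) s) = p) \<and>
     k \<ge> 2 \<and> (\<forall>b\<in>Basis. spherical_harmonic k (\<lambda>x. f x \<bullet> b))"

section \<open>The Dirichlet problem on the unit disk\<close>

definition analytic_Dirichlet_solution ::
  "('a::euclidean_space \<Rightarrow> 'b::euclidean_space) \<Rightarrow> ('a \<Rightarrow> 'b) \<Rightarrow> bool" where
  "analytic_Dirichlet_solution bd F \<longleftrightarrow>
     continuous_on (cball 0 1) F \<and> real_analytic_on (ball 0 1) F \<and>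
     (\<forall>x\<in>sphere 0 1. F x = bd x) \<and>
     minimal_submanifold DIM('a) UNIV ((\<lambda>x. (x, F x)) ` ball 0 1)"

end

theory Submission imports Defs "HOL-Complex_Analysis.Complex_Analysis" begin

text \<open>
  Let \<open>P\<close> be the homogeneous harmonic extension of \<open>f\<close>. Harmonicity of \<open>P\<close> and minimality of
  \<open>M_graph f \<theta>\<close> are two independent linear equations for the traces of the Hessian of \<open>f\<close> over the
  singular space and over the kernel of \<open>df\<close>; hence these traces are \<open>- p \<lambda>\<^sup>2 f\<close> and \<open>0\<close>, and the
  minimal surface system for \<open>F x = r \<phi>(log r) f(x/r)\<close>, \<open>r = \<bar>x\<bar>\<close>, becomes an autonomous second order
  equation for \<open>\<phi>\<close> with rest point \<open>\<phi>0\<close>. The orbit that leaves the origin is a power series in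
  \<open>r^(k-1)\<close>, so that \<open>F x = K(\<bar>x\<bar>\<^sup>2) P x\<close> with \<open>K\<close> analytic up to \<open>0\<close>. For the given \<open>(n,p,k)\<close> the
  rest point is a spiral: an orbit that stayed below \<open>\<phi>0\<close> would converge to it monotonically, which
  the complex eigenvalues forbid. Hence \<open>\<phi>\<close> takes all values slightly above \<open>\<phi>0\<close>, and a translation
  in \<open>log r\<close> moves such a value to \<open>r = 1\<close>.
\<close>


section \<open>Calculus of \<open>C\<^sup>k\<close> maps\<close>

text \<open>The linearisation at the rest point has characteristic equation \<mu>^2 + (n+1) \<mu> +
  \<beta>0 = 0 with \<beta>0 = 2 n (m - n) / m and m = p \<lambda>^2 = k (k+n-1). Its roots are
  non-real when (n+1)^2 m < 8 n (m - n). This forces (n+1)^2 < 8 n, hence n <= 5; it reads k (k+2) >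
  9 for n = 3 and k (k+4) > 50 for n = 5, which is how the bounds on k enter. Two obstacles shape
  the rest. The time log r sends the centre of the disk to minus infinity, so analyticity there
  cannot come from the flow: it is read off a power series at a regular singular point. That series
  and the ordinary local solutions are both instances of one recursion with polynomial right-hand
  side. Secondly, mean curvature is defined through arbitrary choices of a basis and of extensions,
  so it is reduced once and for all to a trace of second derivatives of a parametrisation. The two
  trace equations are independent because f stretches the singular space and not the kernel, so the
  inverse metric of the Lawson-Osserman sphere weights the two traces differently.\<close>

lemma Ck_on_SucD: "Ck_on (Suc k) U f \<Longrightarrow> Ck_on k U f"
proof (induction k arbitrary: f)
  case 0
  then show ?case
    by (auto intro!: continuous_at_imp_continuous_on differentiable_imp_continuous_within)
next
  case (Suc k)
  then show ?case by (metis Ck_on.simps(2))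
qed

lemma Ck_on_imp_continuous_on: "Ck_on k U f \<Longrightarrow> continuous_on U f"
proof (induction k)
  case (Suc k)
  show ?case by (rule Suc.IH[OF Ck_on_SucD[OF Suc.prems]])
qed simp

text \<open>\<open>U\<close> is open, so a Frechet derivative at a point of \<open>U\<close> sees
  only values on \<open>U\<close>, and agreement passes to all higher derivatives.\<close>

lemma Ck_on_cong:
  assumes "open U" "\<And>x. x \<in> U \<Longrightarrow> f x = g x" "Ck_on k U f"
  shows "Ck_on k U g"
  using assms(2,3)
proof (induction k arbitrary: f g)
  case 0
  then show ?case by (metis Ck_on.simps(1) continuous_on_cong)
next
  case (Suc k)
  have der: "(g has_derivative frechet_derivative f (at x)) (at x)" if "x \<in> U" for x
    using Suc.prems that assms(1)
    by (metis Ck_on.simps(2) frechet_derivative_works has_derivative_transform_within_open)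
  have eq: "frechet_derivative f (at x) = frechet_derivative g (at x)" if "x \<in> U" for x
    using der[OF that] by (rule frechet_derivative_at)
  have "Ck_on k U (\<lambda>x. frechet_derivative g (at x) v)" for v
    by (rule Suc.IH[where f="\<lambda>x. frechet_derivative f (at x) v"])
      (use Suc.prems(2) eq in auto)
  then show ?case
    using der by (auto simp: differentiable_def)
qed

text \<open>Lets the later inductions run on explicit derivative formulas instead of
  \<open>frechet_derivative\<close>.\<close>

lemma Ck_on_SucI:
  assumes "open U" "\<And>x. x \<in> U \<Longrightarrow> (f has_derivative f' x) (at x)"
    and "\<And>v. Ck_on k U (\<lambda>x. f' x v)"
  shows "Ck_on (Suc k) U f"
proof -
  have "Ck_on k U (\<lambda>x. frechet_derivative f (at x) v)" for v
    by (rule Ck_on_cong[OF assms(1) _ assms(3)[of v]])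
      (metis assms(2) frechet_derivative_at)
  then show ?thesis
    using assms(2) by (auto simp: differentiable_def)
qed

lemma Ck_on_SucE:
  assumes "open U" "Ck_on (Suc k) U f" "\<And>x. x \<in> U \<Longrightarrow> (f has_derivative f' x) (at x)"
  shows "Ck_on k U (\<lambda>x. f' x v)"
proof -
  have "Ck_on k U (\<lambda>x. frechet_derivative f (at x) v)" using assms(2) by auto
  then show ?thesis
    by (rule Ck_on_cong[OF assms(1), rotated]) (metis assms(3) frechet_derivative_at)
qed

lemma Ck_on_Suc_has_derivative:
  "Ck_on (Suc k) U f \<Longrightarrow> x \<in> U \<Longrightarrow> (f has_derivative frechet_derivative f (at x)) (at x)"
  by (auto simp: frechet_derivative_works)

lemma Ck_on_subset: "Ck_on k U f \<Longrightarrow> V \<subseteq> U \<Longrightarrow> Ck_on k V f"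
proof (induction k arbitrary: f)
  case 0
  then show ?case by (simp add: continuous_on_subset)
next
  case (Suc k)
  then show ?case unfolding Ck_on.simps by (meson subsetD)
qed

lemma Ck_on_const: "Ck_on k U (\<lambda>x. c)"
proof (induction k arbitrary: c)
  case (Suc k)
  have "frechet_derivative (\<lambda>x. c) (at x) = (\<lambda>v. 0)" for x :: 'a and c :: 'b
    by (metis frechet_derivative_at has_derivative_const)
  then show ?case using Suc by simp
qed simp

lemma Ck_on_bounded_linear:
  assumes L: "bounded_linear L"
  shows "Ck_on k U L"
proof (cases k)
  case 0
  then show ?thesis
    by (simp add: L linear_continuous_on)
next
  case (Suc j)
  have "frechet_derivative L (at x) = L" for x
    using L by (metis bounded_linear_imp_has_derivative frechet_derivative_at)
  then show ?thesis
    using Suc L by (auto simp: Ck_on_const bounded_linear_imp_differentiable)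
qed

lemma Ck_on_linear_image:
  assumes L: "bounded_linear L" and U: "open U" and "Ck_on k U f"
  shows "Ck_on k U (\<lambda>x. L (f x))"
  using assms(3)
proof (induction k arbitrary: f)
  case 0
  then show ?case
    using L bounded_linear.continuous_on by auto
next
  case (Suc k)
  show ?case
  proof (rule Ck_on_SucI[OF U])
    show "((\<lambda>x. L (f x)) has_derivative (\<lambda>v. L (frechet_derivative f (at x) v))) (at x)"
      if "x \<in> U" for x
      by (rule bounded_linear.has_derivative[OF L Ck_on_Suc_has_derivative[OF Suc.prems that]])
    show "Ck_on k U (\<lambda>x. L (frechet_derivative f (at x) v))" for v
      using Suc by auto
  qed
qed

lemma Ck_on_affine_arg:
  assumes L: "bounded_linear L" and U: "open U"
    and "\<And>x. x \<in> U \<Longrightarrow> L x + a \<in> V" and "Ck_on k V f"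
  shows "Ck_on k U (\<lambda>x. f (L x + a))"
  using assms(4)
proof (induction k arbitrary: f)
  case 0
  have "continuous_on U (\<lambda>x. L x + a)"
    by (intro continuous_intros) (simp add: L linear_continuous_on)
  then show ?case
    using 0 assms(3) by (auto intro: continuous_on_compose2)
next
  case (Suc k)
  show ?case
  proof (rule Ck_on_SucI[OF U])
    fix x assume x: "x \<in> U"
    have "((\<lambda>x. L x + a) has_derivative L) (at x)"
      by (auto intro!: derivative_eq_intros bounded_linear_imp_has_derivative L)
    from has_derivative_compose[OF this Ck_on_Suc_has_derivative[OF Suc.prems assms(3)[OF x]]]
    show "((\<lambda>x. f (L x + a)) has_derivative (\<lambda>v. frechet_derivative f (at (L x + a)) (L v))) (at x)" .
  next
    show "Ck_on k U (\<lambda>x. frechet_derivative f (at (L x + a)) (L v))" for v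
      using Suc by auto
  qed
qed

lemma Ck_on_linear_arg:
  assumes "bounded_linear L" "open U" "\<And>x. x \<in> U \<Longrightarrow> L x \<in> V" "Ck_on k V f"
  shows "Ck_on k U (\<lambda>x. f (L x))"
  using Ck_on_affine_arg[of L U 0 V k f] assms by simp

lemma Ck_on_add:
  assumes U: "open U" and "Ck_on k U f" "Ck_on k U g"
  shows "Ck_on k U (\<lambda>x. f x + g x)"
  using assms(2,3)
proof (induction k arbitrary: f g)
  case (Suc k)
  show ?case
  proof (rule Ck_on_SucI[OF U])
    show "((\<lambda>x. f x + g x) has_derivative
        (\<lambda>v. frechet_derivative f (at x) v + frechet_derivative g (at x) v)) (at x)" if "x \<in> U" for x
      by (rule has_derivative_add[OF Suc.prems[THEN Ck_on_Suc_has_derivative, OF that]])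
    show "Ck_on k U (\<lambda>x. frechet_derivative f (at x) v + frechet_derivative g (at x) v)" for v
      using Suc by auto
  qed
qed (auto intro: continuous_on_add)

lemma Ck_on_sum:
  assumes "open U" "\<And>i. i \<in> I \<Longrightarrow> Ck_on k U (f i)"
  shows "Ck_on k U (\<lambda>x. \<Sum>i\<in>I. f i x)"
  using assms(2)
proof (induction I rule: infinite_finite_induct)
  case (insert i I)
  then show ?case using Ck_on_add[OF assms(1), of k "f i"] by simp
qed (simp_all add: Ck_on_const)

text \<open>By the product rule the derivative is a sum of two terms of the same bilinear form, each
  with one factor differentiated, which closes the induction.\<close>

lemma Ck_on_bilinear:
  assumes P: "bounded_bilinear B" and U: "open U" and "Ck_on k U f" "Ck_on k U g"
  shows "Ck_on k U (\<lambda>x. B (f x) (g x))"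
  using assms(3,4)
proof (induction k arbitrary: f g)
  case 0
  then show ?case
    using P bounded_bilinear.continuous_on by auto
next
  case (Suc k)
  show ?case
  proof (rule Ck_on_SucI[OF U])
    show "((\<lambda>x. B (f x) (g x)) has_derivative
        (\<lambda>v. B (f x) (frechet_derivative g (at x) v) + B (frechet_derivative f (at x) v) (g x))) (at x)"
      if "x \<in> U" for x
      by (rule bounded_bilinear.FDERIV[OF P Suc.prems[THEN Ck_on_Suc_has_derivative, OF that]])
    have fg: "Ck_on k U f" "Ck_on k U g"
      by (rule Suc.prems[THEN Ck_on_SucD])+
    show "Ck_on k U (\<lambda>x. B (f x) (frechet_derivative g (at x) v) + B (frechet_derivative f (at x) v) (g x))" for v
      by (rule Ck_on_add[OF U]; rule Suc.IH) (use Suc.prems fg in simp_all)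
  qed
qed

lemma Ck_on_Pair:
  assumes U: "open U" and "Ck_on k U f" "Ck_on k U g"
  shows "Ck_on k U (\<lambda>x. (f x, g x))"
proof -
  have "Ck_on k U (\<lambda>x. (f x, 0) + (0, g x))"
    by (rule Ck_on_add[OF U Ck_on_linear_image[OF _ U assms(2)] Ck_on_linear_image[OF _ U assms(3)]])
      (simp_all add: bounded_linear_Pair bounded_linear_ident bounded_linear_zero)
  then show ?thesis by simp
qed

lemma smooth_on_subset: "smooth_on U f \<Longrightarrow> V \<subseteq> U \<Longrightarrow> smooth_on V f"
  unfolding smooth_on_def by (meson Ck_on_subset)

lemma smooth_on_imp_continuous_on: "smooth_on U f \<Longrightarrow> continuous_on U f"
  unfolding smooth_on_def by (meson Ck_on_imp_continuous_on)

lemma smooth_on_const: "smooth_on U (\<lambda>x. c)"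
  by (simp add: smooth_on_def Ck_on_const)

lemma smooth_on_bounded_linear: "bounded_linear L \<Longrightarrow> smooth_on U L"
  by (simp add: smooth_on_def Ck_on_bounded_linear)

lemma smooth_on_linear_image:
  "bounded_linear L \<Longrightarrow> open U \<Longrightarrow> smooth_on U f \<Longrightarrow> smooth_on U (\<lambda>x. L (f x))"
  by (simp add: smooth_on_def Ck_on_linear_image)

lemma smooth_on_affine_arg:
  "bounded_linear L \<Longrightarrow> open U \<Longrightarrow> (\<And>x. x \<in> U \<Longrightarrow> L x + a \<in> V) \<Longrightarrow> smooth_on V f \<Longrightarrow>
    smooth_on U (\<lambda>x. f (L x + a))"
  unfolding smooth_on_def using Ck_on_affine_arg[of L U a V _ f] by blast

lemma smooth_on_linear_arg:
  "bounded_linear L \<Longrightarrow> open U \<Longrightarrow> (\<And>x. x \<in> U \<Longrightarrow> L x \<in> V) \<Longrightarrow> smooth_on V f \<Longrightarrow>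
    smooth_on U (\<lambda>x. f (L x))"
  unfolding smooth_on_def using Ck_on_linear_arg[of L U V _ f] by blast

lemma smooth_on_add:
  "open U \<Longrightarrow> smooth_on U f \<Longrightarrow> smooth_on U g \<Longrightarrow> smooth_on U (\<lambda>x. f x + g x)"
  by (simp add: smooth_on_def Ck_on_add)

lemma smooth_on_sum:
  "open U \<Longrightarrow> (\<And>i. i \<in> I \<Longrightarrow> smooth_on U (f i)) \<Longrightarrow> smooth_on U (\<lambda>x. \<Sum>i\<in>I. f i x)"
  by (simp add: smooth_on_def Ck_on_sum)

lemma smooth_on_bilinear:
  "bounded_bilinear B \<Longrightarrow> open U \<Longrightarrow> smooth_on U f \<Longrightarrow> smooth_on U g \<Longrightarrow>
    smooth_on U (\<lambda>x. B (f x) (g x))"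
  by (simp add: smooth_on_def Ck_on_bilinear)

lemmas smooth_on_mult = smooth_on_bilinear[OF bounded_bilinear_mult]
  and smooth_on_scaleR = smooth_on_bilinear[OF bounded_bilinear_scaleR]
  and smooth_on_inner = smooth_on_bilinear[OF bounded_bilinear_inner]

lemma smooth_on_Pair:
  "open U \<Longrightarrow> smooth_on U f \<Longrightarrow> smooth_on U g \<Longrightarrow> smooth_on U (\<lambda>x. (f x, g x))"
  by (simp add: smooth_on_def Ck_on_Pair)

lemma smooth_on_derivative:
  assumes "open U" "smooth_on U f" "\<And>x. x \<in> U \<Longrightarrow> (f has_derivative f' x) (at x)"
  shows "smooth_on U (\<lambda>x. f' x v)"
  unfolding smooth_on_def
proof
  show "Ck_on k U (\<lambda>x. f' x v)" for k
    by (rule Ck_on_SucE[OF assms(1) _ assms(3)]) (use assms(2) in \<open>simp_all only: smooth_on_def\<close>)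
qed

lemma smooth_on_has_derivative:
  "smooth_on U f \<Longrightarrow> x \<in> U \<Longrightarrow> (f has_derivative frechet_derivative f (at x)) (at x)"
  by (rule Ck_on_Suc_has_derivative[of 0]) (simp_all only: smooth_on_def)

lemma smooth_on_ident: "smooth_on U (\<lambda>x. x)"
  by (rule smooth_on_bounded_linear) (rule bounded_linear_ident)

lemma smooth_on_real_polynomial:
  fixes p :: "'a::euclidean_space \<Rightarrow> real"
  assumes "real_polynomial_function p" "open U"
  shows "smooth_on U p"
  using assms(1)
  by induction (simp_all add: smooth_on_bounded_linear smooth_on_const smooth_on_add smooth_on_mult assms(2))


section \<open>Parametrised submanifolds\<close>

lemma tangent_space_UNIV: "tangent_space UNIV x = UNIV"
proof -
  have "v \<in> tangent_space UNIV x" for v :: 'a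
  proof -
    have "smooth_on {-1<..<1::real} (\<lambda>t. x + t *\<^sub>R v)"
      by (intro smooth_on_add smooth_on_const smooth_on_bounded_linear bounded_linear_scaleR_left) simp
    moreover have "((\<lambda>t. x + t *\<^sub>R v) has_vector_derivative v) (at 0)"
      by (auto intro!: derivative_eq_intros)
    ultimately show ?thesis
      unfolding tangent_space_def
      by (auto intro!: exI[of _ 1] exI[of _ "\<lambda>t. x + t *\<^sub>R v"])
  qed
  then show ?thesis by auto
qed

lemma smooth_submanifold_UNIV: "smooth_submanifold DIM('a) (UNIV :: 'a::euclidean_space set)"
  unfolding smooth_submanifold_def
proof
  fix x :: 'a
  show "\<exists>U V \<Phi> \<Psi> L. open U \<and> x \<in> U \<and> open V \<and> homeomorphism U V \<Phi> \<Psi> \<and>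
        smooth_on U \<Phi> \<and> smooth_on V \<Psi> \<and> subspace (L :: 'a set) \<and> dim L = DIM('a) \<and>
        \<Phi> ` (U \<inter> UNIV) = V \<inter> L"
    by (rule exI[of _ UNIV], rule exI[of _ UNIV], rule exI[of _ "\<lambda>x. x"], rule exI[of _ "\<lambda>x. x"],
        rule exI[of _ UNIV])
      (simp add: smooth_on_ident homeomorphism_ident)
qed

section \<open>Projections, orthonormal bases and traces\<close>

lemma orth_proj_props:
  fixes L :: "'a::euclidean_space set"
  assumes L: "subspace L"
  shows "orth_proj L v \<in> L" and "w \<in> L \<Longrightarrow> orth_proj L v \<bullet> w = v \<bullet> w"
proof -
  obtain y z where yz: "y \<in> span L" "\<And>w. w \<in> span L \<Longrightarrow> orthogonal z w" "v = y + z"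
    using orthogonal_subspace_decomp_exists[of L v] by metis
  have ex: "y \<in> L \<and> (\<forall>w\<in>L. (v - y) \<bullet> w = 0)"
  proof
    show "y \<in> L" using yz(1) L by (metis span_eq_iff)
    show "\<forall>w\<in>L. (v - y) \<bullet> w = 0"
      using yz(2,3) by (simp add: orthogonal_def span_base)
  qed
  have "u = y" if u: "u \<in> L \<and> (\<forall>w\<in>L. (v - u) \<bullet> w = 0)" for u
  proof -
    have "u - y \<in> L" using u ex L by (auto intro: subspace_diff)
    then have "(v - y) \<bullet> (u - y) = 0" "(v - u) \<bullet> (u - y) = 0" using u ex by auto
    then have "(u - y) \<bullet> (u - y) = 0" by (simp add: inner_diff_left inner_diff_right)
    then show ?thesis by simp
  qed
  with ex have "orth_proj L v = y"
    unfolding orth_proj_def by (rule the_equality)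
  then show "orth_proj L v \<in> L" "w \<in> L \<Longrightarrow> orth_proj L v \<bullet> w = v \<bullet> w"
    using ex by (simp_all add: inner_diff_left)
qed

lemma orthonormal_basis_of_exists:
  fixes L :: "'a::euclidean_space set"
  assumes "subspace L"
  shows "\<exists>B. orthonormal_basis_of L B"
  using orthonormal_basis_subspace[OF assms] unfolding orthonormal_basis_of_def by metis

lemma orthonormal_basis_of_finite:
  fixes L :: "'a::euclidean_space set"
  assumes "orthonormal_basis_of L B"
  shows "finite B"
proof -
  have "0 \<notin> B" using assms unfolding orthonormal_basis_of_def by fastforce
  then have "independent B"
    using assms pairwise_orthogonal_independent unfolding orthonormal_basis_of_def by blast
  then show ?thesis by (rule independent_imp_finite)
qed

lemma orthonormal_basis_of_inner:
  assumes "orthonormal_basis_of L B" "a \<in> B" "b \<in> B"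
  shows "a \<bullet> b = (if a = b then 1 else 0)"
  using assms unfolding orthonormal_basis_of_def pairwise_def orthogonal_def
  by (auto simp: norm_eq_1)

lemma orthonormal_basis_of_expand:
  fixes L :: "'a::euclidean_space set"
  assumes B: "orthonormal_basis_of L B" and "x \<in> L"
  shows "x = (\<Sum>b\<in>B. (x \<bullet> b) *\<^sub>R b)"
proof -
  note fin = orthonormal_basis_of_finite[OF B]
  have "x \<in> span B" using assms unfolding orthonormal_basis_of_def by auto
  then obtain c where c: "x = (\<Sum>b\<in>B. c b *\<^sub>R b)"
    using span_finite[OF fin] by auto
  have "x \<bullet> b = c b" if "b \<in> B" for b
  proof -
    have "x \<bullet> b = (\<Sum>a\<in>B. c a * (if a = b then 1 else 0))"
      unfolding c inner_sum_left by (rule sum.cong) (auto simp: orthonormal_basis_of_inner[OF B _ that])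
    also have "\<dots> = (\<Sum>a\<in>B. if a = b then c a else 0)" by (rule sum.cong) auto
    finally show ?thesis using that fin by simp
  qed
  then have "(\<Sum>b\<in>B. (x \<bullet> b) *\<^sub>R b) = (\<Sum>b\<in>B. c b *\<^sub>R b)" by simp
  then show ?thesis using c by simp
qed

text \<open>Expanding the elements of \<open>B\<close> in \<open>C\<close> produces the coefficients
  \<Sum> (e \<bullet> a) (e \<bullet> b) over \<open>e \<in> B\<close>, which equal
  \<open>a \<bullet> b\<close> by Parseval. This frees the mean curvature vector from the basis
  picked by \<open>SOME\<close>.\<close>

lemma trace_orthonormal_bases:
  fixes \<beta> :: "'a::euclidean_space \<Rightarrow> 'a \<Rightarrow> 'b::real_vector"
  assumes B: "orthonormal_basis_of L B" and C: "orthonormal_basis_of L C"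
    and l1: "\<And>y. linear (\<lambda>x. \<beta> x y)" and l2: "\<And>x. linear (\<beta> x)"
  shows "(\<Sum>e\<in>B. \<beta> e e) = (\<Sum>e\<in>C. \<beta> e e)"
proof -
  note finB = orthonormal_basis_of_finite[OF B] and finC = orthonormal_basis_of_finite[OF C]
  have BL: "B \<subseteq> L" "C \<subseteq> L" using B C unfolding orthonormal_basis_of_def by auto
  have ex: "\<beta> e e = (\<Sum>a\<in>C. \<Sum>b\<in>C. ((e \<bullet> a) * (e \<bullet> b)) *\<^sub>R \<beta> a b)" if "e \<in> B" for e
  proof -
    have e: "e = (\<Sum>b\<in>C. (e \<bullet> b) *\<^sub>R b)"
      using orthonormal_basis_of_expand[OF C] that BL by auto
    have "\<beta> e e = (\<Sum>a\<in>C. (e \<bullet> a) *\<^sub>R \<beta> a e)"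
      by (subst e) (simp add: linear_sum[OF l1] linear_cmul[OF l1])
    also have "\<dots> = (\<Sum>a\<in>C. (e \<bullet> a) *\<^sub>R (\<Sum>b\<in>C. (e \<bullet> b) *\<^sub>R \<beta> a b))"
      by (rule sum.cong[OF refl], subst (2) e) (simp add: linear_sum[OF l2] linear_cmul[OF l2])
    finally show ?thesis by (simp add: scaleR_sum_right)
  qed
  have d: "(\<Sum>e\<in>B. (e \<bullet> a) * (e \<bullet> b)) = a \<bullet> b" if "a \<in> C" "b \<in> C" for a b
  proof -
    have "a = (\<Sum>e\<in>B. (a \<bullet> e) *\<^sub>R e)" using orthonormal_basis_of_expand[OF B] that BL by auto
    then have "a \<bullet> b = (\<Sum>e\<in>B. (a \<bullet> e) *\<^sub>R e) \<bullet> b" by (rule arg_cong)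
    also have "\<dots> = (\<Sum>e\<in>B. (e \<bullet> a) * (e \<bullet> b))"
      by (simp add: inner_sum_left inner_commute[of a])
    finally show ?thesis ..
  qed
  have "(\<Sum>e\<in>B. \<beta> e e) = (\<Sum>e\<in>B. \<Sum>a\<in>C. \<Sum>b\<in>C. ((e \<bullet> a) * (e \<bullet> b)) *\<^sub>R \<beta> a b)"
    using ex by simp
  also have "\<dots> = (\<Sum>a\<in>C. \<Sum>b\<in>C. \<Sum>e\<in>B. ((e \<bullet> a) * (e \<bullet> b)) *\<^sub>R \<beta> a b)"
    by (subst sum.swap) (rule sum.cong[OF refl], rule sum.swap)
  also have "\<dots> = (\<Sum>a\<in>C. \<Sum>b\<in>C. (a \<bullet> b) *\<^sub>R \<beta> a b)"
    by (intro sum.cong refl) (simp add: d flip: scaleR_sum_left)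
  also have "\<dots> = (\<Sum>a\<in>C. \<Sum>b\<in>C. if a = b then \<beta> a b else 0)"
    by (intro sum.cong refl) (simp add: orthonormal_basis_of_inner[OF C])
  also have "\<dots> = (\<Sum>a\<in>C. \<beta> a a)" using finC by simp
  finally show ?thesis .
qed

text \<open>The parametrisation \<open>X\<close> need not be injective: \<open>pr\<close> is a linear right inverse of it on
  \<open>M\<close>, and directions along which \<open>X\<close> is constant are killed by \<open>X'\<close>.\<close>

locale parametrised =
  fixes U :: "'p::euclidean_space set" and X :: "'p \<Rightarrow> 'e::euclidean_space"
    and X' :: "'p \<Rightarrow> 'p \<Rightarrow> 'e" and X'' :: "'p \<Rightarrow> 'p \<Rightarrow> 'p \<Rightarrow> 'e" and pr :: "'e \<Rightarrow> 'p"
  assumes open_U: "open U" and smooth_X: "smooth_on U X"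
    and deriv_X: "x \<in> U \<Longrightarrow> (X has_derivative X' x) (at x)"
    and deriv_X': "x \<in> U \<Longrightarrow> ((\<lambda>x. X' x u) has_derivative X'' x u) (at x)"
    and linear_pr: "bounded_linear pr"
    and pr_mem: "x \<in> U \<Longrightarrow> pr (X x) \<in> U" and X_pr: "x \<in> U \<Longrightarrow> X (pr (X x)) = X x"
begin

lemma linear_X': "x \<in> U \<Longrightarrow> bounded_linear (X' x)"
  using deriv_X has_derivative_bounded_linear by blast

lemma linear_X'': "x \<in> U \<Longrightarrow> bounded_linear (X'' x u)"
  using deriv_X' has_derivative_bounded_linear by blast

lemma X'_expand: "x \<in> U \<Longrightarrow> X' x u = (\<Sum>b\<in>Basis. (u \<bullet> b) *\<^sub>R X' x b)"
proof -
  assume x: "x \<in> U"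
  have "X' x u = X' x (\<Sum>b\<in>Basis. (u \<bullet> b) *\<^sub>R b)" by (simp add: euclidean_representation)
  then show ?thesis
    using linear_X'[OF x] by (simp add: linear_sum linear_cmul bounded_linear.linear)
qed

text \<open>Linearity of \<open>X''\<close> in its first vector is inherited from \<open>X'\<close>:
  differentiate the coordinate expansion of \<open>X'\<close> and use uniqueness of
  derivatives.\<close>

lemma X''_expand: "x \<in> U \<Longrightarrow> X'' x u v = (\<Sum>b\<in>Basis. (u \<bullet> b) *\<^sub>R X'' x b v)"
proof -
  assume x: "x \<in> U"
  have "((\<lambda>x. \<Sum>b\<in>Basis. (u \<bullet> b) *\<^sub>R X' x b) has_derivative (\<lambda>v. \<Sum>b\<in>Basis. (u \<bullet> b) *\<^sub>R X'' x b v)) (at x)"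
    using deriv_X'[OF x] by (auto intro!: derivative_eq_intros)
  then have "((\<lambda>x. X' x u) has_derivative (\<lambda>v. \<Sum>b\<in>Basis. (u \<bullet> b) *\<^sub>R X'' x b v)) (at x)"
    by (rule has_derivative_transform_within_open[OF _ open_U x]) (simp add: X'_expand[symmetric])
  from has_derivative_unique[OF deriv_X'[OF x] this] show ?thesis by metis
qed

lemma linear_X''_left:
  assumes x: "x \<in> U"
  shows "linear (\<lambda>u. X'' x u v)"
proof -
  have "(\<lambda>u. X'' x u v) = (\<lambda>u. \<Sum>b\<in>Basis. (u \<bullet> b) *\<^sub>R X'' x b v)"
    by (rule ext) (rule X''_expand[OF x])
  then show ?thesis
    by (simp only:)
      (intro linear_compose_sum ballI linearI; simp add: inner_add_left scaleR_left_distrib)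
qed

lemma smooth_X': "smooth_on U (\<lambda>x. X' x u)"
  by (rule smooth_on_derivative[OF open_U smooth_X deriv_X])

lemma X'_mem_tangent:
  assumes x: "x \<in> U"
  shows "X' x u \<in> tangent_space (X ` U) (X x)"
proof -
  let ?g = "\<lambda>t::real. t *\<^sub>R u + x"
  have "continuous_on UNIV ?g" by (intro continuous_intros)
  then have "open (?g -` U)" using open_U by (simp add: open_vimage)
  moreover have "0 \<in> ?g -` U" using x by simp
  ultimately obtain e where e: "e > 0" "ball 0 e \<subseteq> ?g -` U" using openE by blast
  then have sub: "\<And>t. t \<in> {-e<..<e} \<Longrightarrow> ?g t \<in> U" by (auto simp: dist_norm subset_iff)
  have "smooth_on {-e<..<e} (\<lambda>t. X (?g t))"
    by (rule smooth_on_affine_arg[OF bounded_linear_scaleR_left _ sub smooth_X]) auto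
  moreover have "((\<lambda>t. X (?g t)) has_vector_derivative X' x u) (at 0)"
  proof -
    have "(?g has_derivative (\<lambda>t. t *\<^sub>R u)) (at 0)" by (auto intro!: derivative_eq_intros)
    from has_derivative_compose[OF this, of X "X' x"] deriv_X[OF x]
    have "((\<lambda>t. X (?g t)) has_derivative (\<lambda>t. X' x (t *\<^sub>R u))) (at 0)" by simp
    then show ?thesis
      using linear_X'[OF x]
      by (simp add: has_vector_derivative_def bounded_linear.linear linear_cmul)
  qed
  ultimately show ?thesis
    unfolding tangent_space_def using e sub
    by (auto intro!: exI[of _ e] exI[of _ "\<lambda>t. X (?g t)"])
qed

text \<open>Every point of the image is fixed by \<open>X\<close> after \<open>pr\<close>, so
  differentiating \<open>X (pr (g t)) = g t\<close> along a curve recovers its velocity.\<close>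

lemma tangent_eq_X':
  assumes x: "x \<in> U" "pr (X x) = x" and v: "v \<in> tangent_space (X ` U) (X x)"
  shows "X' x (pr v) = v"
proof -
  obtain e g where e: "e > 0" "g ` {-e<..<e} \<subseteq> X ` U" "g 0 = X x"
      "(g has_vector_derivative v) (at (0::real))"
    using v unfolding tangent_space_def by auto
  have eq: "X (pr (g t)) = g t" if t: "t \<in> {-e<..<e}" for t
  proof -
    obtain z where "z \<in> U" "g t = X z" using e(2) t by blast
    then show ?thesis using X_pr by simp
  qed
  have g': "(g has_derivative (\<lambda>t. t *\<^sub>R v)) (at 0)"
    using e(4) by (simp add: has_vector_derivative_def)
  have "((\<lambda>t. X (pr (g t))) has_derivative (\<lambda>t. X' x (pr (t *\<^sub>R v)))) (at 0)"
    by (rule has_derivative_compose[OF bounded_linear.has_derivative[OF linear_pr g'], of X "X' x"])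
      (simp add: e(3) x deriv_X)
  then have "(g has_derivative (\<lambda>t. X' x (pr (t *\<^sub>R v)))) (at 0)"
    by (rule has_derivative_transform_within_open[where s="{-e<..<e}"]) (use e(1) eq in auto)
  from has_derivative_unique[OF this g'] have "X' x (pr (1 *\<^sub>R v)) = 1 *\<^sub>R v" by metis
  then show ?thesis by simp
qed

lemma tangent_space_eq:
  assumes "x \<in> U" "pr (X x) = x"
  shows "tangent_space (X ` U) (X x) = range (X' x)"
  using X'_mem_tangent[OF assms(1)] tangent_eq_X'[OF assms] by (metis image_subset_iff rangeI subsetI subset_antisym)

lemma subspace_tangent:
  assumes "x \<in> U" "pr (X x) = x"
  shows "subspace (tangent_space (X ` U) (X x))"
  unfolding tangent_space_eq[OF assms]
  using linear_subspace_image[OF bounded_linear.linear[OF linear_X'[OF assms(1)]] subspace_UNIV] .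

text \<open>The field \<open>X' (pr y) (pr w)\<close> makes sense on an open set of the ambient
  space because \<open>pr\<close> does. Its existence gives the \<open>SOME\<close> in
  \<open>second_fundamental_form\<close> its meaning.\<close>

lemma tangent_extension_exists:
  assumes x: "x \<in> U" "pr (X x) = x" and w: "w \<in> tangent_space (X ` U) (X x)"
  shows "\<exists>W. tangent_extension (X ` U) (X x) w W"
proof -
  have op: "open (pr -` U)"
    by (rule open_vimage[OF open_U]) (simp add: linear_pr linear_continuous_on)
  have "smooth_on (pr -` U) (\<lambda>y. X' (pr y) (pr w))"
    by (rule smooth_on_linear_arg[OF linear_pr op _ smooth_X']) auto
  moreover have "X' (pr y) (pr w) \<in> tangent_space (X ` U) y" if "y \<in> pr -` U \<inter> X ` U" for y
    using X'_mem_tangent[of "pr y" "pr w"] that X_pr by auto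
  ultimately have "tangent_extension (X ` U) (X x) w (\<lambda>y. X' (pr y) (pr w))"
    unfolding tangent_extension_def using op x tangent_eq_X'[OF x w] by auto
  then show ?thesis by blast
qed

text \<open>On the image, \<open>W y = X' (pr y) (pr (W y))\<close>. In the product rule the term
  that differentiates \<open>pr (W y)\<close> is tangent, and the other one is \<open>X''\<close>;
  so the normal part does not depend on the extension.\<close>

lemma tangent_extension_derivative:
  assumes x: "x \<in> U" "pr (X x) = x" and W: "tangent_extension (X ` U) (X x) w W"
    and v: "v \<in> tangent_space (X ` U) (X x)"
  shows "\<exists>u. frechet_derivative W (at (X x)) v = X' x u + X'' x (pr w) (pr v)"
proof -
  obtain V where V: "open V" "X x \<in> V" "smooth_on V W"
      "\<And>y. y \<in> V \<inter> X ` U \<Longrightarrow> W y \<in> tangent_space (X ` U) y" and Wx: "W (X x) = w"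
    using W unfolding tangent_extension_def by auto
  let ?D = "frechet_derivative W (at (X x))"
  have contX: "continuous_on U X" by (rule smooth_on_imp_continuous_on[OF smooth_X])
  define U1 where "U1 = U \<inter> X -` V"
  have U1: "open U1" unfolding U1_def using continuous_on_open_vimage[OF open_U] contX V(1)
    by (metis Int_commute)
  have x1: "x \<in> U1" using x V unfolding U1_def by auto
  \<comment> \<open>Base point and direction both move with \<open>z\<close>; coordinates separate
    them into scalar and vector factors to which the product rule applies.\<close>
  have eq: "(\<Sum>b\<in>Basis. (pr (W (X z)) \<bullet> b) *\<^sub>R X' (pr (X z)) b) = W (X z)" if z: "z \<in> U1" for z
  proof -
    have zU: "z \<in> U" using z unfolding U1_def by auto
    have "W (X z) \<in> tangent_space (X ` U) (X (pr (X z)))"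
      using V(4)[of "X z"] z X_pr[OF zU] unfolding U1_def by auto
    then have "X' (pr (X z)) (pr (W (X z))) = W (X z)"
      by (intro tangent_eq_X') (auto simp: pr_mem X_pr zU)
    then show ?thesis using X'_expand[OF pr_mem[OF zU], of "pr (W (X z))"] by metis
  qed
  have dX: "(X has_derivative X' x) (at x)" by (rule deriv_X[OF x(1)])
  have dW: "((\<lambda>z. W (X z)) has_derivative (\<lambda>u. ?D (X' x u))) (at x)"
    by (rule has_derivative_compose[OF dX smooth_on_has_derivative[OF V(3,2)]])
  have dpW: "((\<lambda>z. pr (W (X z))) has_derivative (\<lambda>u. pr (?D (X' x u)))) (at x)"
    by (rule bounded_linear.has_derivative[OF linear_pr dW])
  have dpX: "((\<lambda>z. pr (X z)) has_derivative (\<lambda>u. pr (X' x u))) (at x)"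
    by (rule bounded_linear.has_derivative[OF linear_pr dX])
  have dX'': "((\<lambda>z. X' (pr (X z)) b) has_derivative (\<lambda>u. X'' x b (pr (X' x u)))) (at x)" for b
    by (rule has_derivative_compose[OF dpX]) (simp add: x deriv_X')
  have "((\<lambda>z. \<Sum>b\<in>Basis. (pr (W (X z)) \<bullet> b) *\<^sub>R X' (pr (X z)) b) has_derivative
      (\<lambda>u. \<Sum>b\<in>Basis. (pr (W (X x)) \<bullet> b) *\<^sub>R X'' x b (pr (X' x u)) + (pr (?D (X' x u)) \<bullet> b) *\<^sub>R X' (pr (X x)) b)) (at x)"
    by (intro has_derivative_sum has_derivative_scaleR has_derivative_inner_left dpW dX'')
  then have "((\<lambda>z. W (X z)) has_derivative
      (\<lambda>u. \<Sum>b\<in>Basis. (pr (W (X x)) \<bullet> b) *\<^sub>R X'' x b (pr (X' x u)) + (pr (?D (X' x u)) \<bullet> b) *\<^sub>R X' (pr (X x)) b)) (at x)"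
    by (rule has_derivative_transform_within_open[OF _ U1 x1 eq])
  from has_derivative_unique[OF dW this]
  have "?D (X' x (pr v)) =
      (\<Sum>b\<in>Basis. (pr w \<bullet> b) *\<^sub>R X'' x b (pr (X' x (pr v))) + (pr (?D (X' x (pr v))) \<bullet> b) *\<^sub>R X' x b)"
    by (simp add: Wx x(2) fun_eq_iff)
  then have "?D v = X'' x (pr w) (pr v) + X' x (pr (?D v))"
    by (simp only: tangent_eq_X'[OF x v] sum.distrib flip: X'_expand[OF x(1), of "pr (?D v)"] X''_expand[OF x(1), of "pr w"])
  then show ?thesis by (metis add.commute)
qed

text \<open>Both \<open>SOME\<close> choices drop out: the extension by
  \<open>tangent_extension_derivative\<close>, the basis by \<open>trace_orthonormal_bases\<close>.
  As the mean curvature vector is itself normal, it vanishes once it is orthogonal to all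
  normals.\<close>

theorem mean_curvature_vector_eq_0_iff:
  assumes x: "x \<in> U" "pr (X x) = x" and N: "subspace (tangent_space N (X x))"
    and B: "orthonormal_basis_of (tangent_space (X ` U) (X x)) B"
  shows "mean_curvature_vector N (X ` U) (X x) = 0 \<longleftrightarrow>
    (\<forall>\<nu>\<in>normal_space N (X ` U) (X x). (\<Sum>e\<in>B. X'' x (pr e) (pr e)) \<bullet> \<nu> = 0)"
proof -
  let ?T = "tangent_space (X ` U) (X x)" and ?N = "normal_space N (X ` U) (X x)"
  have sN: "subspace ?N"
    using N unfolding normal_space_def subspace_def by (auto simp: inner_add_left)
  define C where "C = (SOME B. orthonormal_basis_of ?T B)"
  have C: "orthonormal_basis_of ?T C" unfolding C_def using B by (rule someI)
  define W where "W e = (SOME W. tangent_extension (X ` U) (X x) e W)" for e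
  have CT: "e \<in> ?T" if "e \<in> C" for e using C that unfolding orthonormal_basis_of_def by auto
  have W: "tangent_extension (X ` U) (X x) e (W e)" if "e \<in> C" for e
    unfolding W_def by (rule someI_ex[OF tangent_extension_exists[OF x CT[OF that]]])
  define H where "H = mean_curvature_vector N (X ` U) (X x)"
  have H: "H = (\<Sum>e\<in>C. orth_proj ?N (frechet_derivative (W e) (at (X x)) e))"
    unfolding H_def mean_curvature_vector_def second_fundamental_form_def C_def W_def ..
  have HN: "H \<in> ?N" unfolding H by (intro subspace_sum sN orth_proj_props)
  have II: "orth_proj ?N (frechet_derivative (W e) (at (X x)) e) \<bullet> \<nu> = X'' x (pr e) (pr e) \<bullet> \<nu>"
    if \<nu>: "\<nu> \<in> ?N" and e: "e \<in> C" for \<nu> e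
  proof -
    obtain u where u: "frechet_derivative (W e) (at (X x)) e = X' x u + X'' x (pr e) (pr e)"
      using tangent_extension_derivative[OF x W[OF e] CT[OF e]] by blast
    have "X' x u \<bullet> \<nu> = 0"
      using X'_mem_tangent[OF x(1), of u] \<nu> unfolding normal_space_def by (auto simp: inner_commute)
    then show ?thesis using u orth_proj_props(2)[OF sN \<nu>] by (simp add: inner_add_left)
  qed
  have l1: "linear (\<lambda>e. X'' x (pr e) (pr e'))" for e'
    using linear_compose[OF bounded_linear.linear[OF linear_pr] linear_X''_left[OF x(1)]]
    by (simp add: o_def)
  have l2: "linear (\<lambda>e'. X'' x (pr e) (pr e'))" for e
    using linear_compose[OF bounded_linear.linear[OF linear_pr] bounded_linear.linear[OF linear_X''[OF x(1)]]]
    by (simp add: o_def)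
  have tr: "(\<Sum>e\<in>C. X'' x (pr e) (pr e)) = (\<Sum>e\<in>B. X'' x (pr e) (pr e))"
    by (rule trace_orthonormal_bases[OF C B, where \<beta>="\<lambda>e e'. X'' x (pr e) (pr e')"]) (rule l1 l2)+
  have "H \<bullet> \<nu> = (\<Sum>e\<in>B. X'' x (pr e) (pr e)) \<bullet> \<nu>" if "\<nu> \<in> ?N" for \<nu>
    unfolding H tr[symmetric] inner_sum_left by (rule sum.cong) (auto simp: II that)
  moreover have "H = 0 \<longleftrightarrow> (\<forall>\<nu>\<in>?N. H \<bullet> \<nu> = 0)"
    using HN by (metis inner_eq_zero_iff inner_zero_left)
  ultimately show ?thesis unfolding H_def by auto
qed

end


section \<open>Real analytic functions\<close>

text \<open>Real analytic functions of one variable are restrictions of holomorphic ones.\<close>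

definition analytic_real :: "real set \<Rightarrow> (real \<Rightarrow> real) \<Rightarrow> bool" where
  "analytic_real U f \<longleftrightarrow> (\<forall>a\<in>U. \<exists>r>0. \<exists>g. g holomorphic_on ball (of_real a) r \<and>
     (\<forall>x. \<bar>x - a\<bar> < r \<longrightarrow> g (of_real x) = of_real (f x)))"

lemma analytic_realE:
  assumes "analytic_real U f" "a \<in> U"
  obtains r g where "r > 0" "g holomorphic_on ball (of_real a) r"
    "\<And>x. \<bar>x - a\<bar> < r \<Longrightarrow> g (of_real x) = of_real (f x)"
  using assms unfolding analytic_real_def by blast

lemma of_real_mem_ball: "(of_real x :: complex) \<in> ball (of_real a) r \<longleftrightarrow> \<bar>x - a\<bar> < r"
  unfolding mem_ball dist_of_real dist_real_def by (subst abs_minus_commute) (rule refl)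

text \<open>The imaginary part of \<open>g\<close> is zero on the interval, hence so is that of its
  derivative along the real axis, which is the complex derivative.\<close>

lemma analytic_real_derivative_aux:
  assumes r: "g holomorphic_on ball (of_real a) r"
    and g: "\<And>x. \<bar>x - a\<bar> < r \<Longrightarrow> g (of_real x) = of_real (f x)" and x: "\<bar>x - a\<bar> < r"
  shows "(f has_real_derivative deriv f x) (at x) \<and> deriv g (of_real x) = of_real (deriv f x)"
proof -
  let ?D = "deriv g (of_real x)"
  have "(g has_field_derivative ?D) (at (of_real x))"
    by (rule holomorphic_derivI[OF r]) (simp_all only: open_ball of_real_mem_ball x)
  then have D: "((\<lambda>t. g (of_real t)) has_vector_derivative ?D) (at x)"
    by (rule has_vector_derivative_real_field)
  have nh: "x \<in> ball a r" "open (ball a r)" using x by (auto simp: dist_norm)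
  have D': "((\<lambda>t. complex_of_real (f t)) has_vector_derivative ?D) (at x)"
    by (rule has_vector_derivative_transform_within_open[OF D nh(2,1)])
      (auto simp: g dist_norm abs_minus_commute)
  have Re: "(f has_vector_derivative Re ?D) (at x)"
    using bounded_linear.has_vector_derivative[OF bounded_linear_Re D'] by simp
  have "((\<lambda>t. 0) has_vector_derivative Im ?D) (at x)"
    using bounded_linear.has_vector_derivative[OF bounded_linear_Im D'] by simp
  then have "Im ?D = 0"
    by (metis has_vector_derivative_const vector_derivative_at)
  moreover have "(f has_real_derivative Re ?D) (at x)"
    using Re by (simp add: has_real_derivative_iff_has_vector_derivative)
  moreover from this have "deriv f x = Re ?D" by (rule DERIV_imp_deriv)
  ultimately show ?thesis by (auto simp: complex_eq_iff)
qed

lemma analytic_real_has_derivative: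
  assumes "analytic_real U f" "x \<in> U"
  shows "(f has_real_derivative deriv f x) (at x)"
proof -
  obtain r g where "r > 0" "g holomorphic_on ball (of_real x) r"
    "\<And>y. \<bar>y - x\<bar> < r \<Longrightarrow> g (of_real y) = of_real (f y)"
    using analytic_realE[OF assms] by blast
  then show ?thesis using analytic_real_derivative_aux[of g x r f x] by simp
qed

lemma analytic_real_deriv:
  assumes "analytic_real U f"
  shows "analytic_real U (deriv f)"
  unfolding analytic_real_def
proof
  fix a assume a: "a \<in> U"
  obtain r g where rg: "r > 0" "g holomorphic_on ball (of_real a) r"
    "\<And>y. \<bar>y - a\<bar> < r \<Longrightarrow> g (of_real y) = of_real (f y)"
    using analytic_realE[OF assms a] by blast
  then show "\<exists>r>0. \<exists>g. g holomorphic_on ball (of_real a) r \<and>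
     (\<forall>x. \<bar>x - a\<bar> < r \<longrightarrow> g (of_real x) = of_real (deriv f x))"
    using analytic_real_derivative_aux[of g a r f] by (auto intro!: holomorphic_deriv)
qed

lemma analytic_real_isCont: "analytic_real U f \<Longrightarrow> x \<in> U \<Longrightarrow> isCont f x"
  using analytic_real_has_derivative DERIV_isCont by blast

lemma analytic_real_cong:
  assumes "analytic_real U f" "\<And>a. a \<in> U \<Longrightarrow> \<exists>e>0. \<forall>x. \<bar>x - a\<bar> < e \<longrightarrow> f x = g x"
  shows "analytic_real U g"
  unfolding analytic_real_def
proof
  fix a assume a: "a \<in> U"
  obtain r h where rg: "r > 0" "h holomorphic_on ball (of_real a) r"
    "\<And>y. \<bar>y - a\<bar> < r \<Longrightarrow> h (of_real y) = of_real (f y)"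
    using analytic_realE[OF assms(1) a] by blast
  obtain e where e: "e > 0" "\<And>x. \<bar>x - a\<bar> < e \<Longrightarrow> f x = g x" using assms(2)[OF a] by blast
  have "h holomorphic_on ball (of_real a) (min r e)"
    by (rule holomorphic_on_subset[OF rg(2)]) auto
  then show "\<exists>r>0. \<exists>h. h holomorphic_on ball (of_real a) r \<and>
     (\<forall>x. \<bar>x - a\<bar> < r \<longrightarrow> h (of_real x) = of_real (g x))"
    using rg e by (intro exI[of _ "min r e"] exI[of _ h] conjI) auto
qed

lemma analytic_real_compose:
  assumes g: "analytic_real V g" and f: "analytic_real U f" and sub: "\<And>x. x \<in> U \<Longrightarrow> f x \<in> V"
  shows "analytic_real U (\<lambda>x. g (f x))"
  unfolding analytic_real_def
proof
  fix a assume a: "a \<in> U"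
  obtain r F where F: "r > 0" "F holomorphic_on ball (of_real a) r"
    "\<And>y. \<bar>y - a\<bar> < r \<Longrightarrow> F (of_real y) = of_real (f y)"
    using analytic_realE[OF f a] by blast
  obtain s G where G: "s > 0" "G holomorphic_on ball (of_real (f a)) s"
    "\<And>y. \<bar>y - f a\<bar> < s \<Longrightarrow> G (of_real y) = of_real (g y)"
    using analytic_realE[OF g sub[OF a]] by blast
  have Fa: "F (of_real a) = of_real (f a)" using F by simp
  have "isCont F (of_real a)"
    using F(1,2) by (metis centre_in_ball continuous_on_interior holomorphic_on_imp_continuous_on interior_open open_ball)
  then obtain d where d: "d > 0" "\<And>z. dist z (of_real a) < d \<Longrightarrow> dist (F z) (of_real (f a)) < s"
    unfolding continuous_at_eps_delta using G(1) Fa by (metis)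
  have "(G \<circ> F) holomorphic_on ball (of_real a) (min r d)"
  proof (rule holomorphic_on_compose_gen[OF _ G(2)])
    show "F holomorphic_on ball (of_real a) (min r d)" by (rule holomorphic_on_subset[OF F(2)]) auto
    show "F ` ball (of_real a) (min r d) \<subseteq> ball (of_real (f a)) s"
      using d(2) by (auto simp: dist_commute)
  qed
  moreover have "(G \<circ> F) (of_real x) = of_real (g (f x))" if x: "\<bar>x - a\<bar> < min r d" for x
  proof -
    have "dist (complex_of_real x) (of_real a) < d"
      using x by (simp add: dist_norm flip: of_real_diff)
    then have "dist (F (of_real x)) (of_real (f a)) < s" by (rule d(2))
    then have "\<bar>f x - f a\<bar> < s" using F(3)[of x] x by (simp add: dist_norm flip: of_real_diff)
    then show ?thesis using F(3)[of x] G(3)[of "f x"] x by simp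
  qed
  ultimately show "\<exists>r>0. \<exists>h. h holomorphic_on ball (of_real a) r \<and>
     (\<forall>x. \<bar>x - a\<bar> < r \<longrightarrow> h (of_real x) = of_real (g (f x)))"
    using F(1) d(1) by (intro exI[of _ "min r d"] exI[of _ "G \<circ> F"]) auto
qed

lemma analytic_real_mult:
  assumes "analytic_real U f" "analytic_real U g"
  shows "analytic_real U (\<lambda>x. f x * g x)"
  unfolding analytic_real_def
proof
  fix a assume a: "a \<in> U"
  obtain r F where F: "r > 0" "F holomorphic_on ball (of_real a) r"
    "\<And>y. \<bar>y - a\<bar> < r \<Longrightarrow> F (of_real y) = of_real (f y)"
    using analytic_realE[OF assms(1) a] by blast
  obtain s G where G: "s > 0" "G holomorphic_on ball (of_real a) s"
    "\<And>y. \<bar>y - a\<bar> < s \<Longrightarrow> G (of_real y) = of_real (g y)"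
    using analytic_realE[OF assms(2) a] by blast
  have "F holomorphic_on ball (of_real a) (min r s)" "G holomorphic_on ball (of_real a) (min r s)"
    by (rule holomorphic_on_subset[OF F(2)] holomorphic_on_subset[OF G(2)]; auto)+
  then have "(\<lambda>z. F z * G z) holomorphic_on ball (of_real a) (min r s)"
    by (rule holomorphic_on_mult)
  then show "\<exists>r>0. \<exists>h. h holomorphic_on ball (of_real a) r \<and>
     (\<forall>x. \<bar>x - a\<bar> < r \<longrightarrow> h (of_real x) = of_real (f x * g x))"
    using F G by (intro exI[of _ "min r s"] exI[of _ "\<lambda>z. F z * G z"]) auto
qed

lemma analytic_real_holomorphic:
  assumes "\<And>a. a \<in> U \<Longrightarrow> r a > 0" "\<And>a. a \<in> U \<Longrightarrow> g holomorphic_on ball (of_real a) (r a)"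
    and "\<And>a x. a \<in> U \<Longrightarrow> \<bar>x - a\<bar> < r a \<Longrightarrow> g (of_real x) = of_real (f x)"
  shows "analytic_real U f"
  unfolding analytic_real_def using assms by blast

lemma analytic_real_exp: "analytic_real U exp"
  by (rule analytic_real_holomorphic[where r="\<lambda>_. 1" and g=exp])
    (auto simp: holomorphic_on_exp exp_of_real)

lemma analytic_real_const_mult: "analytic_real U (\<lambda>x. c * x)"
  by (rule analytic_real_holomorphic[where r="\<lambda>_. 1" and g="\<lambda>x. of_real c * x"])
    (auto intro!: holomorphic_intros)

lemma analytic_real_power: "analytic_real U (\<lambda>x. x ^ k)"
  by (rule analytic_real_holomorphic[where r="\<lambda>_. 1" and g="\<lambda>x. x ^ k"])
    (auto intro!: holomorphic_intros)

lemma analytic_real_ln: "analytic_real {0<..} ln"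
proof (rule analytic_real_holomorphic[where r="\<lambda>a. a" and g=Ln])
  fix a :: real assume a: "a \<in> {0<..}"
  show "Ln holomorphic_on ball (of_real a) a"
  proof -
    have False if "z \<in> ball (complex_of_real a) a" "z \<in> \<real>\<^sub>\<le>\<^sub>0" for z
    proof -
    have "\<bar>a - Re z\<bar> \<le> cmod (of_real a - z)" using abs_Re_le_cmod[of "of_real a - z"] by simp
    with that show False by (auto simp: dist_norm complex_nonpos_Reals_iff)
    qed
    then show ?thesis by (intro holomorphic_on_Ln) blast
  qed
qed (auto simp: Ln_of_real)

lemma analytic_real_power_series:
  fixes c :: "nat \<Rightarrow> real"
  assumes R: "R > 0" and s: "summable (\<lambda>j. \<bar>c j\<bar> * R ^ j)"
    and f: "\<And>x. \<bar>x - a\<bar> < R \<Longrightarrow> f x = (\<Sum>j. c j * (x - a) ^ j)"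
  shows "analytic_real {x. \<bar>x - a\<bar> < R} f"
proof (rule analytic_real_holomorphic[where r="\<lambda>x. R - \<bar>x - a\<bar>"
      and g="\<lambda>z. \<Sum>j. of_real (c j) * (z - of_real a) ^ j"])
  have sm: "(\<lambda>n. complex_of_real (c n) * (w - of_real a) ^ n) sums (\<Sum>j. of_real (c j) * (w - of_real a) ^ j)"
    if "w \<in> ball (of_real a) R" for w
  proof (rule summable_sums, rule summable_norm_cancel, rule summable_comparison_test'[OF s])
    fix n :: nat
    have "cmod (w - of_real a) \<le> R" using that by (simp add: dist_norm norm_minus_commute)
    then show "norm (norm (complex_of_real (c n) * (w - of_real a) ^ n)) \<le> \<bar>c n\<bar> * R ^ n"
      by (auto simp: norm_mult norm_power intro!: mult_left_mono power_mono)
  qed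
  have hol: "(\<lambda>z. \<Sum>j. of_real (c j) * (z - of_real a) ^ j) holomorphic_on ball (of_real a) R"
    by (rule power_series_holomorphic[OF sm])
  show "(\<lambda>z. \<Sum>j. of_real (c j) * (z - of_real a) ^ j) holomorphic_on ball (of_real b) (R - \<bar>b - a\<bar>)"
    for b :: real
  proof (rule holomorphic_on_subset[OF hol])
    show "ball (complex_of_real b) (R - \<bar>b - a\<bar>) \<subseteq> ball (of_real a) R"
    proof
      fix z assume "z \<in> ball (complex_of_real b) (R - \<bar>b - a\<bar>)"
      moreover have "dist (complex_of_real a) (of_real b) = \<bar>b - a\<bar>"
        by (simp add: dist_norm abs_minus_commute flip: of_real_diff)
      ultimately show "z \<in> ball (of_real a) R"
        using dist_triangle[of "complex_of_real a" z "of_real b"] by simp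
    qed
  qed
  fix b x :: real assume "\<bar>x - b\<bar> < R - \<bar>b - a\<bar>"
  then have xR: "\<bar>x - a\<bar> < R" by linarith
  have "summable (\<lambda>j. c j * (x - a) ^ j)"
    by (rule summable_comparison_test'[OF s])
      (use xR in \<open>auto simp: abs_mult power_abs intro!: mult_left_mono power_mono\<close>)
  from suminf_of_real[OF this, where 'a=complex]
  show "(\<Sum>j. of_real (c j) * (of_real x - of_real a) ^ j) = complex_of_real (f x)"
    using f[OF xR] by simp
qed auto

lemma analytic_real_expansion:
  assumes "analytic_real U f" "a \<in> U"
  shows "\<exists>r>0. \<exists>c. summable (\<lambda>j. \<bar>c j\<bar> * r ^ j) \<and> (\<forall>x. \<bar>x - a\<bar> < r \<longrightarrow> (\<lambda>j. c j * (x - a) ^ j) sums f x)"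
proof -
  obtain r g where rg: "r > 0" "g holomorphic_on ball (of_real a) r"
    "\<And>y. \<bar>y - a\<bar> < r \<Longrightarrow> g (of_real y) = of_real (f y)"
    using analytic_realE[OF assms] by blast
  define c where "c n = Re ((deriv ^^ n) g (of_real a) / fact n)" for n
  have s: "(\<lambda>n. c n * (x - a) ^ n) sums f x" if x: "\<bar>x - a\<bar> < r" for x
  proof -
    have "(\<lambda>n. (deriv ^^ n) g (of_real a) / fact n * (of_real x - of_real a) ^ n) sums g (of_real x)"
      by (rule holomorphic_power_series[OF rg(2)]) (simp only: of_real_mem_ball x)
    from sums_Re[OF this]
    have "(\<lambda>n. Re ((deriv ^^ n) g (of_real a) / fact n * of_real ((x - a) ^ n))) sums f x"
      using rg(3)[OF x] by simp
    moreover have "Re (z * of_real t) = Re z * t" for z t by simp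
    ultimately show ?thesis unfolding c_def by (simp only:)
  qed
  \<comment> \<open>Convergence at \<open>r / 2\<close> yields absolute convergence at
    \<open>r / 4\<close>, the radius that is finally reported.\<close>
  have "summable (\<lambda>n. c n * (r/2) ^ n)"
    using s[of "a + r/2"] rg(1) by (auto simp: sums_iff)
  then have "summable (\<lambda>n. norm (c n * (r/4) ^ n))"
    by (rule powser_insidea) (use rg(1) in auto)
  then have "summable (\<lambda>n. \<bar>c n\<bar> * (r/4) ^ n)" using rg(1) by (simp add: abs_mult)
  then show ?thesis using s rg(1) by (intro exI[of _ "r/4"] conjI exI[of _ c]) auto
qed

text \<open>The derivative contains \<open>deriv G\<close> composed with \<open>h\<close>, again of
  the assumed kind; so the induction generalises over \<open>G\<close>.\<close>

lemma Ck_on_analytic_compose: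
  fixes h :: "'a::euclidean_space \<Rightarrow> real"
  assumes U: "open U" and h: "smooth_on U h" and sub: "\<And>x. x \<in> U \<Longrightarrow> h x \<in> V"
    and G: "analytic_real V G"
  shows "Ck_on k U (\<lambda>x. G (h x))"
  using G
proof (induction k arbitrary: G)
  case 0
  have "continuous_on V G"
    using 0 analytic_real_isCont continuous_at_imp_continuous_on by blast
  then show ?case
    using continuous_on_compose2[OF _ smooth_on_imp_continuous_on[OF h], of V G] sub
    by (simp add: image_subset_iff)
next
  case (Suc k)
  show ?case
  proof (rule Ck_on_SucI[OF U])
    fix x assume x: "x \<in> U"
    have "(G has_derivative (\<lambda>t. deriv G (h x) * t)) (at (h x))"
      using analytic_real_has_derivative[OF Suc.prems sub[OF x]] by (simp add: has_field_derivative_def)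
    from has_derivative_compose[OF smooth_on_has_derivative[OF h x] this]
    show "((\<lambda>x. G (h x)) has_derivative (\<lambda>v. deriv G (h x) * frechet_derivative h (at x) v)) (at x)" .
  next
    have "Ck_on (Suc k) U h" using h by (simp only: smooth_on_def)
    then have "Ck_on k U (\<lambda>x. frechet_derivative h (at x) v)" for v by simp
    then show "Ck_on k U (\<lambda>x. deriv G (h x) * frechet_derivative h (at x) v)" for v
      by (rule Ck_on_bilinear[OF bounded_bilinear_mult U Suc.IH[OF analytic_real_deriv[OF Suc.prems]]])
  qed
qed

lemma smooth_on_analytic_compose:
  fixes h :: "'a::euclidean_space \<Rightarrow> real"
  assumes "open U" "smooth_on U h" "\<And>x. x \<in> U \<Longrightarrow> h x \<in> V" "analytic_real V G"
  shows "smooth_on U (\<lambda>x. G (h x))"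
  unfolding smooth_on_def by (rule allI) (rule Ck_on_analytic_compose[OF assms])


subsection \<open>Multivariate power series\<close>

abbreviation multi_indices :: "('a::euclidean_space \<Rightarrow> nat) set" where
  "multi_indices \<equiv> Basis \<rightarrow>\<^sub>E UNIV"

definition monom_at :: "'a::euclidean_space \<Rightarrow> ('a \<Rightarrow> nat) \<Rightarrow> real" where
  "monom_at y \<alpha> = (\<Prod>b\<in>Basis. (y \<bullet> b) ^ \<alpha> b)"

definition total_degree :: "('a::euclidean_space \<Rightarrow> nat) \<Rightarrow> nat" where
  "total_degree \<alpha> = (\<Sum>b\<in>Basis. \<alpha> b)"

text \<open>\<open>N\<close> bounds the weighted \<open>\<ell>\<^sup>1\<close> norm of the coefficients, which is submultiplicative.\<close>

definition expands_at :: "'a::euclidean_space \<Rightarrow> real \<Rightarrow> real \<Rightarrow> ('a \<Rightarrow> real) \<Rightarrow> bool" where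
  "expands_at a r N f \<longleftrightarrow> r > 0 \<and> (\<exists>c M.
     ((\<lambda>\<alpha>. \<bar>c \<alpha>\<bar> * r ^ total_degree \<alpha>) has_sum M) multi_indices \<and> M \<le> N \<and>
     (\<forall>x\<in>ball a r. ((\<lambda>\<alpha>. c \<alpha> * monom_at (x - a) \<alpha>) has_sum f x) multi_indices))"

lemma abs_monom_at_le:
  assumes "norm y \<le> r"
  shows "\<bar>monom_at y \<alpha>\<bar> \<le> r ^ total_degree \<alpha>"
proof -
  have "\<bar>monom_at y \<alpha>\<bar> = (\<Prod>b\<in>Basis. \<bar>y \<bullet> b\<bar> ^ \<alpha> b)"
    by (simp add: monom_at_def abs_prod power_abs)
  also have "\<dots> \<le> (\<Prod>b\<in>Basis. r ^ \<alpha> b)"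
    by (rule prod_mono) (use assms Basis_le_norm order_trans in \<open>fastforce intro!: power_mono\<close>)
  finally show ?thesis by (simp add: total_degree_def power_sum)
qed

lemma summable_on_monom_at:
  assumes "norm y \<le> r" "(\<lambda>i. \<bar>d i\<bar> * r ^ total_degree (m i)) summable_on I"
  shows "(\<lambda>i. d i * monom_at y (m i)) summable_on I"
  by (rule abs_summable_summable, rule Infinite_Sum.abs_summable_on_comparison_test'[OF assms(2)])
    (auto simp: abs_mult intro!: mult_left_mono abs_monom_at_le assms(1))

text \<open>A series over an arbitrary index set may meet the same monomial repeatedly. Grouping
  over the fibres \<open>J\<close> gives a proper expansion, and the triangle inequality keeps the
  weighted norm from growing. Products and infinite sums are reduced to this.\<close>

lemma expands_at_reindex:
  fixes m :: "'i \<Rightarrow> 'a::euclidean_space \<Rightarrow> nat"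
  assumes r: "r > 0" and m: "\<And>i. i \<in> I \<Longrightarrow> m i \<in> multi_indices"
    and M: "((\<lambda>i. \<bar>d i\<bar> * r ^ total_degree (m i)) has_sum M) I" "M \<le> N"
    and f: "\<And>x. x \<in> ball a r \<Longrightarrow> ((\<lambda>i. d i * monom_at (x - a) (m i)) has_sum f x) I"
  shows "expands_at a r N f"
proof -
  define J where "J \<alpha> = {i \<in> I. m i = \<alpha>}" for \<alpha>
  have bij: "bij_betw (\<lambda>i. (m i, i)) I (Sigma multi_indices J)"
    by (rule bij_betwI[where g=snd]) (auto simp: J_def m)
  have abs: "((\<lambda>(\<alpha>, i). \<bar>d i\<bar> * r ^ total_degree \<alpha>) has_sum M) (Sigma multi_indices J)"
    by (subst has_sum_reindex_bij_betw[OF bij, symmetric]) (simp add: M(1))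
  have absJ: "(\<lambda>i. \<bar>d i\<bar> * r ^ total_degree \<alpha>) summable_on J \<alpha>" if "\<alpha> \<in> multi_indices" for \<alpha>
    by (rule summable_on_SigmaD1[OF _ that, where f="\<lambda>\<alpha> i. \<bar>d i\<bar> * r ^ total_degree \<alpha>"])
      (use abs has_sum_imp_summable in blast)
  have absd: "(\<lambda>i. \<bar>d i\<bar>) summable_on J \<alpha>" if "\<alpha> \<in> multi_indices" for \<alpha>
    using absJ[OF that] summable_on_cmult_left'[of "r ^ total_degree \<alpha>" "\<lambda>i. \<bar>d i\<bar>" "J \<alpha>"] r by simp
  define c where "c \<alpha> = infsum d (J \<alpha>)" for \<alpha>
  have c: "(d has_sum c \<alpha>) (J \<alpha>)" if "\<alpha> \<in> multi_indices" for \<alpha>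
    unfolding c_def by (rule has_sum_infsum, rule abs_summable_summable) (use absd[OF that] in simp)
  have cle: "\<bar>c \<alpha>\<bar> \<le> infsum (\<lambda>i. \<bar>d i\<bar>) (J \<alpha>)" if "\<alpha> \<in> multi_indices" for \<alpha>
    using norm_infsum_bound[of d "J \<alpha>"] absd[OF that] unfolding c_def by simp
  have S: "((\<lambda>\<alpha>. infsum (\<lambda>i. \<bar>d i\<bar>) (J \<alpha>) * r ^ total_degree \<alpha>) has_sum M) multi_indices"
    by (rule has_sum_SigmaD[OF abs]) (use absd in \<open>auto intro!: has_sum_cmult_left\<close>)
  have Sc: "(\<lambda>\<alpha>. \<bar>c \<alpha>\<bar> * r ^ total_degree \<alpha>) summable_on multi_indices"
    by (rule summable_on_comparison_test[OF has_sum_imp_summable[OF S]])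
      (use cle r in \<open>auto intro!: mult_right_mono\<close>)
  have "infsum (\<lambda>\<alpha>. \<bar>c \<alpha>\<bar> * r ^ total_degree \<alpha>) multi_indices \<le> M"
    by (rule has_sum_mono[OF has_sum_infsum[OF Sc] S]) (use cle r in \<open>auto intro!: mult_right_mono\<close>)
  moreover have "((\<lambda>\<alpha>. c \<alpha> * monom_at (x - a) \<alpha>) has_sum f x) multi_indices" if x: "x \<in> ball a r" for x
  proof (rule has_sum_SigmaD)
    show "((\<lambda>(\<alpha>, i). d i * monom_at (x - a) \<alpha>) has_sum f x) (Sigma multi_indices J)"
      by (subst has_sum_reindex_bij_betw[OF bij, symmetric]) (simp add: f[OF x])
    show "((\<lambda>i. case (\<alpha>, i) of (\<alpha>, i) \<Rightarrow> d i * monom_at (x - a) \<alpha>) has_sum c \<alpha> * monom_at (x - a) \<alpha>) (J \<alpha>)"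
      if "\<alpha> \<in> multi_indices" for \<alpha>
      using has_sum_cmult_left[OF c[OF that]] by simp
  qed
  ultimately show ?thesis
    unfolding expands_at_def using r M(2) has_sum_infsum[OF Sc]
    by (intro conjI exI[of _ c] exI[of _ "infsum (\<lambda>\<alpha>. \<bar>c \<alpha>\<bar> * r ^ total_degree \<alpha>) multi_indices"]) auto
qed

lemma expands_atD:
  assumes "expands_at a r N f"
  shows "\<exists>c M. r > 0 \<and> ((\<lambda>\<alpha>. \<bar>c \<alpha>\<bar> * r ^ total_degree \<alpha>) has_sum M) multi_indices \<and> 0 \<le> M \<and> M \<le> N \<and>
    (\<forall>x\<in>ball a r. ((\<lambda>\<alpha>. c \<alpha> * monom_at (x - a) \<alpha>) has_sum f x) multi_indices \<and> \<bar>f x\<bar> \<le> M)"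
proof -
  obtain c M where c: "r > 0" "((\<lambda>\<alpha>. \<bar>c \<alpha>\<bar> * r ^ total_degree \<alpha>) has_sum M) multi_indices" "M \<le> N"
    "\<And>x. x \<in> ball a r \<Longrightarrow> ((\<lambda>\<alpha>. c \<alpha> * monom_at (x - a) \<alpha>) has_sum f x) multi_indices"
    using assms unfolding expands_at_def by blast
  have "0 \<le> M" by (rule has_sum_nonneg[OF c(2)]) (use c(1) in auto)
  moreover have "\<bar>f x\<bar> \<le> M" if x: "x \<in> ball a r" for x
  proof -
    have "norm (x - a) \<le> r" using x by (simp add: dist_norm norm_minus_commute)
    then have "norm (f x) \<le> M"
      by (intro norm_infsum_le[OF c(4)[OF x] c(2)]) (auto simp: abs_mult intro!: mult_left_mono abs_monom_at_le)
    then show ?thesis by simp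
  qed
  ultimately show ?thesis using c by (intro exI[of _ c] exI[of _ M]) simp
qed

lemma total_degree_zero: "total_degree (\<lambda>b\<in>Basis. 0) = 0"
  by (simp add: total_degree_def)

lemma expands_at_const: "r > 0 \<Longrightarrow> \<bar>k\<bar> \<le> N \<Longrightarrow> expands_at a r N (\<lambda>x. k)"
  by (rule expands_at_reindex[where I="{()}" and m="\<lambda>_. \<lambda>b\<in>Basis. 0" and d="\<lambda>_. k" and M="\<bar>k\<bar>"])
    (auto simp: total_degree_zero monom_at_def intro!: has_sum_finiteI)

lemma expands_at_coord:
  assumes b: "b \<in> Basis" and "r > 0" "r \<le> N"
  shows "expands_at a r N (\<lambda>x. (x - a) \<bullet> b)"
proof (rule expands_at_reindex[where I="{()}" and m="\<lambda>_. \<lambda>c\<in>Basis. if c = b then 1 else 0" and d="\<lambda>_. 1" and M="r"])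
  have "total_degree (\<lambda>c\<in>Basis. if c = b then 1 else 0 :: nat) = 1"
    using b by (simp add: total_degree_def)
  then show "((\<lambda>i. \<bar>1\<bar> * r ^ total_degree (\<lambda>c\<in>Basis. if c = b then 1 else 0 :: nat)) has_sum r) {()}"
    by (auto intro!: has_sum_finiteI)
  have "monom_at y (\<lambda>c\<in>Basis. if c = b then 1 else 0) = y \<bullet> b" for y
  proof -
    have "monom_at y (\<lambda>c\<in>Basis. if c = b then 1 else 0) = (\<Prod>c\<in>Basis. if c = b then y \<bullet> c else 1)"
      unfolding monom_at_def by (rule prod.cong) auto
    then show ?thesis using b by simp
  qed
  then show "((\<lambda>i. 1 * monom_at (x - a) (\<lambda>c\<in>Basis. if c = b then 1 else 0)) has_sum (x - a) \<bullet> b) {()}" for x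
    by (auto intro!: has_sum_finiteI)
qed (use assms in auto)

lemma expands_at_add:
  assumes "expands_at a r N f" "expands_at a r N' g"
  shows "expands_at a r (N + N') (\<lambda>x. f x + g x)"
proof -
  obtain c M where c: "r > 0" "((\<lambda>\<alpha>. \<bar>c \<alpha>\<bar> * r ^ total_degree \<alpha>) has_sum M) multi_indices" "M \<le> N"
    "\<And>x. x \<in> ball a r \<Longrightarrow> ((\<lambda>\<alpha>. c \<alpha> * monom_at (x - a) \<alpha>) has_sum f x) multi_indices"
    using expands_atD[OF assms(1)] by blast
  obtain c' M' where c': "((\<lambda>\<alpha>. \<bar>c' \<alpha>\<bar> * r ^ total_degree \<alpha>) has_sum M') multi_indices" "M' \<le> N'"
    "\<And>x. x \<in> ball a r \<Longrightarrow> ((\<lambda>\<alpha>. c' \<alpha> * monom_at (x - a) \<alpha>) has_sum g x) multi_indices"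
    using expands_atD[OF assms(2)] by blast
  have s: "((\<lambda>\<alpha>. \<bar>c \<alpha>\<bar> * r ^ total_degree \<alpha> + \<bar>c' \<alpha>\<bar> * r ^ total_degree \<alpha>) has_sum (M + M')) multi_indices"
    by (rule has_sum_add[OF c(2) c'(1)])
  have le: "\<bar>c \<alpha> + c' \<alpha>\<bar> * r ^ total_degree \<alpha> \<le> \<bar>c \<alpha>\<bar> * r ^ total_degree \<alpha> + \<bar>c' \<alpha>\<bar> * r ^ total_degree \<alpha>" for \<alpha>
    using c(1) by (simp flip: distrib_right add: mult_right_mono)
  have S: "(\<lambda>\<alpha>. \<bar>c \<alpha> + c' \<alpha>\<bar> * r ^ total_degree \<alpha>) summable_on multi_indices"
    by (rule summable_on_comparison_test[OF has_sum_imp_summable[OF s] le]) (use c(1) in simp)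
  have "infsum (\<lambda>\<alpha>. \<bar>c \<alpha> + c' \<alpha>\<bar> * r ^ total_degree \<alpha>) multi_indices \<le> M + M'"
    by (rule has_sum_mono[OF has_sum_infsum[OF S] s le])
  then show ?thesis
    unfolding expands_at_def using c(1,3) c'(2) has_sum_infsum[OF S] has_sum_add[OF c(4) c'(3)]
    by (intro conjI exI[of _ "\<lambda>\<alpha>. c \<alpha> + c' \<alpha>"] exI[of _ "infsum (\<lambda>\<alpha>. \<bar>c \<alpha> + c' \<alpha>\<bar> * r ^ total_degree \<alpha>) multi_indices"])
      (auto simp: distrib_right)
qed

text \<open>Pairs of multi-indices serve as index set: exponents add, monomials multiply, and the
  absolutely convergent double series of norms factorises.\<close>

lemma expands_at_mult:
  assumes "expands_at a r N f" "expands_at a r N' g"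
  shows "expands_at a r (N * N') (\<lambda>x. f x * g x)"
proof -
  obtain c M where c: "r > 0" "((\<lambda>\<alpha>. \<bar>c \<alpha>\<bar> * r ^ total_degree \<alpha>) has_sum M) multi_indices" "0 \<le> M" "M \<le> N"
    "\<And>x. x \<in> ball a r \<Longrightarrow> ((\<lambda>\<alpha>. c \<alpha> * monom_at (x - a) \<alpha>) has_sum f x) multi_indices"
    using expands_atD[OF assms(1)] by blast
  obtain c' M' where c': "((\<lambda>\<alpha>. \<bar>c' \<alpha>\<bar> * r ^ total_degree \<alpha>) has_sum M') multi_indices" "0 \<le> M'" "M' \<le> N'"
    "\<And>x. x \<in> ball a r \<Longrightarrow> ((\<lambda>\<alpha>. c' \<alpha> * monom_at (x - a) \<alpha>) has_sum g x) multi_indices"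
    using expands_atD[OF assms(2)] by blast
  define m where "m p = (\<lambda>b\<in>Basis. fst p b + snd p b)" for p :: "('a \<Rightarrow> nat) \<times> ('a \<Rightarrow> nat)"
  define d where "d p = c (fst p) * c' (snd p)" for p
  have dg: "total_degree (m p) = total_degree (fst p) + total_degree (snd p)" for p
    by (simp add: total_degree_def m_def sum.distrib)
  have mn: "monom_at y (m p) = monom_at y (fst p) * monom_at y (snd p)" for y p
    by (simp add: monom_at_def m_def power_add prod.distrib)
  let ?F = "\<lambda>p. (\<bar>c (fst p)\<bar> * r ^ total_degree (fst p)) * (\<bar>c' (snd p)\<bar> * r ^ total_degree (snd p))"
  have "?F summable_on multi_indices \<times> multi_indices"
    by (rule summable_on_SigmaI[where g="\<lambda>\<alpha>. (\<bar>c \<alpha>\<bar> * r ^ total_degree \<alpha>) * M'"])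
      (use c c' has_sum_imp_summable in \<open>auto intro!: has_sum_cmult_right summable_on_cmult_left\<close>)
  then have F: "(?F has_sum M * M') (multi_indices \<times> multi_indices)"
    by (intro has_sum_SigmaI[where g="\<lambda>\<alpha>. (\<bar>c \<alpha>\<bar> * r ^ total_degree \<alpha>) * M'"])
      (auto intro!: has_sum_cmult_right has_sum_cmult_left c c')
  show ?thesis
  proof (rule expands_at_reindex[OF c(1), where I="multi_indices \<times> multi_indices" and m=m and d=d and M="M*M'"])
    have eq: "?F = (\<lambda>i. \<bar>d i\<bar> * r ^ total_degree (m i))"
      by (auto simp: fun_eq_iff d_def dg power_add abs_mult)
    show F': "((\<lambda>i. \<bar>d i\<bar> * r ^ total_degree (m i)) has_sum M * M') (multi_indices \<times> multi_indices)"
      using F unfolding eq .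
    show "M * M' \<le> N * N'" using c c' by (intro mult_mono) auto
    fix x assume x: "x \<in> ball a r"
    have nx: "norm (x - a) \<le> r" using x by (simp add: dist_norm norm_minus_commute)
    show "((\<lambda>i. d i * monom_at (x - a) (m i)) has_sum f x * g x) (multi_indices \<times> multi_indices)"
    proof (rule has_sum_SigmaI[where g="\<lambda>\<alpha>. (c \<alpha> * monom_at (x - a) \<alpha>) * g x"])
      show "(\<lambda>i. d i * monom_at (x - a) (m i)) summable_on multi_indices \<times> multi_indices"
        by (rule summable_on_monom_at[OF nx has_sum_imp_summable[OF F']])
      show "((\<lambda>\<alpha>. (c \<alpha> * monom_at (x - a) \<alpha>) * g x) has_sum f x * g x) multi_indices"
        by (rule has_sum_cmult_left[OF c(5)[OF x]])
      fix \<alpha> :: "'a \<Rightarrow> nat"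
      show "((\<lambda>j. d (\<alpha>, j) * monom_at (x - a) (m (\<alpha>, j))) has_sum c \<alpha> * monom_at (x - a) \<alpha> * g x) multi_indices"
        using has_sum_cmult_right[OF c'(4)[OF x], of "c \<alpha> * monom_at (x - a) \<alpha>"]
        by (simp add: d_def mn mult_ac)
    qed
  qed (auto simp: m_def)
qed

lemma expands_at_power:
  assumes "expands_at a r N f"
  shows "expands_at a r (N ^ k) (\<lambda>x. f x ^ k)"
proof (induction k)
  case 0
  have "r > 0" using assms unfolding expands_at_def by blast
  then show ?case by (simp add: expands_at_const)
next
  case (Suc k)
  then show ?case using expands_at_mult[OF assms Suc] by simp
qed

text \<open>Summable norm bounds make the double series over the summation index and the
  multi-indices absolutely convergent, so it may be regrouped by monomials.\<close>

lemma expands_at_sums: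
  assumes f: "\<And>j. expands_at a r (N j) (f j)" and N: "summable N"
    and g: "\<And>x. x \<in> ball a r \<Longrightarrow> (\<lambda>j. f j x) sums g x"
  shows "expands_at a r (suminf N) g"
proof -
  have r: "r > 0" using f[of 0] unfolding expands_at_def by (rule conjunct1)
  define Q where "Q j c M \<longleftrightarrow> r > 0 \<and> ((\<lambda>\<alpha>. \<bar>c \<alpha>\<bar> * r ^ total_degree \<alpha>) has_sum M) multi_indices \<and> 0 \<le> M \<and> M \<le> N j \<and>
     (\<forall>x\<in>ball a r. ((\<lambda>\<alpha>. c \<alpha> * monom_at (x - a) \<alpha>) has_sum f j x) multi_indices \<and> \<bar>f j x\<bar> \<le> M)" for j c M
  have "\<exists>c M. Q j c M" for j unfolding Q_def by (rule expands_atD[OF f[of j]])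
  then obtain c M where Q: "\<And>j. Q j (c j) (M j)" by metis
  have c: "\<And>j. ((\<lambda>\<alpha>. \<bar>c j \<alpha>\<bar> * r ^ total_degree \<alpha>) has_sum M j) multi_indices"
     "\<And>j. 0 \<le> M j" "\<And>j. M j \<le> N j"
     "\<And>j x. x \<in> ball a r \<Longrightarrow> ((\<lambda>\<alpha>. c j \<alpha> * monom_at (x - a) \<alpha>) has_sum f j x) multi_indices"
     "\<And>j x. x \<in> ball a r \<Longrightarrow> \<bar>f j x\<bar> \<le> M j"
    using Q by (simp_all add: Q_def)
  have sM: "summable M" by (rule summable_comparison_test'[OF N]) (use c in auto)
  have hM: "(M has_sum suminf M) UNIV"
    by (rule norm_summable_imp_has_sum) (use sM c(2) in \<open>auto intro: summable_sums\<close>)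
  let ?d = "\<lambda>p. c (fst p) (snd p)"
  show ?thesis
  proof (rule expands_at_reindex[OF r, where I="UNIV \<times> multi_indices" and m=snd and d="?d" and M="suminf M"])
    show "suminf M \<le> suminf N" by (rule suminf_le[OF c(3) sM N])
    have "(\<lambda>i. \<bar>?d i\<bar> * r ^ total_degree (snd i)) summable_on UNIV \<times> multi_indices"
      by (rule summable_on_SigmaI[where g=M]) (use c(1) r has_sum_imp_summable[OF hM] in auto)
    then show F: "((\<lambda>i. \<bar>?d i\<bar> * r ^ total_degree (snd i)) has_sum suminf M) (UNIV \<times> multi_indices)"
      by (intro has_sum_SigmaI[where g=M]) (use c(1) hM in auto)
    fix x assume x: "x \<in> ball a r"
    have nx: "norm (x - a) \<le> r" using x by (simp add: dist_norm norm_minus_commute)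
    have "summable (\<lambda>j. norm (f j x))" by (rule summable_comparison_test'[OF sM]) (use c(5)[OF x] in auto)
    then have hf: "((\<lambda>j. f j x) has_sum g x) UNIV" by (rule norm_summable_imp_has_sum[OF _ g[OF x]])
    show "((\<lambda>i. ?d i * monom_at (x - a) (snd i)) has_sum g x) (UNIV \<times> multi_indices)"
      by (rule has_sum_SigmaI[where g="\<lambda>j. f j x", OF _ hf summable_on_monom_at[OF nx has_sum_imp_summable[OF F]]])
        (use c(4)[OF x] in simp)
  qed auto
qed

lemma expands_at_cong:
  assumes "expands_at a r N f" "\<And>x. x \<in> ball a r \<Longrightarrow> f x = g x"
  shows "expands_at a r N g"
proof -
  have "(\<forall>x\<in>ball a r. (h x has_sum f x) A) \<longleftrightarrow> (\<forall>x\<in>ball a r. (h x has_sum g x) A)"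
    for h :: "'a \<Rightarrow> ('a \<Rightarrow> nat) \<Rightarrow> real" and A
    using assms(2) by (intro ball_cong) simp_all
  then show ?thesis using assms(1) unfolding expands_at_def by (simp only:)
qed

lemma expands_at_sum:
  assumes "r > 0" "\<And>i. i \<in> I \<Longrightarrow> expands_at a r (N i) (f i)"
  shows "expands_at a r (\<Sum>i\<in>I. N i) (\<lambda>x. \<Sum>i\<in>I. f i x)"
  using assms(2)
proof (induction I rule: infinite_finite_induct)
  case (insert i I)
  then show ?case using expands_at_add[of a r "N i" "f i"] by simp
qed (simp_all add: expands_at_const assms(1))

text \<open>Substitution into the power series of \<open>G\<close> at \<open>h a\<close>: the
  \<open>j\<close>-th term has norm at most \<open>\<bar>c j\<bar> * N r ^ j\<close>, and since
  \<open>N r\<close> tends to 0 it falls below the radius of convergence for small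
  \<open>r\<close>.\<close>

lemma expands_at_analytic_compose:
  assumes G: "analytic_real V G" "h a \<in> V"
    and h: "\<And>r. r > 0 \<Longrightarrow> expands_at a r (N r) (\<lambda>x. h x - h a)"
    and N: "(N \<longlongrightarrow> 0) (at_right 0)"
  shows "\<exists>r0>0. \<forall>r. 0 < r \<and> r < r0 \<longrightarrow> (\<exists>N. expands_at a r N (\<lambda>x. G (h x)))"
proof -
  obtain \<rho> c where c: "\<rho> > 0" "summable (\<lambda>j. \<bar>c j\<bar> * \<rho> ^ j)"
    "\<And>y. \<bar>y - h a\<bar> < \<rho> \<Longrightarrow> (\<lambda>j. c j * (y - h a) ^ j) sums G y"
    using analytic_real_expansion[OF G] by blast
  have "eventually (\<lambda>r. N r < \<rho>) (at_right 0)" using order_tendstoD(2)[OF N c(1)] .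
  then obtain r0 where r0: "r0 > 0" "\<And>r. 0 < r \<Longrightarrow> r < r0 \<Longrightarrow> N r < \<rho>"
    unfolding eventually_at_right_field by auto
  have "expands_at a r (\<Sum>j. \<bar>c j\<bar> * N r ^ j) (\<lambda>x. G (h x))" if r: "0 < r" "r < r0" for r
  proof (rule expands_at_sums[where f="\<lambda>j x. c j * (h x - h a) ^ j"])
    obtain M where M: "0 \<le> M" "M \<le> N r" "\<And>x. x \<in> ball a r \<Longrightarrow> \<bar>h x - h a\<bar> \<le> M"
      using expands_atD[OF h[OF r(1)]] by blast
    have N0: "0 \<le> N r" using M by linarith
    show "summable (\<lambda>j. \<bar>c j\<bar> * N r ^ j)"
      by (rule summable_comparison_test'[OF c(2)])
        (use N0 r0(2)[OF r] in \<open>auto simp: abs_mult intro!: mult_left_mono power_mono\<close>)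
    show "expands_at a r (\<bar>c j\<bar> * N r ^ j) (\<lambda>x. c j * (h x - h a) ^ j)" for j
      by (intro expands_at_mult expands_at_const expands_at_power h r) auto
    show "(\<lambda>j. c j * (h x - h a) ^ j) sums G (h x)" if "x \<in> ball a r" for x
      using M(2,3) r0(2)[OF r] that by (intro c(3)) fastforce
  qed
  then show ?thesis using r0(1) by blast
qed

lemma expands_at_coord':
  assumes "b \<in> Basis" "r > 0"
  shows "expands_at a r (r + \<bar>a \<bullet> b\<bar>) (\<lambda>x. x \<bullet> b)"
  by (rule expands_at_cong[OF expands_at_add[OF expands_at_coord[OF assms order_refl]
        expands_at_const[OF assms(2) order_refl, where a=a and k="a \<bullet> b"]]]) (simp add: inner_diff_left)

lemma expands_at_real_polynomial:
  assumes "real_polynomial_function p" "r > 0"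
  shows "\<exists>N. expands_at a r N p"
  using assms(1)
proof induction
  case (linear l)
  have l: "(\<Sum>b\<in>Basis. l b * (x \<bullet> b)) = l x" for x
  proof -
    have "l x = l (\<Sum>b\<in>Basis. (x \<bullet> b) *\<^sub>R b)" by (simp add: euclidean_representation)
    then show ?thesis using linear
      by (simp add: linear_sum linear_cmul bounded_linear.linear mult.commute)
  qed
  have "expands_at a r (\<Sum>b\<in>Basis. \<bar>l b\<bar> * (r + \<bar>a \<bullet> b\<bar>)) (\<lambda>x. \<Sum>b\<in>Basis. l b * (x \<bullet> b))"
    by (intro expands_at_sum assms(2) expands_at_mult expands_at_const expands_at_coord') auto
  then have "expands_at a r (\<Sum>b\<in>Basis. \<bar>l b\<bar> * (r + \<bar>a \<bullet> b\<bar>)) l"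
    by (rule expands_at_cong) (rule l)
  then show ?case ..
next
  case (const k)
  then show ?case using expands_at_const[OF assms(2) order_refl] by blast
next
  case (add f g)
  then show ?case using expands_at_add by blast
next
  case (mult f g)
  then show ?case using expands_at_mult by blast
qed

text \<open>From \<open>x \<bullet> x - a \<bullet> a = (2 a + (x - a)) \<bullet> (x - a)\<close>,
  coordinate by coordinate. The last factor makes the bound tend to 0 with \<open>r\<close>, as the
  composition lemma demands.\<close>

lemma expands_at_inner_self:
  assumes "r > 0"
  shows "expands_at a r (\<Sum>b\<in>Basis. (2 * \<bar>a \<bullet> b\<bar> + r) * r) (\<lambda>x. x \<bullet> x - a \<bullet> a)"
proof (rule expands_at_cong)
  show "expands_at a r (\<Sum>b\<in>Basis. (2 * \<bar>a \<bullet> b\<bar> + r) * r)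
      (\<lambda>x. \<Sum>b\<in>Basis. (2 * (a \<bullet> b) + (x - a) \<bullet> b) * ((x - a) \<bullet> b))"
    by (intro expands_at_sum assms expands_at_mult expands_at_add expands_at_const expands_at_coord)
      (auto simp: assms abs_mult)
  show "(\<Sum>b\<in>Basis. (2 * (a \<bullet> b) + (x - a) \<bullet> b) * ((x - a) \<bullet> b)) = x \<bullet> x - a \<bullet> a" for x
    by (subst (2 3) euclidean_inner) (simp add: sum_subtractf[symmetric] inner_diff_left algebra_simps)
qed

lemma has_sum_finite_sum:
  fixes f :: "'i \<Rightarrow> 'j \<Rightarrow> 'b::topological_comm_monoid_add"
  assumes "\<And>i. i \<in> I \<Longrightarrow> (f i has_sum s i) A"
  shows "((\<lambda>x. \<Sum>i\<in>I. f i x) has_sum (\<Sum>i\<in>I. s i)) A"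
  using assms by (induction I rule: infinite_finite_induct) (auto intro!: has_sum_add)

lemma real_analytic_onI:
  fixes F :: "'a::euclidean_space \<Rightarrow> 'b::euclidean_space"
  assumes "\<And>a. a \<in> U \<Longrightarrow> \<exists>r>0. \<forall>b\<in>Basis. \<exists>N. expands_at a r N (\<lambda>x. F x \<bullet> b)"
  shows "real_analytic_on U F"
  unfolding real_analytic_on_def
proof
  fix a assume "a \<in> U"
  then obtain r where r: "r > 0" "\<forall>b\<in>Basis. \<exists>N. expands_at a r N (\<lambda>x. F x \<bullet> b)" using assms by blast
  have "\<exists>c. \<forall>x\<in>ball a r. ((\<lambda>\<alpha>. c \<alpha> * monom_at (x - a) \<alpha>) has_sum (F x \<bullet> b)) multi_indices"
    if "b \<in> Basis" for b
    using r(2) that unfolding expands_at_def by meson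
  then obtain c where c: "\<And>b x. b \<in> Basis \<Longrightarrow> x \<in> ball a r \<Longrightarrow>
      ((\<lambda>\<alpha>. c b \<alpha> * monom_at (x - a) \<alpha>) has_sum (F x \<bullet> b)) multi_indices"
    by metis
  have "((\<lambda>\<alpha>. monom_at (x - a) \<alpha> *\<^sub>R (\<Sum>b\<in>Basis. c b \<alpha> *\<^sub>R b)) has_sum F x) multi_indices"
    if x: "x \<in> ball a r" for x
  proof -
    have "((\<lambda>\<alpha>. \<Sum>b\<in>Basis. (c b \<alpha> * monom_at (x - a) \<alpha>) *\<^sub>R b) has_sum (\<Sum>b\<in>Basis. (F x \<bullet> b) *\<^sub>R b)) multi_indices"
      by (intro has_sum_finite_sum has_sum_bounded_linear[OF bounded_linear_scaleR_left] c x)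
    then show ?thesis by (simp add: euclidean_representation scaleR_sum_right mult.commute)
  qed
  then show "\<exists>r>0. \<exists>c. \<forall>x\<in>ball a r.
        ((\<lambda>\<alpha>. (\<Prod>b\<in>Basis. ((x - a) \<bullet> b) ^ \<alpha> b) *\<^sub>R c \<alpha>) has_sum F x) (Basis \<rightarrow>\<^sub>E UNIV)"
    using r(1) unfolding monom_at_def by (intro exI[of _ r] conjI exI[of _ "\<lambda>\<alpha>. \<Sum>b\<in>Basis. c b \<alpha> *\<^sub>R b"]) auto
qed

text \<open>A polynomial expands at every radius, so the radius may be dictated by the radial factor
  alone.\<close>

theorem real_analytic_on_radial_times_polynomial:
  fixes P :: "'a::euclidean_space \<Rightarrow> 'b::euclidean_space"
  assumes K: "analytic_real V K" and V: "\<And>x. x \<in> U \<Longrightarrow> x \<bullet> x \<in> V"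
    and P: "\<And>b. b \<in> Basis \<Longrightarrow> real_polynomial_function (\<lambda>x. P x \<bullet> b)"
  shows "real_analytic_on U (\<lambda>x. K (x \<bullet> x) *\<^sub>R P x)"
proof (rule real_analytic_onI)
  fix a assume a: "a \<in> U"
  have "((\<lambda>r. \<Sum>b\<in>Basis. (2 * \<bar>a \<bullet> b\<bar> + r) * r) \<longlongrightarrow> (\<Sum>b\<in>(Basis::'a set). (2 * \<bar>a \<bullet> b\<bar> + 0) * 0)) (at_right 0)"
    by (intro tendsto_intros)
  then have "((\<lambda>r. \<Sum>b\<in>Basis. (2 * \<bar>a \<bullet> b\<bar> + r) * r) \<longlongrightarrow> 0) (at_right 0)" by simp
  from expands_at_analytic_compose[OF K V[OF a] expands_at_inner_self this]
  obtain r0 where r0: "r0 > 0" "\<And>r. 0 < r \<Longrightarrow> r < r0 \<Longrightarrow> \<exists>N. expands_at a r N (\<lambda>x. K (x \<bullet> x))" by blast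
  then obtain N where N: "expands_at a (r0/2) N (\<lambda>x. K (x \<bullet> x))" using r0(2)[of "r0/2"] r0(1) by (metis field_sum_of_halves half_gt_zero_iff less_add_same_cancel1)
  have "\<exists>N. expands_at a (r0/2) N (\<lambda>x. (K (x \<bullet> x) *\<^sub>R P x) \<bullet> b)" if "b \<in> Basis" for b
    using expands_at_real_polynomial[OF P[OF that], of "r0/2" a] expands_at_mult[OF N] r0(1) by fastforce
  then show "\<exists>r>0. \<forall>b\<in>Basis. \<exists>N. expands_at a r N (\<lambda>x. (K (x \<bullet> x) *\<^sub>R P x) \<bullet> b)"
    using r0(1) by (intro exI[of _ "r0/2"]) auto
qed


section \<open>Power series solutions of polynomial recursions\<close>

text \<open>Polynomials are kept as syntax because one expression is read in three ways: on numbers,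
  on formal power series, and as a majorant for norms.\<close>

datatype pexp = Var nat | Const real | Add pexp pexp | Mul pexp pexp

fun pval :: "pexp \<Rightarrow> (nat \<Rightarrow> real) \<Rightarrow> real" where
  "pval (Var i) y = y i"
| "pval (Const c) y = c"
| "pval (Add e f) y = pval e y + pval f y"
| "pval (Mul e f) y = pval e y * pval f y"

fun pfps :: "pexp \<Rightarrow> (nat \<Rightarrow> real fps) \<Rightarrow> real fps" where
  "pfps (Var i) Y = Y i"
| "pfps (Const c) Y = fps_const c"
| "pfps (Add e f) Y = pfps e Y + pfps f Y"
| "pfps (Mul e f) Y = pfps e Y * pfps f Y"

fun pbound :: "pexp \<Rightarrow> real \<Rightarrow> real" where
  "pbound (Var i) M = M"
| "pbound (Const c) M = \<bar>c\<bar>"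
| "pbound (Add e f) M = pbound e M + pbound f M"
| "pbound (Mul e f) M = pbound e M * pbound f M"

fun pvars :: "pexp \<Rightarrow> nat set" where
  "pvars (Var i) = {i}"
| "pvars (Const c) = {}"
| "pvars (Add e f) = pvars e \<union> pvars f"
| "pvars (Mul e f) = pvars e \<union> pvars f"

lemma pbound_nonneg: "M \<ge> 0 \<Longrightarrow> pbound e M \<ge> 0"
  by (induction e) auto

lemma abs_pval_le: "(\<And>i. \<bar>y i\<bar> \<le> M) \<Longrightarrow> \<bar>pval e y\<bar> \<le> pbound e M"
proof (induction e)
  case (Add e f)
  then show ?case using abs_triangle_ineq[of "pval e y" "pval f y"] by fastforce
next
  case (Mul e f)
  have "0 \<le> M" using Mul.prems[of 0] by linarith
  then show ?case using Mul by (auto simp: abs_mult intro!: mult_mono pbound_nonneg)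
qed auto

text \<open>The Lipschitz bound on bounded sets that the uniqueness theorem feeds into Gronwall's
  inequality.\<close>

lemma pval_Lipschitz:
  assumes "finite I" "M \<ge> 0"
  shows "pvars e \<subseteq> I \<Longrightarrow> \<exists>C\<ge>0. \<forall>x y. (\<forall>i. \<bar>x i\<bar> \<le> M) \<longrightarrow> (\<forall>i. \<bar>y i\<bar> \<le> M) \<longrightarrow>
    \<bar>pval e x - pval e y\<bar> \<le> C * (\<Sum>i\<in>I. \<bar>x i - y i\<bar>)"
proof (induction e)
  case (Var j)
  then have "\<bar>x j - y j\<bar> \<le> (\<Sum>i\<in>I. \<bar>x i - y i\<bar>)" for x y :: "nat \<Rightarrow> real"
    using assms(1) by (intro member_le_sum[of j I "\<lambda>i. \<bar>x i - y i\<bar>"]) auto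
  then show ?case by (intro exI[of _ 1]) simp
next
  case (Const c)
  then show ?case by (intro exI[of _ 0]) simp
next
  case (Add e f)
  let ?s = "\<lambda>x y :: nat \<Rightarrow> real. \<Sum>i\<in>I. \<bar>x i - y i\<bar>"
  obtain C D where C: "C \<ge> 0" "\<And>x y. \<forall>i. \<bar>x i\<bar> \<le> M \<Longrightarrow> \<forall>i. \<bar>y i\<bar> \<le> M \<Longrightarrow> \<bar>pval e x - pval e y\<bar> \<le> C * ?s x y"
    and D: "D \<ge> 0" "\<And>x y. \<forall>i. \<bar>x i\<bar> \<le> M \<Longrightarrow> \<forall>i. \<bar>y i\<bar> \<le> M \<Longrightarrow> \<bar>pval f x - pval f y\<bar> \<le> D * ?s x y"
    using Add by auto
  show ?case
  proof (intro exI[of _ "C + D"] conjI allI impI)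
    fix x y :: "nat \<Rightarrow> real" assume "\<forall>i. \<bar>x i\<bar> \<le> M" "\<forall>i. \<bar>y i\<bar> \<le> M"
    from C(2)[OF this] D(2)[OF this]
    show "\<bar>pval (Add e f) x - pval (Add e f) y\<bar> \<le> (C + D) * ?s x y" by (simp add: distrib_right)
  qed (use C D in auto)
next
  case (Mul e f)
  let ?s = "\<lambda>x y :: nat \<Rightarrow> real. \<Sum>i\<in>I. \<bar>x i - y i\<bar>"
  obtain C D where C: "C \<ge> 0" "\<And>x y. \<forall>i. \<bar>x i\<bar> \<le> M \<Longrightarrow> \<forall>i. \<bar>y i\<bar> \<le> M \<Longrightarrow> \<bar>pval e x - pval e y\<bar> \<le> C * ?s x y"
    and D: "D \<ge> 0" "\<And>x y. \<forall>i. \<bar>x i\<bar> \<le> M \<Longrightarrow> \<forall>i. \<bar>y i\<bar> \<le> M \<Longrightarrow> \<bar>pval f x - pval f y\<bar> \<le> D * ?s x y"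
    using Mul by auto
  show ?case
  proof (intro exI[of _ "pbound f M * C + pbound e M * D"] conjI allI impI)
    fix x y :: "nat \<Rightarrow> real" assume xy: "\<forall>i. \<bar>x i\<bar> \<le> M" "\<forall>i. \<bar>y i\<bar> \<le> M"
    have "pval (Mul e f) x - pval (Mul e f) y = pval f x * (pval e x - pval e y) + pval e y * (pval f x - pval f y)"
      by (simp add: algebra_simps)
    then have "\<bar>pval (Mul e f) x - pval (Mul e f) y\<bar> \<le> \<bar>pval f x\<bar> * \<bar>pval e x - pval e y\<bar> + \<bar>pval e y\<bar> * \<bar>pval f x - pval f y\<bar>"
      by (metis abs_mult abs_triangle_ineq)
    also have "\<dots> \<le> pbound f M * (C * ?s x y) + pbound e M * (D * ?s x y)"
      using xy by (intro add_mono mult_mono C(2) D(2) abs_pval_le pbound_nonneg assms) auto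
    finally show "\<bar>pval (Mul e f) x - pval (Mul e f) y\<bar> \<le> (pbound f M * C + pbound e M * D) * ?s x y"
      by (simp add: algebra_simps)
  qed (use C D pbound_nonneg assms in auto)
qed

text \<open>The weighted l1 norm is truncated so that it can be estimated before convergence is
  known; bounds uniform in \<open>J\<close> then give absolute convergence at
  \<open>R\<close>.\<close>

definition partial_norm :: "real \<Rightarrow> nat \<Rightarrow> real fps \<Rightarrow> real" where
  "partial_norm R J a = (\<Sum>j\<le>J. \<bar>fps_nth a j\<bar> * R ^ j)"

lemma partial_norm_nonneg: "R \<ge> 0 \<Longrightarrow> partial_norm R J a \<ge> 0"
  by (auto simp: partial_norm_def intro!: sum_nonneg)

lemma partial_norm_add: "R \<ge> 0 \<Longrightarrow> partial_norm R J (a + b) \<le> partial_norm R J a + partial_norm R J b"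
  by (auto simp: partial_norm_def sum.distrib[symmetric] distrib_right[symmetric] intro!: sum_mono mult_right_mono)

lemma partial_norm_mult:
  assumes R: "R \<ge> 0"
  shows "partial_norm R J (a * b) \<le> partial_norm R J a * partial_norm R J b"
proof -
  let ?f = "\<lambda>i j. (\<bar>fps_nth a i\<bar> * R ^ i) * (\<bar>fps_nth b j\<bar> * R ^ j)"
  have "partial_norm R J (a * b) \<le> (\<Sum>k\<le>J. \<Sum>i\<le>k. ?f i (k - i))"
    unfolding partial_norm_def
  proof (rule sum_mono)
    fix k
    have "\<bar>fps_nth (a * b) k\<bar> \<le> (\<Sum>i\<le>k. \<bar>fps_nth a i * fps_nth b (k - i)\<bar>)"
      by (simp add: fps_mult_nth atLeast0AtMost)
    then have "\<bar>fps_nth (a * b) k\<bar> * R ^ k \<le> (\<Sum>i\<le>k. \<bar>fps_nth a i * fps_nth b (k - i)\<bar>) * R ^ k"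
      using R by (intro mult_right_mono) auto
    also have "\<dots> = (\<Sum>i\<le>k. ?f i (k - i))"
      unfolding sum_distrib_right
    proof (rule sum.cong[OF refl])
      fix i assume "i \<in> {..k}"
      then have "R ^ k = R ^ i * R ^ (k - i)" by (simp flip: power_add)
      then show "\<bar>fps_nth a i * fps_nth b (k - i)\<bar> * R ^ k = ?f i (k - i)" by (simp add: abs_mult)
    qed
    finally show "\<bar>fps_nth (a * b) k\<bar> * R ^ k \<le> (\<Sum>i\<le>k. ?f i (k - i))" .
  qed
  also have "\<dots> = (\<Sum>(i,j)\<in>{(i,j). i + j \<le> J}. ?f i j)"
    by (rule sum.triangle_reindex_eq[symmetric])
  \<comment> \<open>Enlarging the triangle to a square keeps the truncated norm submultiplicative
    with the same \<open>J\<close>.\<close>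
  also have "\<dots> \<le> (\<Sum>(i,j)\<in>{..J} \<times> {..J}. ?f i j)"
    using R by (intro sum_mono2) auto
  also have "\<dots> = partial_norm R J a * partial_norm R J b"
    by (simp add: partial_norm_def sum_product sum.cartesian_product)
  finally show ?thesis .
qed

lemma partial_norm_pfps:
  assumes "R \<ge> 0" "\<And>i. partial_norm R J (Y i) \<le> M"
  shows "partial_norm R J (pfps e Y) \<le> pbound e M"
proof (induction e)
  case (Const c)
  have "partial_norm R J (fps_const c) = (\<Sum>j\<le>J. if j = 0 then \<bar>c\<bar> else 0)"
    unfolding partial_norm_def by (rule sum.cong) auto
  then show ?case by simp
next
  case (Add e f)
  then show ?case using partial_norm_add[OF assms(1), of J "pfps e Y" "pfps f Y"] by simp
next
  case (Mul e f)
  have M: "M \<ge> 0" using assms partial_norm_nonneg order_trans by blast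
  have "partial_norm R J (pfps e Y) * partial_norm R J (pfps f Y) \<le> pbound e M * pbound f M"
    using Mul by (intro mult_mono partial_norm_nonneg pbound_nonneg assms M)
  then show ?case using partial_norm_mult[OF assms(1), of J "pfps e Y" "pfps f Y"] by simp
qed (use assms in auto)

text \<open>Sums and Cauchy products are triangular in the degree; this is why the recursion below
  determines each coefficient from earlier ones.\<close>

lemma pfps_nth_cong:
  assumes "\<And>i l. l \<le> j \<Longrightarrow> fps_nth (Y i) l = fps_nth (Z i) l"
  shows "l \<le> j \<Longrightarrow> fps_nth (pfps e Y) l = fps_nth (pfps e Z) l"
  by (induction e arbitrary: l) (auto simp: assms fps_mult_nth intro!: sum.cong)

text \<open>Each iteration of \<open>step\<close> makes one more coefficient stationary, and the
  solution is read off the diagonal. The weights \<open>w\<close> carry the divisors produced by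
  integration or by a regular singular point.\<close>

lemma recursion_solution:
  fixes e :: "nat \<Rightarrow> pexp" and w :: "nat \<Rightarrow> nat \<Rightarrow> real"
  shows "\<exists>Y. \<forall>i. fps_nth (Y i) 0 = y0 i \<and> (\<forall>j. fps_nth (Y i) (Suc j) = w i (Suc j) * fps_nth (pfps (e i) Y) j)"
proof -
  define step where "step Z i = Abs_fps (\<lambda>j. case j of 0 \<Rightarrow> y0 i | Suc l \<Rightarrow> w i j * fps_nth (pfps (e i) Z) l)"
    for Z i
  define Z where "Z n = (step ^^ n) (\<lambda>i. fps_const (y0 i))" for n
  have Z_Suc: "Z (Suc n) = step (Z n)" for n by (simp add: Z_def)
  have Z0: "fps_nth (Z n i) 0 = y0 i" for n i
    by (cases n) (simp_all add: Z_def step_def)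
  have ZS: "fps_nth (Z (Suc n) i) (Suc m) = w i (Suc m) * fps_nth (pfps (e i) (Z n)) m" for n i m
    by (simp add: Z_Suc step_def)
  have agree: "fps_nth (Z (Suc n) i) l = fps_nth (Z n i) l" if "l \<le> n" for n i l
    using that
  proof (induction n arbitrary: i l)
    case 0
    then show ?case by (simp add: Z0)
  next
    case (Suc n)
    show ?case
    proof (cases l)
      case (Suc m)
      have "fps_nth (pfps (e i) (Z (Suc n))) m = fps_nth (pfps (e i) (Z n)) m"
        by (rule pfps_nth_cong[OF Suc.IH, of n m]) (use Suc.prems Suc in auto)
      then show ?thesis by (simp add: Suc ZS)
    qed (simp add: Z0)
  qed
  have agree': "fps_nth (Z (l + n) i) l = fps_nth (Z l i) l" for l n i
    by (induction n) (auto simp: agree)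
  define Y where "Y i = Abs_fps (\<lambda>j. fps_nth (Z j i) j)" for i
  have YZ: "fps_nth (Y i) l = fps_nth (Z n i) l" if "l \<le> n" for n i l
    using agree'[of l "n - l" i] that by (simp add: Y_def)
  have "fps_nth (Y i) (Suc j) = w i (Suc j) * fps_nth (pfps (e i) Y) j" for i j
  proof -
    have "fps_nth (Y i) (Suc j) = w i (Suc j) * fps_nth (pfps (e i) (Z j)) j"
      using YZ[of "Suc j" "Suc j" i] by (simp add: Z_Suc step_def)
    also have "fps_nth (pfps (e i) (Z j)) j = fps_nth (pfps (e i) Y) j"
      by (rule pfps_nth_cong[OF YZ[symmetric] order_refl])
    finally show ?thesis .
  qed
  moreover have "fps_nth (Y i) 0 = y0 i" for i
    by (simp add: Y_def Z_def)
  ultimately show ?thesis by blast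
qed

text \<open>The recursion raises the degree by one, so passing from \<open>J\<close> to
  \<open>Suc J\<close> costs a factor \<open>R\<close> times the majorant of the norm up to
  \<open>J\<close>. For small \<open>R\<close> the bound \<open>A + 1\<close> reproduces
  itself.\<close>

lemma recursion_bound:
  assumes Y: "\<And>i. fps_nth (Y i) 0 = y0 i"
      "\<And>i j. fps_nth (Y i) (Suc j) = w i (Suc j) * fps_nth (pfps (e i) Y) j"
    and A: "\<And>i. \<bar>y0 i\<bar> \<le> A" and w: "\<And>i j. \<bar>w i (Suc j)\<bar> \<le> C"
    and R: "R \<ge> 0" and small: "\<And>i. C * R * pbound (e i) (A + 1) \<le> 1"
  shows "partial_norm R J (Y i) \<le> A + 1"
proof (induction J arbitrary: i)
  case 0
  then show ?case using A[of i] by (simp add: partial_norm_def Y)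
next
  case (Suc J)
  have C: "C \<ge> 0" using w[of 0 0] by linarith
  have "partial_norm R (Suc J) (Y i) = \<bar>y0 i\<bar> + (\<Sum>j\<le>J. \<bar>fps_nth (Y i) (Suc j)\<bar> * R ^ Suc j)"
    unfolding partial_norm_def by (subst sum.atMost_Suc_shift) (simp add: Y(1))
  also have "(\<Sum>j\<le>J. \<bar>fps_nth (Y i) (Suc j)\<bar> * R ^ Suc j) \<le> (\<Sum>j\<le>J. (C * R) * (\<bar>fps_nth (pfps (e i) Y) j\<bar> * R ^ j))"
  proof (rule sum_mono)
    fix j
    have "\<bar>fps_nth (Y i) (Suc j)\<bar> \<le> C * \<bar>fps_nth (pfps (e i) Y) j\<bar>"
      unfolding Y(2) abs_mult using w by (intro mult_right_mono) auto
    then have "\<bar>fps_nth (Y i) (Suc j)\<bar> * R ^ Suc j \<le> C * \<bar>fps_nth (pfps (e i) Y) j\<bar> * R ^ Suc j"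
      using R by (intro mult_right_mono) auto
    then show "\<bar>fps_nth (Y i) (Suc j)\<bar> * R ^ Suc j \<le> (C * R) * (\<bar>fps_nth (pfps (e i) Y) j\<bar> * R ^ j)"
      by (simp add: mult_ac)
  qed
  also have "\<dots> = C * R * partial_norm R J (pfps (e i) Y)"
    by (simp add: partial_norm_def sum_distrib_left)
  also have "\<dots> \<le> C * R * pbound (e i) (A + 1)"
    using C R Suc by (intro mult_left_mono partial_norm_pfps) auto
  finally show ?case using small[of i] A[of i] by linarith
qed

section \<open>Sums of convergent formal series\<close>

definition fps_value :: "real fps \<Rightarrow> real \<Rightarrow> real" where
  "fps_value a x = (\<Sum>j. fps_nth a j * x ^ j)"

lemma partial_norm_bounded_summable:
  assumes "R \<ge> 0" "\<And>J. partial_norm R J a \<le> M"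
  shows "summable (\<lambda>j. \<bar>fps_nth a j\<bar> * R ^ j)"
proof (rule bounded_imp_summable[where B=M])
  show "(\<Sum>k\<le>n. \<bar>fps_nth a k\<bar> * R ^ k) \<le> M" for n using assms(2) by (simp add: partial_norm_def)
qed (use assms in auto)

lemma fps_value_summable:
  fixes a :: "real fps"
  assumes "summable (\<lambda>j. \<bar>fps_nth a j\<bar> * R ^ j)" "\<bar>x\<bar> \<le> R"
  shows "summable (\<lambda>j. norm (fps_nth a j * x ^ j))" and "summable (\<lambda>j. fps_nth a j * x ^ j)"
proof -
  show "summable (\<lambda>j. norm (fps_nth a j * x ^ j))"
    by (rule summable_comparison_test'[OF assms(1)])
      (use assms(2) in \<open>auto simp: abs_mult power_abs intro!: mult_left_mono power_mono\<close>)
  then show "summable (\<lambda>j. fps_nth a j * x ^ j)" by (rule summable_norm_cancel)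
qed

lemma pfps_summable:
  assumes "R \<ge> 0" "\<And>i J. partial_norm R J (Y i) \<le> M"
  shows "summable (\<lambda>j. \<bar>fps_nth (pfps e Y) j\<bar> * R ^ j)"
  by (rule partial_norm_bounded_summable[OF assms(1) partial_norm_pfps[OF assms]])

lemma fps_value_pfps:
  assumes "R \<ge> 0" "\<And>i J. partial_norm R J (Y i) \<le> M" "\<bar>x\<bar> \<le> R"
  shows "fps_value (pfps e Y) x = pval e (\<lambda>i. fps_value (Y i) x)"
proof (induction e)
  case (Const c)
  have "(\<Sum>j. fps_nth (fps_const c) j * x ^ j) = (\<Sum>j\<in>{0}. fps_nth (fps_const c) j * x ^ j)"
    by (rule suminf_finite) auto
  then show ?case by (simp add: fps_value_def)
next
  case (Add e f)
  have "fps_value (pfps e Y + pfps f Y) x = fps_value (pfps e Y) x + fps_value (pfps f Y) x"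
    unfolding fps_value_def
    using suminf_add[OF fps_value_summable(2)[OF pfps_summable[OF assms(1,2)] assms(3), of e]
        fps_value_summable(2)[OF pfps_summable[OF assms(1,2)] assms(3), of f]]
    by (simp add: distrib_right)
  then show ?case using Add by simp
next
  case (Mul e f)
  have "fps_value (pfps e Y) x * fps_value (pfps f Y) x =
      (\<Sum>k. \<Sum>i\<le>k. (fps_nth (pfps e Y) i * x ^ i) * (fps_nth (pfps f Y) (k - i) * x ^ (k - i)))"
    unfolding fps_value_def
    by (intro Cauchy_product fps_value_summable(1)[OF pfps_summable[OF assms(1,2)] assms(3)])
  also have "\<dots> = fps_value (pfps e Y * pfps f Y) x"
    unfolding fps_value_def
  proof (rule suminf_cong)
    fix k
    have "(fps_nth (pfps e Y) i * x ^ i) * (fps_nth (pfps f Y) (k - i) * x ^ (k - i)) =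
        fps_nth (pfps e Y) i * fps_nth (pfps f Y) (k - i) * x ^ k" if "i \<le> k" for i
    proof -
      have "x ^ k = x ^ i * x ^ (k - i)" using that by (simp flip: power_add)
      then show ?thesis by simp
    qed
    then show "(\<Sum>i\<le>k. (fps_nth (pfps e Y) i * x ^ i) * (fps_nth (pfps f Y) (k - i) * x ^ (k - i))) =
        fps_nth (pfps e Y * pfps f Y) k * x ^ k"
      unfolding fps_mult_nth atLeast0AtMost sum_distrib_right by (intro sum.cong) auto
  qed
  finally show ?case using Mul by simp
qed simp

lemma fps_value_has_derivative:
  assumes "summable (\<lambda>j. \<bar>fps_nth a j\<bar> * R ^ j)" "\<bar>x\<bar> < R"
  shows "(fps_value a has_real_derivative fps_value (fps_deriv a) x) (at x)"
proof -
  have "summable (\<lambda>j. fps_nth a j * R ^ j)"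
    by (rule fps_value_summable(2)[OF assms(1)]) (use assms(2) in auto)
  from termdiffs_strong[OF this, of x] assms(2)
  show ?thesis unfolding fps_value_def[abs_def] by (simp add: diffs_def)
qed

lemma analytic_real_fps_value:
  assumes "R > 0" "summable (\<lambda>j. \<bar>fps_nth a j\<bar> * R ^ j)"
  shows "analytic_real {x. \<bar>x\<bar> < R} (fps_value a)"
  using analytic_real_power_series[OF assms, of 0 "fps_value a"] by (simp add: fps_value_def)

text \<open>\<open>R\<close> is fixed before the initial values are chosen. This uniformity later
  allows an orbit to be continued by steps of constant length.\<close>

theorem polynomial_recursion:
  fixes e :: "nat \<Rightarrow> pexp" and w :: "nat \<Rightarrow> nat \<Rightarrow> real"
  assumes e: "\<And>i. i \<ge> N \<Longrightarrow> e i = Const 0" and w: "\<And>i j. \<bar>w i (Suc j)\<bar> \<le> C" and A: "A \<ge> 0"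
  shows "\<exists>R>0. \<forall>y0. (\<forall>i. \<bar>y0 i\<bar> \<le> A) \<longrightarrow> (\<exists>Y.
    (\<forall>i. fps_nth (Y i) 0 = y0 i \<and> (\<forall>j. fps_nth (Y i) (Suc j) = w i (Suc j) * fps_nth (pfps (e i) Y) j)) \<and>
    (\<forall>i J. partial_norm R J (Y i) \<le> A + 1))"
proof -
  define B where "B = (\<Sum>i<N. pbound (e i) (A + 1))"
  have pb: "pbound (e i) (A + 1) \<ge> 0" for i using A by (intro pbound_nonneg) auto
  have B: "pbound (e i) (A + 1) \<le> B" for i
  proof (cases "i < N")
    case True
    then show ?thesis unfolding B_def by (intro member_le_sum) (auto simp: pb)
  next
    case False
    then show ?thesis using e[of i] by (auto simp: B_def pb intro!: sum_nonneg)
  qed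
  have B0: "B \<ge> 0" using B[of 0] pb[of 0] by linarith
  have C: "C \<ge> 0" using w[of 0 0] by linarith
  \<comment> \<open>Makes \<open>C * R * B\<close> at most 1, which is what
    \<open>recursion_bound\<close> asks for.\<close>
  define R where "R = 1 / (C * B + 1)"
  have R: "R > 0" using B0 C by (auto simp: R_def intro!: divide_pos_pos add_nonneg_pos)
  have small: "C * R * pbound (e i) (A + 1) \<le> 1" for i
  proof -
    have "C * R * pbound (e i) (A + 1) \<le> C * R * B"
      using C R B by (intro mult_left_mono) auto
    also have "\<dots> = C * B / (C * B + 1)" by (simp add: R_def)
    also have "\<dots> \<le> 1" using C B0 by (simp add: divide_le_eq add_nonneg_pos)
    finally show ?thesis .
  qed
  show ?thesis
  proof (intro exI[of _ R] conjI R allI impI)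
    fix y0 :: "nat \<Rightarrow> real" assume y0: "\<forall>i. \<bar>y0 i\<bar> \<le> A"
    obtain Y where Y: "\<forall>i. fps_nth (Y i) 0 = y0 i \<and> (\<forall>j. fps_nth (Y i) (Suc j) = w i (Suc j) * fps_nth (pfps (e i) Y) j)"
      using recursion_solution[of y0 w e] by blast
    have "partial_norm R J (Y i) \<le> A + 1" for i J
      by (rule recursion_bound[where ?y0.0=y0 and w=w and e=e and C=C]) (use Y y0 w R small in auto)
    with Y show "\<exists>Y. (\<forall>i. fps_nth (Y i) 0 = y0 i \<and> (\<forall>j. fps_nth (Y i) (Suc j) = w i (Suc j) * fps_nth (pfps (e i) Y) j)) \<and>
      (\<forall>i J. partial_norm R J (Y i) \<le> A + 1)" by blast
  qed
qed

text \<open>Termwise integration is the recursion with weights \<open>1 / j\<close>.\<close>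

theorem polynomial_ODE_local_solution:
  fixes e :: "nat \<Rightarrow> pexp"
  assumes e: "\<And>i. i \<ge> N \<Longrightarrow> e i = Const 0" and A: "A \<ge> 0"
  shows "\<exists>R>0. \<forall>y0. (\<forall>i. \<bar>y0 i\<bar> \<le> A) \<longrightarrow> (\<exists>y. \<forall>i. y i 0 = y0 i \<and> analytic_real {x. \<bar>x\<bar> < R} (y i) \<and>
    (\<forall>x. \<bar>x\<bar> < R \<longrightarrow> (y i has_real_derivative pval (e i) (\<lambda>i. y i x)) (at x)))"
proof -
  have w: "\<bar>1 / real (Suc j)\<bar> \<le> 1" for j by simp
  obtain R where R: "R > 0" "\<And>y0. \<forall>i. \<bar>y0 i\<bar> \<le> A \<Longrightarrow> \<exists>Y.
    (\<forall>i. fps_nth (Y i) 0 = y0 i \<and> (\<forall>j. fps_nth (Y i) (Suc j) = 1 / real (Suc j) * fps_nth (pfps (e i) Y) j)) \<and>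
    (\<forall>i J. partial_norm R J (Y i) \<le> A + 1)"
    using polynomial_recursion[where w="\<lambda>i j. 1 / real j" and e=e, OF e w A] by blast
  show ?thesis
  proof (intro exI[of _ R] conjI R(1) allI impI)
    fix y0 :: "nat \<Rightarrow> real" assume "\<forall>i. \<bar>y0 i\<bar> \<le> A"
    then obtain Y where Y: "\<And>i. fps_nth (Y i) 0 = y0 i"
      "\<And>i j. fps_nth (Y i) (Suc j) = 1 / real (Suc j) * fps_nth (pfps (e i) Y) j"
      and b: "\<And>i J. partial_norm R J (Y i) \<le> A + 1" using R(2) by blast
    have R0: "R \<ge> 0" using R(1) by simp
    have s: "summable (\<lambda>j. \<bar>fps_nth (Y i) j\<bar> * R ^ j)" for i
      using partial_norm_bounded_summable[OF R0 b] .
    have d: "fps_deriv (Y i) = pfps (e i) Y" for i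
      by (rule fps_ext) (simp add: Y(2) del: of_nat_Suc)
    have "(fps_value (Y i) has_real_derivative pval (e i) (\<lambda>i. fps_value (Y i) x)) (at x)" if "\<bar>x\<bar> < R" for i x
      using fps_value_has_derivative[OF s[of i] that] fps_value_pfps[where Y=Y and e="e i", OF R0 b, of x] that by (simp add: d)
    moreover have "fps_value (Y i) 0 = y0 i" for i by (simp add: fps_value_def Y(1))
    ultimately show "\<exists>y. \<forall>i. y i 0 = y0 i \<and> analytic_real {x. \<bar>x\<bar> < R} (y i) \<and>
        (\<forall>x. \<bar>x\<bar> < R \<longrightarrow> (y i has_real_derivative pval (e i) (\<lambda>i. y i x)) (at x))"
      using analytic_real_fps_value[OF R(1) s] by (intro exI[of _ "\<lambda>i. fps_value (Y i)"]) auto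
  qed
qed

text \<open>The bound on \<open>\<bar>D' t\<bar>\<close> works in both directions of time:
  \<open>D t * exp (- C * t)\<close> does not increase after \<open>c\<close>, and
  \<open>D t * exp (C * t)\<close> does not decrease before \<open>c\<close>.\<close>

lemma Gronwall_zero:
  fixes D D' :: "real \<Rightarrow> real"
  assumes der: "\<And>t. a \<le> t \<Longrightarrow> t \<le> b \<Longrightarrow> (D has_real_derivative D' t) (at t)"
    and le: "\<And>t. a \<le> t \<Longrightarrow> t \<le> b \<Longrightarrow> \<bar>D' t\<bar> \<le> C * D t"
    and nn: "\<And>t. a \<le> t \<Longrightarrow> t \<le> b \<Longrightarrow> 0 \<le> D t"
    and c: "a \<le> c" "c \<le> b" "D c = 0" and t: "a \<le> t" "t \<le> b"
  shows "D t = 0"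
proof (cases "c \<le> t")
  case True
  have "D t * exp (- C * t) \<le> D c * exp (- C * c)"
  proof (rule DERIV_nonpos_imp_nonincreasing[where f="\<lambda>x. D x * exp (- C * x)", OF True])
    fix x assume x: "c \<le> x" "x \<le> t"
    have "((\<lambda>x. D x * exp (- C * x)) has_real_derivative (D' x - C * D x) * exp (- C * x)) (at x)"
      using der[of x] x c t by (auto intro!: derivative_eq_intros simp: algebra_simps)
    moreover have "(D' x - C * D x) * exp (- C * x) \<le> 0"
      using le[of x] x c t by (auto simp: mult_le_0_iff)
    ultimately show "\<exists>y. ((\<lambda>x. D x * exp (- C * x)) has_real_derivative y) (at x) \<and> y \<le> 0" by blast
  qed
  then have "D t * exp (- C * t) \<le> 0" using c by simp
  then show ?thesis using nn[OF t] by (auto simp: mult_le_0_iff)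
next
  case False
  have "D t * exp (C * t) \<le> D c * exp (C * c)"
  proof (rule DERIV_nonneg_imp_nondecreasing[where f="\<lambda>x. D x * exp (C * x)"])
    show "t \<le> c" using False by simp
    fix x assume x: "t \<le> x" "x \<le> c"
    have "((\<lambda>x. D x * exp (C * x)) has_real_derivative (D' x + C * D x) * exp (C * x)) (at x)"
      using der[of x] x c t by (auto intro!: derivative_eq_intros simp: algebra_simps)
    moreover have "(D' x + C * D x) * exp (C * x) \<ge> 0"
      using le[of x] x c t by (auto simp: zero_le_mult_iff)
    ultimately show "\<exists>y. ((\<lambda>x. D x * exp (C * x)) has_real_derivative y) (at x) \<and> 0 \<le> y" by blast
  qed
  then have "D t * exp (C * t) \<le> 0" using c by simp
  then show ?thesis using nn[OF t] by (auto simp: mult_le_0_iff)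
qed

theorem polynomial_ODE_unique:
  fixes e :: "nat \<Rightarrow> pexp"
  assumes vars: "\<And>i. i < N \<Longrightarrow> pvars (e i) \<subseteq> {..<N}"
    and y: "\<And>i t. i < N \<Longrightarrow> a \<le> t \<Longrightarrow> t \<le> b \<Longrightarrow> (y i has_real_derivative pval (e i) (\<lambda>i. y i t)) (at t)"
    and z: "\<And>i t. i < N \<Longrightarrow> a \<le> t \<Longrightarrow> t \<le> b \<Longrightarrow> (z i has_real_derivative pval (e i) (\<lambda>i. z i t)) (at t)"
    and bd: "\<And>i t. a \<le> t \<Longrightarrow> t \<le> b \<Longrightarrow> \<bar>y i t\<bar> \<le> M" "\<And>i t. a \<le> t \<Longrightarrow> t \<le> b \<Longrightarrow> \<bar>z i t\<bar> \<le> M"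
    and c: "a \<le> c" "c \<le> b" "\<And>i. i < N \<Longrightarrow> y i c = z i c" and t: "a \<le> t" "t \<le> b" and i: "i < N"
  shows "y i t = z i t"
proof -
  have M: "M \<ge> 0" using bd(1)[OF t, of 0] by linarith
  have "\<exists>C\<ge>0. \<forall>x y. (\<forall>i. \<bar>x i\<bar> \<le> M) \<longrightarrow> (\<forall>i. \<bar>y i\<bar> \<le> M) \<longrightarrow>
    \<bar>pval (e j) x - pval (e j) y\<bar> \<le> C * (\<Sum>i<N. \<bar>x i - y i\<bar>)" if "j < N" for j
    using pval_Lipschitz[OF _ M vars[OF that]] by simp
  then obtain L where L: "\<And>j. j < N \<Longrightarrow> L j \<ge> 0" "\<And>j x y. j < N \<Longrightarrow> (\<forall>i. \<bar>x i\<bar> \<le> M) \<Longrightarrow> (\<forall>i. \<bar>y i\<bar> \<le> M) \<Longrightarrow>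
    \<bar>pval (e j) x - pval (e j) y\<bar> \<le> L j * (\<Sum>i<N. \<bar>x i - y i\<bar>)"
    by metis
  define D where "D t = (\<Sum>i<N. (y i t - z i t)\<^sup>2)" for t
  define D' where "D' t = (\<Sum>i<N. 2 * (y i t - z i t) * (pval (e i) (\<lambda>i. y i t) - pval (e i) (\<lambda>i. z i t)))" for t
  \<comment> \<open>With \<open>S\<close> the l1 distance of the two solutions, \<open>D'\<close> is
    at most \<open>2 * (\<Sum>j<N. L j)\<close> times the square of \<open>S\<close>, and that
    square is at most \<open>N * D\<close> by Cauchy-Schwarz.\<close>
  define K where "K = 2 * real N * (\<Sum>j<N. L j)"
  have "D t = 0"
  proof (rule Gronwall_zero[where D=D and D'=D' and C=K and a=a and b=b and c=c and t=t])
    fix s assume s: "a \<le> s" "s \<le> b"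
    show "(D has_real_derivative D' s) (at s)"
      unfolding D_def[abs_def] D'_def
      using y[OF _ s] z[OF _ s] by (auto intro!: derivative_eq_intros sum.cong simp: algebra_simps)
    show "0 \<le> D s" by (simp add: D_def sum_nonneg)
    define S where "S = (\<Sum>i<N. \<bar>y i s - z i s\<bar>)"
    have S0: "S \<ge> 0" by (simp add: S_def sum_nonneg)
    have "\<bar>D' s\<bar> \<le> (\<Sum>i<N. \<bar>2 * (y i s - z i s) * (pval (e i) (\<lambda>i. y i s) - pval (e i) (\<lambda>i. z i s))\<bar>)"
      unfolding D'_def by (rule sum_abs)
    also have "\<dots> \<le> (\<Sum>i<N. 2 * S * (L i * S))"
    proof (rule sum_mono)
      fix i assume i: "i \<in> {..<N}"
      have "\<bar>y i s - z i s\<bar> \<le> S"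
        unfolding S_def using i by (intro member_le_sum[of i "{..<N}" "\<lambda>i. \<bar>y i s - z i s\<bar>"]) auto
      moreover have "\<bar>pval (e i) (\<lambda>i. y i s) - pval (e i) (\<lambda>i. z i s)\<bar> \<le> L i * S"
        unfolding S_def using i bd s by (intro L(2)) auto
      ultimately show "\<bar>2 * (y i s - z i s) * (pval (e i) (\<lambda>i. y i s) - pval (e i) (\<lambda>i. z i s))\<bar> \<le> 2 * S * (L i * S)"
        unfolding abs_mult by (intro mult_mono) (auto simp: S0)
    qed
    also have "\<dots> = 2 * (\<Sum>j<N. L j) * S\<^sup>2"
      by (simp add: sum_distrib_left sum_distrib_right power2_eq_square mult_ac)
    also have "\<dots> \<le> 2 * (\<Sum>j<N. L j) * (real N * D s)"
    proof -
      have "S\<^sup>2 \<le> real N * (\<Sum>i<N. \<bar>y i s - z i s\<bar>\<^sup>2)"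
        unfolding S_def using sum_squared_le_sum_of_squares[of "\<lambda>i. \<bar>y i s - z i s\<bar>" "{..<N}"] by (simp add: mult.commute)
      then show ?thesis using L(1) by (intro mult_left_mono) (auto simp: D_def intro!: sum_nonneg)
    qed
    finally show "\<bar>D' s\<bar> \<le> K * D s" by (simp add: K_def mult_ac)
  qed (use c t in \<open>auto simp: D_def\<close>)
  then have "(y i t - z i t)\<^sup>2 = 0"
    unfolding D_def using i by (subst (asm) sum_nonneg_eq_0_iff) auto
  then show ?thesis by simp
qed


section \<open>The profile equation\<close>

lemma fps_value_shift:
  fixes a :: "real fps"
  assumes s: "summable (\<lambda>j. \<bar>fps_nth a j\<bar> * R ^ j)" and x: "\<bar>x\<bar> < R"
  shows "summable (\<lambda>j. fps_nth (fps_shift 1 a) j * x ^ j)"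
    and "fps_value a x = fps_nth a 0 + x * fps_value (fps_shift 1 a) x"
proof -
  have R: "R > 0" using x by linarith
  have "summable (\<lambda>j. \<bar>fps_nth a (Suc j)\<bar> * R ^ Suc j)" using s by (subst summable_Suc_iff)
  from summable_mult[OF this, of "inverse R"]
  have "summable (\<lambda>j. \<bar>fps_nth (fps_shift 1 a) j\<bar> * R ^ j)" using R by (simp add: field_simps)
  then show s': "summable (\<lambda>j. fps_nth (fps_shift 1 a) j * x ^ j)"
    by (rule fps_value_summable(2)) (use x in simp)
  have "fps_value a x = fps_nth a 0 + (\<Sum>j. fps_nth a (Suc j) * x ^ Suc j)"
    unfolding fps_value_def
    using suminf_split_head[OF fps_value_summable(2)[OF s, of x]] x by simp
  also have "(\<Sum>j. fps_nth a (Suc j) * x ^ Suc j) = x * fps_value (fps_shift 1 a) x"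
    unfolding fps_value_def using suminf_mult[OF s', of x] by (simp add: mult_ac)
  finally show "fps_value a x = fps_nth a 0 + x * fps_value (fps_shift 1 a) x" .
qed

lemma fps_value_deriv_summable:
  fixes a :: "real fps"
  assumes s: "summable (\<lambda>j. \<bar>fps_nth a j\<bar> * R ^ j)" and x: "\<bar>x\<bar> < R"
  shows "summable (\<lambda>j. fps_nth (fps_deriv a) j * x ^ j)"
  using termdiff_converges[of x R "fps_nth a"] fps_value_summable(2)[OF s] x
  by (simp add: diffs_def)

lemma fps_value_add:
  "summable (\<lambda>j. fps_nth a j * x ^ j) \<Longrightarrow> summable (\<lambda>j. fps_nth b j * x ^ j) \<Longrightarrow>
    fps_value (a + b) x = fps_value a x + fps_value b x"
  by (simp add: fps_value_def suminf_add distrib_right)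

lemma fps_value_cmult:
  "summable (\<lambda>j. fps_nth a j * x ^ j) \<Longrightarrow> fps_value (fps_const c * a) x = c * fps_value a x"
  by (simp add: fps_value_def suminf_mult mult.assoc)

text \<open>\<open>L\<close> is the squared singular value and \<open>\<kappa>\<close> is
  \<open>k - 1\<close>. The linearisation of \<open>field\<close> at the origin has characteristic
  polynomial (\<mu> + 1) (\<mu> + n) - p L; the last assumption says that \<open>\<kappa>\<close> is
  its positive root.\<close>

locale profile_ODE =
  fixes n p L \<kappa> :: real
  assumes p: "0 < p" "p < n" and \<kappa>: "\<kappa> > 0" and L: "p * L = (\<kappa> + 1) * (\<kappa> + n)"
begin

lemma L_pos: "L > 0"
proof -
  have "p * L > 0" unfolding L using p \<kappa> by (intro mult_pos_pos) auto
  then show ?thesis using p(1) by (simp add: zero_less_mult_iff)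
qed

definition q :: "real \<Rightarrow> real" where "q x = 1 / (1 + L * x\<^sup>2)"

definition field :: "real \<Rightarrow> real \<Rightarrow> real" where
  "field x y = - y - ((n - p + p * q x) * y + (n - p + (1 - L) * p * q x) * x) * (1 + (x + y)\<^sup>2)"

definition solution :: "real set \<Rightarrow> (real \<Rightarrow> real) \<Rightarrow> (real \<Rightarrow> real) \<Rightarrow> bool" where
  "solution S \<phi> \<psi> \<longleftrightarrow> (\<forall>t\<in>S. (\<phi> has_real_derivative \<psi> t) (at t) \<and>
     (\<psi> has_real_derivative field (\<phi> t) (\<psi> t)) (at t))"

lemma solutionD:
  assumes "solution S \<phi> \<psi>" "t \<in> S"
  shows "(\<phi> has_real_derivative \<psi> t) (at t)" "(\<psi> has_real_derivative field (\<phi> t) (\<psi> t)) (at t)"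
  using assms unfolding solution_def by auto

lemma solution_subset: "solution S \<phi> \<psi> \<Longrightarrow> T \<subseteq> S \<Longrightarrow> solution T \<phi> \<psi>"
  unfolding solution_def by blast

lemma denom_pos: "1 + L * x\<^sup>2 > 0"
  using L_pos by (simp add: add_pos_nonneg)

lemma q_pos: "q x > 0" and q_le_1: "q x \<le> 1"
  using denom_pos[of x] L_pos by (auto simp: q_def divide_le_eq)

lemma q_has_derivative:
  assumes "(\<phi> has_real_derivative \<psi> t) (at t)"
  shows "((\<lambda>t. q (\<phi> t)) has_real_derivative - 2 * L * ((q (\<phi> t) * q (\<phi> t)) * (\<phi> t * \<psi> t))) (at t)"
  unfolding q_def using denom_pos[of "\<phi> t"]
  by (auto intro!: derivative_eq_intros assms simp: power2_eq_square divide_simps)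

text \<open>\<open>field\<close> is only rational. With \<open>q\<close> as a third unknown,
  \<open>Var 2\<close>, it becomes polynomial, and the system closes because the derivative of
  \<open>q\<close> is polynomial in the three unknowns.\<close>

definition field_exp :: pexp where
  "field_exp = Add (Mul (Const (-1)) (Var 1))
     (Mul (Mul (Const (-1)) (Add
         (Mul (Add (Const (n - p)) (Mul (Const p) (Var 2))) (Var 1))
         (Mul (Add (Const (n - p)) (Mul (Const ((1 - L) * p)) (Var 2))) (Var 0))))
       (Add (Const 1) (Mul (Add (Var 0) (Var 1)) (Add (Var 0) (Var 1)))))"

lemma pval_field_exp:
  assumes "Y 2 = q (Y 0)"
  shows "pval field_exp Y = field (Y 0) (Y 1)"
  unfolding field_exp_def field_def by (simp add: assms[unfolded One_nat_def] power2_eq_square) algebra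

definition system :: "nat \<Rightarrow> pexp" where
  "system i = (if i = 0 then Var 1 else if i = 1 then field_exp
     else if i = 2 then Mul (Const (- 2 * L)) (Mul (Mul (Var 2) (Var 2)) (Mul (Var 0) (Var 1)))
     else Const 0)"

definition state :: "(real \<Rightarrow> real) \<Rightarrow> (real \<Rightarrow> real) \<Rightarrow> nat \<Rightarrow> real \<Rightarrow> real" where
  "state \<phi> \<psi> i t = (if i = 0 then \<phi> t else if i = 1 then \<psi> t else if i = 2 then q (\<phi> t) else 0)"

lemma state_has_derivative:
  assumes "solution S \<phi> \<psi>" "t \<in> S" "i < 3"
  shows "(state \<phi> \<psi> i has_real_derivative pval (system i) (\<lambda>i. state \<phi> \<psi> i t)) (at t)"
proof -
  note d = solutionD[OF assms(1,2)]
  have f: "pval field_exp (\<lambda>i. state \<phi> \<psi> i t) = field (\<phi> t) (\<psi> t)"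
    by (subst pval_field_exp) (simp_all add: state_def)
  have st: "state \<phi> \<psi> 0 = \<phi>" "state \<phi> \<psi> 1 = \<psi>" "state \<phi> \<psi> 2 = (\<lambda>t. q (\<phi> t))"
    by (auto simp: state_def fun_eq_iff)
  consider "i = 0" | "i = 1" | "i = 2" using assms(3) by linarith
  then show ?thesis
  proof cases
    case 1
    then show ?thesis using d(1) st by (simp add: system_def)
  next
    case 2
    then show ?thesis using d(2) f st by (simp add: system_def)
  next
    case 3
    then show ?thesis using q_has_derivative[where \<phi>=\<phi> and \<psi>=\<psi> and t=t, OF d(1)] st by (simp add: system_def)
  qed
qed

lemma solution_unique:
  assumes s1: "solution {a..b} \<phi>1 \<psi>1" and s2: "solution {a..b} \<phi>2 \<psi>2"
    and c: "c \<in> {a..b}" "\<phi>1 c = \<phi>2 c" "\<psi>1 c = \<psi>2 c" and t: "t \<in> {a..b}"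
  shows "\<phi>1 t = \<phi>2 t" "\<psi>1 t = \<psi>2 t"
proof -
  have "continuous_on {a..b} f" if "\<And>t. t \<in> {a..b} \<Longrightarrow> \<exists>d. (f has_real_derivative d) (at t)" for f :: "real \<Rightarrow> real"
    using that by (meson DERIV_isCont continuous_at_imp_continuous_on)
  then have "continuous_on {a..b} \<phi>1" "continuous_on {a..b} \<psi>1" "continuous_on {a..b} \<phi>2" "continuous_on {a..b} \<psi>2"
    using solutionD[OF s1] solutionD[OF s2] by blast+
  then have "bounded (\<phi>1 ` {a..b} \<union> \<psi>1 ` {a..b} \<union> \<phi>2 ` {a..b} \<union> \<psi>2 ` {a..b})"
    by (simp add: compact_continuous_image compact_imp_bounded)
  then obtain M where M': "\<And>x. x \<in> \<phi>1 ` {a..b} \<union> \<psi>1 ` {a..b} \<union> \<phi>2 ` {a..b} \<union> \<psi>2 ` {a..b} \<Longrightarrow> \<bar>x\<bar> \<le> M"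
    unfolding bounded_iff real_norm_def by metis
  have M: "\<bar>\<phi>1 t\<bar> \<le> M \<and> \<bar>\<psi>1 t\<bar> \<le> M \<and> \<bar>\<phi>2 t\<bar> \<le> M \<and> \<bar>\<psi>2 t\<bar> \<le> M" if "t \<in> {a..b}" for t
    using that M' by blast
  have vars: "pvars (system i) \<subseteq> {..<3}" for i
    by (auto simp: system_def field_exp_def)
  have bd: "\<bar>state \<phi> \<psi> i t\<bar> \<le> max M 1" if "\<bar>\<phi> t\<bar> \<le> M" "\<bar>\<psi> t\<bar> \<le> M" for \<phi> \<psi> i t
    using that q_pos[of "\<phi> t"] q_le_1[of "\<phi> t"] by (auto simp: state_def)
  have "state \<phi>1 \<psi>1 i t = state \<phi>2 \<psi>2 i t" if "i < 3" for i
  proof (rule polynomial_ODE_unique[where e=system and N=3 and a=a and b=b and c=c and M="max M 1"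
        and y="state \<phi>1 \<psi>1" and z="state \<phi>2 \<psi>2"])
    show "\<And>i t. i < 3 \<Longrightarrow> a \<le> t \<Longrightarrow> t \<le> b \<Longrightarrow>
        (state \<phi>1 \<psi>1 i has_real_derivative pval (system i) (\<lambda>i. state \<phi>1 \<psi>1 i t)) (at t)"
      using state_has_derivative[OF s1] by simp
    show "\<And>i t. i < 3 \<Longrightarrow> a \<le> t \<Longrightarrow> t \<le> b \<Longrightarrow>
        (state \<phi>2 \<psi>2 i has_real_derivative pval (system i) (\<lambda>i. state \<phi>2 \<psi>2 i t)) (at t)"
      using state_has_derivative[OF s2] by simp
    show "state \<phi>1 \<psi>1 i c = state \<phi>2 \<psi>2 i c" for i using c by (simp add: state_def)
  qed (use vars bd M c t that in auto)
  from this[of 0] this[of 1] show "\<phi>1 t = \<phi>2 t" "\<psi>1 t = \<psi>2 t" by (simp_all add: state_def)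
qed

text \<open>The equation is autonomous, so it is solved at time 0 and translated; the step
  \<open>\<delta>\<close> depends on the bound \<open>A\<close> alone.\<close>

lemma local_solution:
  assumes A: "A \<ge> 0"
  shows "\<exists>\<delta>>0. \<forall>t0 x y. \<bar>x\<bar> \<le> A \<longrightarrow> \<bar>y\<bar> \<le> A \<longrightarrow> (\<exists>\<phi> \<psi>. \<phi> t0 = x \<and> \<psi> t0 = y \<and>
    solution {t0 - \<delta><..<t0 + \<delta>} \<phi> \<psi> \<and> analytic_real {t0 - \<delta><..<t0 + \<delta>} \<phi>)"
proof -
  have sys: "system i = Const 0" if "i \<ge> 3" for i using that by (simp add: system_def)
  obtain R where R: "R > 0" "\<And>y0. \<forall>i. \<bar>y0 i\<bar> \<le> max A 1 \<Longrightarrow> \<exists>y. \<forall>i. y i 0 = y0 i \<and> analytic_real {x. \<bar>x\<bar> < R} (y i) \<and>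
    (\<forall>x. \<bar>x\<bar> < R \<longrightarrow> (y i has_real_derivative pval (system i) (\<lambda>i. y i x)) (at x))"
    using polynomial_ODE_local_solution[where e=system and N=3 and A="max A 1", OF sys max.coboundedI2[OF zero_le_one]]
    by blast
  show ?thesis
  proof (intro exI[of _ R] conjI R(1) allI impI)
    fix t0 x y :: real assume xy: "\<bar>x\<bar> \<le> A" "\<bar>y\<bar> \<le> A"
    have "\<forall>i. \<bar>state (\<lambda>_. x) (\<lambda>_. y) i 0\<bar> \<le> max A 1"
      using xy q_pos[of x] q_le_1[of x] by (auto simp: state_def)
    from R(2)[OF this] obtain Y where Y: "\<And>i. Y i 0 = state (\<lambda>_. x) (\<lambda>_. y) i 0"
       "analytic_real {x. \<bar>x\<bar> < R} (Y 0)"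
       "\<And>i x. \<bar>x\<bar> < R \<Longrightarrow> (Y i has_real_derivative pval (system i) (\<lambda>i. Y i x)) (at x)" by blast
    have Y0: "(Y 0 has_real_derivative Y 1 s) (at s)" if "\<bar>s\<bar> < R" for s
      using Y(3)[OF that, of 0] by (simp add: system_def)
    have Y1: "(Y 1 has_real_derivative pval field_exp (\<lambda>i. Y i s)) (at s)" if "\<bar>s\<bar> < R" for s
      using Y(3)[OF that, of 1] by (simp add: system_def)
    have Y2: "(Y 2 has_real_derivative - 2 * L * ((Y 2 s * Y 2 s) * (Y 0 s * Y 1 s))) (at s)" if "\<bar>s\<bar> < R" for s
      using Y(3)[OF that, of 2] by (simp add: system_def)
    \<comment> \<open>The third unknown must be recognised as \<open>q\<close> of the first. The
      defect \<open>z\<close> starts at 0 and solves a homogeneous linear equation, hence stays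
      0.\<close>
    define z where "z s = Y 2 s * (1 + L * (Y 0 s)\<^sup>2) - 1" for s
    have z': "(z has_real_derivative (- 2 * L * (Y 2 s * (Y 0 s * Y 1 s))) * z s) (at s)" if "\<bar>s\<bar> < R" for s
      unfolding z_def[abs_def]
      by (auto intro!: derivative_eq_intros Y0 Y2 that simp: algebra_simps power2_eq_square)
    have z0: "z s = 0" if s: "\<bar>s\<bar> < R" for s
    proof -
      define r where "r = \<bar>s\<bar>"
      have inR: "\<bar>t\<bar> < R" if "t \<in> {-r..r}" for t using that s unfolding r_def by auto
      have "continuous_on {-r..r} (Y i)" for i
        using Y(3)[OF inR] by (meson DERIV_isCont continuous_at_imp_continuous_on)
      then have "continuous_on {-r..r} (\<lambda>s. - 2 * L * (Y 2 s * (Y 0 s * Y 1 s)))"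
        by (intro continuous_intros)
      then have "bounded ((\<lambda>s. - 2 * L * (Y 2 s * (Y 0 s * Y 1 s))) ` {-r..r})"
        by (intro compact_imp_bounded compact_continuous_image) auto
      then obtain C where C: "\<And>t. t \<in> {-r..r} \<Longrightarrow> \<bar>- 2 * L * (Y 2 t * (Y 0 t * Y 1 t))\<bar> \<le> C"
        unfolding bounded_iff real_norm_def by blast
      have "(z s)\<^sup>2 = 0"
      proof (rule Gronwall_zero[where D="\<lambda>s. (z s)\<^sup>2" and a="-r" and b=r and c=0 and t=s and C="2 * C"
            and D'="\<lambda>s. 2 * (- 2 * L * (Y 2 s * (Y 0 s * Y 1 s))) * (z s)\<^sup>2"])
        fix t assume t: "- r \<le> t" "t \<le> r"
        then have t': "\<bar>t\<bar> < R" "t \<in> {-r..r}" using inR by auto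
        show "((\<lambda>s. (z s)\<^sup>2) has_real_derivative 2 * (- 2 * L * (Y 2 t * (Y 0 t * Y 1 t))) * (z t)\<^sup>2) (at t)"
          by (rule DERIV_cong[OF DERIV_power[OF z'[OF t'(1)], of 2]]) (simp add: power2_eq_square)
        have "\<bar>2 * (- 2 * L * (Y 2 t * (Y 0 t * Y 1 t))) * (z t)\<^sup>2\<bar> = 2 * \<bar>- 2 * L * (Y 2 t * (Y 0 t * Y 1 t))\<bar> * (z t)\<^sup>2"
          by (simp only: abs_mult abs_numeral abs_power2)
        also have "\<dots> \<le> 2 * C * (z t)\<^sup>2"
          using C[OF t'(2)] by (intro mult_right_mono mult_left_mono) auto
        finally show "\<bar>2 * (- 2 * L * (Y 2 t * (Y 0 t * Y 1 t))) * (z t)\<^sup>2\<bar> \<le> 2 * C * (z t)\<^sup>2" .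
      next
        show "(z 0)\<^sup>2 = 0"
          unfolding z_def Y(1) using denom_pos[of x] by (simp add: state_def q_def)
      qed (auto simp: r_def)
      then show ?thesis by simp
    qed
    have Y2q: "Y 2 s = q (Y 0 s)" if "\<bar>s\<bar> < R" for s
      using z0[OF that] denom_pos[of "Y 0 s"] by (simp add: z_def q_def field_simps)
    have fld: "pval field_exp (\<lambda>i. Y i s) = field (Y 0 s) (Y 1 s)" if "\<bar>s\<bar> < R" for s
      by (rule pval_field_exp[of "\<lambda>i. Y i s", OF Y2q[OF that]])
    have sh: "((\<lambda>t. t - t0) has_real_derivative 1) (at t)" for t
      by (auto intro!: derivative_eq_intros)
    have inR: "\<bar>t - t0\<bar> < R" if "t \<in> {t0 - R<..<t0 + R}" for t using that by auto
    have "solution {t0 - R<..<t0 + R} (\<lambda>t. Y 0 (t - t0)) (\<lambda>t. Y 1 (t - t0))"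
      unfolding solution_def
    proof (intro ballI conjI)
      fix t assume "t \<in> {t0 - R<..<t0 + R}"
      note t = inR[OF this]
      show "((\<lambda>t. Y 0 (t - t0)) has_real_derivative Y 1 (t - t0)) (at t)"
        using DERIV_chain2[OF Y0[OF t] sh] by simp
      show "((\<lambda>t. Y 1 (t - t0)) has_real_derivative field (Y 0 (t - t0)) (Y 1 (t - t0))) (at t)"
        using DERIV_chain2[OF Y1[OF t] sh] fld[OF t] by simp
    qed
    moreover have "analytic_real {t0 - R<..<t0 + R} (\<lambda>t. Y 0 (t - t0))"
    proof (rule analytic_real_compose[OF Y(2)])
      show "analytic_real {t0 - R<..<t0 + R} (\<lambda>t. t - t0)"
        by (rule analytic_real_holomorphic[where r="\<lambda>_. 1" and g="\<lambda>z. z - of_real t0"])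
          (auto intro!: holomorphic_intros)
    qed (use inR in auto)
    ultimately show "\<exists>\<phi> \<psi>. \<phi> t0 = x \<and> \<psi> t0 = y \<and>
      solution {t0 - R<..<t0 + R} \<phi> \<psi> \<and> analytic_real {t0 - R<..<t0 + R} \<phi>"
      using Y(1) by (intro exI[of _ "\<lambda>t. Y 0 (t - t0)"] exI[of _ "\<lambda>t. Y 1 (t - t0)"]) (simp add: state_def)
  qed
qed

text \<open>Near each point uniqueness identifies the solution with the power series solution
  through the same values.\<close>

lemma solution_analytic:
  assumes s: "solution S \<phi> \<psi>" and S: "open S"
  shows "analytic_real S \<phi>"
  unfolding analytic_real_def
proof
  fix a assume a: "a \<in> S"
  define A where "A = max \<bar>\<phi> a\<bar> \<bar>\<psi> a\<bar>"
  have A: "\<bar>\<phi> a\<bar> \<le> A" "\<bar>\<psi> a\<bar> \<le> A" "A \<ge> 0" by (auto simp: A_def)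
  obtain \<delta> \<phi>1 \<psi>1 where d: "\<delta> > 0" "\<phi>1 a = \<phi> a" "\<psi>1 a = \<psi> a" "solution {a - \<delta><..<a + \<delta>} \<phi>1 \<psi>1"
      "analytic_real {a - \<delta><..<a + \<delta>} \<phi>1"
    using local_solution[OF A(3)] A(1,2) by blast
  obtain e where e: "e > 0" "ball a e \<subseteq> S" using S a openE by blast
  define r where "r = min \<delta> e / 2"
  have r: "r > 0" using d e by (simp add: r_def)
  have s2: "solution {a - r..a + r} \<phi> \<psi>"
    by (rule solution_subset[OF s]) (use e in \<open>auto simp: r_def subset_iff dist_real_def\<close>)
  have s1: "solution {a - r..a + r} \<phi>1 \<psi>1"
    by (rule solution_subset[OF d(4)]) (use d e in \<open>auto simp: r_def\<close>)
  have eq: "\<phi>1 x = \<phi> x" if "\<bar>x - a\<bar> < r" for x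
    by (rule solution_unique(1)[OF s1 s2, where c=a]) (use that r d(2,3) in auto)
  have "a \<in> {a - \<delta><..<a + \<delta>}" using d by simp
  from analytic_realE[OF d(5) this] obtain r1 g where g: "r1 > 0" "g holomorphic_on ball (of_real a) r1"
    "\<And>x. \<bar>x - a\<bar> < r1 \<Longrightarrow> g (of_real x) = of_real (\<phi>1 x)" by blast
  have "g holomorphic_on ball (of_real a) (min r r1)"
    by (rule holomorphic_on_subset[OF g(2)]) auto
  then show "\<exists>r>0. \<exists>g. g holomorphic_on ball (of_real a) r \<and>
     (\<forall>x. \<bar>x - a\<bar> < r \<longrightarrow> g (of_real x) = of_real (\<phi> x))"
    using g r eq by (intro exI[of _ "min r r1"] conjI exI[of _ g]) auto
qed

end


section \<open>The orbit that leaves the origin\<close>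

context profile_ODE
begin

text \<open>The one-dimensional unstable manifold of the origin, in the form \<open>\<phi> = s h(s\<^sup>2)\<close>,
  \<open>\<psi> = s (\<kappa> h + d)(s\<^sup>2)\<close> with \<open>s = exp (\<kappa> t)\<close>. In the variable \<open>u = s\<^sup>2\<close> the system has a regular
  singular point at \<open>0\<close>, with exponents \<open>0\<close> (for \<open>h\<close>) and \<open>- (2 \<kappa> + 1 + n) / (2 \<kappa>)\<close> (for \<open>d\<close>).
  The variables \<open>0\<close>, \<open>1\<close>, \<open>2\<close> of the recursion stand for \<open>h\<close>, \<open>d\<close>, \<open>q\<close>.\<close>

definition slope_exp :: pexp where "slope_exp = Add (Mul (Const \<kappa>) (Var 0)) (Var 1)"

text \<open>The nonlinear part of \<open>field\<close> divided by \<open>s^3\<close>. The first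
  summand comes from \<open>1 - q = x L h^2 q\<close>, which exhibits the factor
  \<open>x = s^2\<close>; the second from the factor (h + slope)^2.\<close>

definition remainder_exp :: pexp where
  "remainder_exp = Add
    (Mul (Const (L * p)) (Mul (Mul (Mul (Var 0) (Var 0)) (Var 2)) (Add slope_exp (Mul (Const (1 - L)) (Var 0)))))
    (Mul (Const (-1)) (Mul
      (Add (Mul (Add (Const (n - p)) (Mul (Const p) (Var 2))) slope_exp)
           (Mul (Add (Const (n - p)) (Mul (Const ((1 - L) * p)) (Var 2))) (Var 0)))
      (Mul (Add (Var 0) slope_exp) (Add (Var 0) slope_exp))))"

definition origin_exps :: "nat \<Rightarrow> pexp" where
  "origin_exps i = (if i = 0 \<or> i = 1 then remainder_exp
    else if i = 2 then Mul (Const (- L)) (Mul (Mul (Var 0) (Var 0)) (Var 2)) else Const 0)"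

definition \<nu> :: real where "\<nu> = (2 * \<kappa> + 1 + n) / (2 * \<kappa>)"

text \<open>On the \<open>j\<close>-th coefficients \<open>2 \<kappa> x h' = d\<close> means
  division by \<open>2 \<kappa> j\<close>, and
  \<open>2 \<kappa> (x d' + \<nu> d) = x * remainder\<close> division by
  \<open>2 \<kappa> (j + \<nu>)\<close>. For \<open>h\<close> both divisions are combined, so
  \<open>h\<close> and \<open>d\<close> share one right-hand side. As \<open>\<nu>\<close> is
  positive there is no resonance.\<close>

definition origin_weights :: "nat \<Rightarrow> nat \<Rightarrow> real" where
  "origin_weights i j = (if i = 0 then 1 / (4 * \<kappa>\<^sup>2 * j * (j + \<nu>)) else if i = 1 then 1 / (2 * \<kappa> * (j + \<nu>)) else 1)"

lemma \<nu>_pos: "\<nu> > 0" using p \<kappa> by (simp add: \<nu>_def)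

lemma field_origin_identity:
  assumes Q: "Q = 1 - x * L * h\<^sup>2 * Q" and s: "s\<^sup>2 = x" and q: "q (s * h) = Q"
  shows "field (s * h) (s * (\<kappa> * h + d)) = s * (\<kappa>\<^sup>2 * h - (1 + n) * d + x * pval remainder_exp (\<lambda>i. if i = 0 then h else if i = 1 then d else Q))"
proof -
  define g where "g = \<kappa> * h + d"
  define B where "B = (n - p + p * Q) * g + (n - p + (1 - L) * p * Q) * h"
  have r: "pval remainder_exp (\<lambda>i. if i = 0 then h else if i = 1 then d else Q) =
      L * p * (h\<^sup>2 * Q * (g + (1 - L) * h)) - B * (h + g)\<^sup>2"
    by (simp add: remainder_exp_def slope_exp_def g_def B_def power2_eq_square)
  have "s * (\<kappa>\<^sup>2 * h - (1 + n) * d + x * pval remainder_exp (\<lambda>i. if i = 0 then h else if i = 1 then d else Q)) =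
      s * (\<kappa>\<^sup>2 * h - (1 + n) * d + p * (x * L * h\<^sup>2 * Q) * (g + (1 - L) * h) - x * (B * (h + g)\<^sup>2))"
    unfolding r by (simp add: algebra_simps)
  also have "x * L * h\<^sup>2 * Q = 1 - Q" using Q by simp
  also have "\<kappa>\<^sup>2 * h - (1 + n) * d + p * (1 - Q) * (g + (1 - L) * h) = - g - B"
  proof -
    have "\<kappa>\<^sup>2 * h - (1 + n) * d + p * (1 - Q) * (g + (1 - L) * h) + g + B = h * ((\<kappa> + 1) * (\<kappa> + n) - p * L)"
      by (simp add: B_def g_def algebra_simps power2_eq_square)
    \<comment> \<open>The choice of the exponent \<open>\<kappa>\<close> cancels the leftover
      multiple of \<open>h\<close>.\<close>
    then show ?thesis using L by simp
  qed
  also have "s * (- g - B - x * (B * (h + g)\<^sup>2)) = field (s * h) (s * g)"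
    unfolding field_def q B_def s[symmetric] by (simp add: algebra_simps power2_eq_square)
  finally show ?thesis by (simp add: g_def)
qed

text \<open>Another positive value of \<open>h 0\<close> would only translate the orbit in
  time.\<close>

theorem origin_orbit:
  obtains R h d where "R > 0" "analytic_real {x. \<bar>x\<bar> < R} h" "h 0 = (1::real)" "d 0 = (0::real)" "isCont d 0"
    "solution {t. exp (2 * \<kappa> * t) < R} (\<lambda>t. exp (\<kappa> * t) * h (exp (2 * \<kappa> * t)))
       (\<lambda>t. exp (\<kappa> * t) * (\<kappa> * h (exp (2 * \<kappa> * t)) + d (exp (2 * \<kappa> * t))))"
proof -
  have e: "origin_exps i = Const 0" if "i \<ge> 3" for i using that by (simp add: origin_exps_def)
  define C where "C = 1 + 1 / (4 * \<kappa>\<^sup>2) + 1 / (2 * \<kappa>)"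
  have w: "\<bar>origin_weights i (Suc j)\<bar> \<le> C" for i j
  proof -
    have j: "real (Suc j) + \<nu> \<ge> 1" "real (Suc j) * (real (Suc j) + \<nu>) \<ge> 1 * 1"
      using \<nu>_pos by (simp, intro mult_mono) auto
    have "1 / (4 * \<kappa>\<^sup>2 * real (Suc j) * (real (Suc j) + \<nu>)) \<le> 1 / (4 * \<kappa>\<^sup>2 * 1)"
      unfolding mult.assoc[of "4 * \<kappa>\<^sup>2"] using j \<kappa> by (intro divide_left_mono mult_left_mono mult_pos_pos) auto
    moreover have "1 / (2 * \<kappa> * (real (Suc j) + \<nu>)) \<le> 1 / (2 * \<kappa> * 1)"
      using j \<kappa> by (intro divide_left_mono mult_left_mono mult_pos_pos) auto
    moreover have "0 \<le> 1 / (4 * \<kappa>\<^sup>2 * real (Suc j) * (real (Suc j) + \<nu>))" "0 \<le> 1 / (2 * \<kappa> * (real (Suc j) + \<nu>))"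
      using j \<kappa> by auto
    moreover have "0 \<le> 1 / (4 * \<kappa>\<^sup>2)" "0 \<le> 1 / (2 * \<kappa>)" using \<kappa> by auto
    moreover have "\<bar>if i = 0 then a else if i = 1 then b else 1\<bar> \<le> 1 + A + B"
      if "a \<le> A" "b \<le> B" "0 \<le> a" "0 \<le> b" "0 \<le> A" "0 \<le> B" for a b A B :: real
      using that by auto
    ultimately show ?thesis
      unfolding origin_weights_def C_def mult_1_right by blast
  qed
  \<comment> \<open>The values of \<open>h\<close>, \<open>d\<close>, \<open>q\<close> at the origin
    are 1, 0, 1.\<close>
  define y0 :: "nat \<Rightarrow> real" where "y0 i = (if i = 0 \<or> i = 2 then 1 else 0)" for i
  have y0: "\<forall>i. \<bar>y0 i\<bar> \<le> 1" by (simp add: y0_def)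
  obtain R where R: "R > 0" "\<And>y0. \<forall>i. \<bar>y0 i\<bar> \<le> 1 \<Longrightarrow> \<exists>Y.
    (\<forall>i. fps_nth (Y i) 0 = y0 i \<and> (\<forall>j. fps_nth (Y i) (Suc j) = origin_weights i (Suc j) * fps_nth (pfps (origin_exps i) Y) j)) \<and>
    (\<forall>i J. partial_norm R J (Y i) \<le> 1 + 1)"
    using polynomial_recursion[where e=origin_exps and w=origin_weights and N=3, OF e w zero_le_one] by blast
  obtain Y where Y: "\<And>i. fps_nth (Y i) 0 = y0 i"
    "\<And>i j. fps_nth (Y i) (Suc j) = origin_weights i (Suc j) * fps_nth (pfps (origin_exps i) Y) j"
    "\<And>i J. partial_norm R J (Y i) \<le> 1 + 1"
    using R(2)[OF y0] by blast
  have R0: "R \<ge> 0" using R(1) by simp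
  have sm: "summable (\<lambda>j. \<bar>fps_nth (Y i) j\<bar> * R ^ j)" for i
    by (rule partial_norm_bounded_summable[OF R0 Y(3)])
  note sh = fps_value_shift[OF sm] and ds = fps_value_deriv_summable[OF sm]
  let ?h = "fps_value (Y 0)" and ?h' = "fps_value (fps_deriv (Y 0))"
    and ?d = "fps_value (Y 1)" and ?d' = "fps_value (fps_deriv (Y 1))" and ?q = "fps_value (Y 2)"
  have nz: "real (Suc j) + \<nu> \<noteq> 0" for j using \<nu>_pos by (simp add: add_pos_pos less_imp_neq[symmetric])
  \<comment> \<open>The equation \<open>d = 2 \<kappa> x h'\<close> with \<open>x\<close> divided
    out; it holds because both recursions have the same right-hand side and proportional
    weights.\<close>
  have f1: "fps_shift 1 (Y 1) = fps_const (2 * \<kappa>) * fps_deriv (Y 0)"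
  proof (rule fps_ext)
    fix j
    have "1 / (2 * \<kappa> * c) * E = 2 * \<kappa> * (m * (1 / (4 * \<kappa>\<^sup>2 * m * c) * E))" if "m \<noteq> 0" "c \<noteq> 0" for m c E :: real
      using that \<kappa> by (simp add: field_simps power2_eq_square)
    from this[of "real (Suc j)", OF _ nz[of j]]
    show "fps_nth (fps_shift 1 (Y 1)) j = fps_nth (fps_const (2 * \<kappa>) * fps_deriv (Y 0)) j"
      by (simp add: Y(2) origin_weights_def origin_exps_def del: of_nat_Suc)
  qed
  have f2: "fps_const (2 * \<kappa>) * (fps_deriv (Y 1) + fps_const \<nu> * fps_shift 1 (Y 1)) = pfps remainder_exp Y"
  proof (rule fps_ext)
    fix j
    have "fps_nth (fps_const (2 * \<kappa>) * (fps_deriv (Y 1) + fps_const \<nu> * fps_shift 1 (Y 1))) j =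
        2 * \<kappa> * (real (Suc j) + \<nu>) * fps_nth (Y 1) (Suc j)"
      by (simp add: algebra_simps)
    also have "\<dots> = fps_nth (pfps remainder_exp Y) j"
      unfolding Y(2) using \<kappa> nz[of j] by (simp add: origin_weights_def origin_exps_def del: of_nat_Suc)
    finally show "fps_nth (fps_const (2 * \<kappa>) * (fps_deriv (Y 1) + fps_const \<nu> * fps_shift 1 (Y 1))) j =
        fps_nth (pfps remainder_exp Y) j" .
  qed
  have f3: "fps_shift 1 (Y 2) = pfps (Mul (Const (- L)) (Mul (Mul (Var 0) (Var 0)) (Var 2))) Y"
    by (rule fps_ext) (simp only: fps_shift_nth Suc_eq_plus1[symmetric] Y(2), simp add: origin_weights_def origin_exps_def)
  have h: "(?h has_real_derivative ?h' x) (at x)" and d: "(?d has_real_derivative ?d' x) (at x)" if "\<bar>x\<bar> < R" for x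
    by (rule fps_value_has_derivative[OF sm that])+
  have hd: "2 * \<kappa> * x * ?h' x = ?d x" if x: "\<bar>x\<bar> < R" for x
    using sh(2)[OF x, of 1] fps_value_cmult[OF ds[OF x, of 0], of "2 * \<kappa>"]
    unfolding f1 by (simp add: Y(1) y0_def)
  have dE: "2 * \<kappa> * (x * ?d' x + \<nu> * ?d x) = x * pval remainder_exp (\<lambda>i. fps_value (Y i) x)" if x: "\<bar>x\<bar> < R" for x
  proof -
    have s1: "summable (\<lambda>j. fps_nth (fps_const \<nu> * fps_shift 1 (Y 1)) j * x ^ j)"
      using summable_mult[OF sh(1)[OF x, of 1], of \<nu>] by (simp add: mult.assoc)
    have s2: "summable (\<lambda>j. fps_nth (fps_deriv (Y 1) + fps_const \<nu> * fps_shift 1 (Y 1)) j * x ^ j)"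
      using summable_add[OF ds[OF x, of 1] s1] by (simp add: distrib_right)
    have "fps_value (pfps remainder_exp Y) x = 2 * \<kappa> * (?d' x + \<nu> * fps_value (fps_shift 1 (Y 1)) x)"
      unfolding f2[symmetric] fps_value_cmult[OF s2] fps_value_add[OF ds[OF x, of 1] s1]
        fps_value_cmult[OF sh(1)[OF x, of 1]] ..
    moreover have "fps_value (pfps remainder_exp Y) x = pval remainder_exp (\<lambda>i. fps_value (Y i) x)"
      by (rule fps_value_pfps[OF R0 Y(3)]) (use x in simp)
    moreover have "?d x = x * fps_value (fps_shift 1 (Y 1)) x"
      using sh(2)[OF x, of 1] by (simp add: Y(1) y0_def)
    ultimately show ?thesis by (simp add: algebra_simps)
  qed
  have q: "?q x = 1 - x * L * (?h x)\<^sup>2 * ?q x" if x: "\<bar>x\<bar> < R" for x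
  proof -
    have v: "fps_value (pfps (Mul (Const (- L)) (Mul (Mul (Var 0) (Var 0)) (Var 2))) Y) x = - L * ((?h x)\<^sup>2 * ?q x)"
      by (subst fps_value_pfps[OF R0 Y(3)]) (use x in \<open>simp_all add: power2_eq_square\<close>)
    have "?q x = fps_nth (Y 2) 0 + x * fps_value (pfps (Mul (Const (- L)) (Mul (Mul (Var 0) (Var 0)) (Var 2))) Y) x"
      using sh(2)[OF x, of 2] unfolding f3 .
    also have "\<dots> = 1 - x * L * (?h x)\<^sup>2 * ?q x" unfolding v by (simp add: Y(1) y0_def)
    finally show ?thesis .
  qed
  have rem: "pval remainder_exp (\<lambda>i. fps_value (Y i) x) = pval remainder_exp (\<lambda>i. if i = 0 then ?h x else if i = 1 then ?d x else ?q x)" for x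
    by (simp add: remainder_exp_def slope_exp_def)
  have "solution {t. exp (2 * \<kappa> * t) < R} (\<lambda>t. exp (\<kappa> * t) * ?h (exp (2 * \<kappa> * t)))
       (\<lambda>t. exp (\<kappa> * t) * (\<kappa> * ?h (exp (2 * \<kappa> * t)) + ?d (exp (2 * \<kappa> * t))))"
    unfolding solution_def
  proof (intro ballI conjI)
    fix t assume "t \<in> {t. exp (2 * \<kappa> * t) < R}"
    define x where "x = exp (2 * \<kappa> * t)"
    define s where "s = exp (\<kappa> * t)"
    have x: "\<bar>x\<bar> < R" "x > 0" and sx: "s\<^sup>2 = x"
      using \<open>t \<in> _\<close> by (auto simp: x_def s_def power2_eq_square simp flip: exp_add)
    have x': "((\<lambda>t. exp (2 * \<kappa> * t)) has_real_derivative 2 * \<kappa> * x) (at t)"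
      unfolding x_def by (auto intro!: derivative_eq_intros)
    have s': "((\<lambda>t. exp (\<kappa> * t)) has_real_derivative \<kappa> * s) (at t)"
      unfolding s_def by (auto intro!: derivative_eq_intros)
    have h1: "((\<lambda>t. ?h (exp (2 * \<kappa> * t))) has_real_derivative ?d x) (at t)"
      using DERIV_chain2[OF h[OF x(1), unfolded x_def] x'] hd[OF x(1)] by (simp add: x_def mult_ac)
    have d1: "((\<lambda>t. ?d (exp (2 * \<kappa> * t))) has_real_derivative ?d' x * (2 * \<kappa> * x)) (at t)"
      using DERIV_chain2[OF d[OF x(1), unfolded x_def] x'] by (simp add: x_def)
    show "((\<lambda>t. exp (\<kappa> * t) * ?h (exp (2 * \<kappa> * t))) has_real_derivative
        exp (\<kappa> * t) * (\<kappa> * ?h (exp (2 * \<kappa> * t)) + ?d (exp (2 * \<kappa> * t)))) (at t)"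
      by (rule DERIV_cong[OF DERIV_mult[OF s' h1]]) (simp add: x_def s_def algebra_simps)
    have Q: "q (s * ?h x) = ?q x"
    proof -
      have "?q x * (1 + L * (s * ?h x)\<^sup>2) = 1"
        using q[OF x(1)] by (simp add: power_mult_distrib sx algebra_simps)
      then show ?thesis using denom_pos[of "s * ?h x"] by (simp add: q_def field_simps)
    qed
    have "((\<lambda>t. exp (\<kappa> * t) * (\<kappa> * ?h (exp (2 * \<kappa> * t)) + ?d (exp (2 * \<kappa> * t)))) has_real_derivative
        \<kappa> * s * (\<kappa> * ?h x + ?d x) + (\<kappa> * ?d x + ?d' x * (2 * \<kappa> * x)) * s) (at t)"
      using DERIV_mult[OF s' DERIV_add[OF DERIV_cmult[OF h1, of \<kappa>] d1]] by (simp add: x_def s_def)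
    moreover have "\<kappa> * s * (\<kappa> * ?h x + ?d x) + (\<kappa> * ?d x + ?d' x * (2 * \<kappa> * x)) * s =
        field (s * ?h x) (s * (\<kappa> * ?h x + ?d x))"
    proof -
      have \<nu>: "2 * \<kappa> * \<nu> = 2 * \<kappa> + 1 + n" using \<kappa> by (simp add: \<nu>_def)
      have e1: "2 * \<kappa> * x * ?d' x = x * pval remainder_exp (\<lambda>i. fps_value (Y i) x) - (2 * \<kappa> + 1 + n) * ?d x"
        unfolding \<nu>[symmetric] dE[OF x(1), symmetric] by (simp add: algebra_simps)
      have e2: "\<kappa> * s * (\<kappa> * ?h x + ?d x) + (\<kappa> * ?d x + ?d' x * (2 * \<kappa> * x)) * s =
          s * (\<kappa>\<^sup>2 * ?h x + 2 * \<kappa> * ?d x + 2 * \<kappa> * x * ?d' x)"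
        by (simp add: algebra_simps power2_eq_square)
      have "\<kappa> * s * (\<kappa> * ?h x + ?d x) + (\<kappa> * ?d x + ?d' x * (2 * \<kappa> * x)) * s =
          s * (\<kappa>\<^sup>2 * ?h x - (1 + n) * ?d x + x * pval remainder_exp (\<lambda>i. if i = 0 then ?h x else if i = 1 then ?d x else ?q x))"
        unfolding e2 e1 rem by (simp add: algebra_simps)
      then show ?thesis unfolding field_origin_identity[OF q[OF x(1)] sx Q] .
    qed
    ultimately show "((\<lambda>t. exp (\<kappa> * t) * (\<kappa> * ?h (exp (2 * \<kappa> * t)) + ?d (exp (2 * \<kappa> * t)))) has_real_derivative
       field (exp (\<kappa> * t) * ?h (exp (2 * \<kappa> * t))) (exp (\<kappa> * t) * (\<kappa> * ?h (exp (2 * \<kappa> * t)) + ?d (exp (2 * \<kappa> * t))))) (at t)"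
      by (simp add: x_def s_def)
  qed
  moreover have "isCont ?d 0" using d[of 0] R(1) DERIV_isCont by auto
  moreover have "?h 0 = 1" "?d 0 = 0" by (simp_all add: fps_value_def Y(1) y0_def)
  ultimately show thesis
    using that R(1) analytic_real_fps_value[OF R(1) sm] by blast
qed

end


section \<open>Overshooting the rest point\<close>

text \<open>At a first zero a positive derivative would make \<open>f\<close> negative just before
  it. The hypothesis \<open>cross\<close> may use positivity at all earlier times, which is how it
  is verified below.\<close>

lemma positive_until_crossing:
  fixes f f' :: "real \<Rightarrow> real"
  assumes der: "\<And>t. a \<le> t \<Longrightarrow> t \<le> b \<Longrightarrow> (f has_real_derivative f' t) (at t)" and "f a > 0"
    and cross: "\<And>t. a \<le> t \<Longrightarrow> t \<le> b \<Longrightarrow> f t = 0 \<Longrightarrow> (\<And>s. a \<le> s \<Longrightarrow> s < t \<Longrightarrow> f s > 0) \<Longrightarrow> f' t > 0"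
    and t: "a \<le> t" "t \<le> b"
  shows "f t > 0"
proof (rule ccontr)
  assume "\<not> f t > 0"
  have cont: "continuous_on {a..b} f"
    using der by (meson DERIV_isCont atLeastAtMost_iff continuous_at_imp_continuous_on)
  define S where "S = {s \<in> {a..b}. f s \<le> 0}"
  have "compact S" unfolding S_def
    using continuous_closed_preimage[OF cont closed_real_atLeastAtMost, of "{..0}"]
    by (simp add: compact_eq_bounded_closed vimage_def Int_def bounded_subset[of "{a..b}"] subset_iff)
  moreover have "t \<in> S" using t \<open>\<not> f t > 0\<close> by (simp add: S_def)
  ultimately obtain c where c: "c \<in> S" "\<And>s. s \<in> S \<Longrightarrow> c \<le> s"
    using compact_attains_inf[of S] by blast
  have cab: "a \<le> c" "c \<le> b" "f c \<le> 0" using c(1) by (auto simp: S_def)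
  have before: "f s > 0" if "a \<le> s" "s < c" for s
    using c(2)[of s] that cab by (force simp: S_def)
  have "f c = 0"
  proof (rule ccontr)
    assume "f c \<noteq> 0"
    have "isCont f x" if "a \<le> x" "x \<le> c" for x
      using DERIV_isCont[OF der[of x]] that cab by simp
    then have "\<exists>x\<ge>a. x \<le> c \<and> f x = 0"
      using \<open>f a > 0\<close> cab by (intro IVT2) auto
    then show False using before \<open>f c \<noteq> 0\<close> by (metis less_eq_real_def less_irrefl)
  qed
  from cross[OF cab(1,2) this before] have "f' c > 0" .
  from DERIV_pos_inc_left[OF der[OF cab(1,2)] this] obtain e where
    e: "e > 0" "\<And>h. h > 0 \<Longrightarrow> h < e \<Longrightarrow> f (c - h) < f c" by blast
  have "a < c" using \<open>f a > 0\<close> \<open>f c = 0\<close> cab by (metis less_eq_real_def less_irrefl)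
  define h where "h = min (e/2) (c - a)"
  have "h > 0" "h < e" "a \<le> c - h" using e(1) \<open>a < c\<close> by (auto simp: h_def)
  then show False using e(2)[of h] before[of "c - h"] \<open>f c = 0\<close> by simp
qed

section \<open>Derivatives of convergent functions at infinity\<close>

lemma filterlim_shift_at_top: "filterlim (\<lambda>t. t + c :: real) at_top at_top"
  using filterlim_tendsto_add_at_top[OF tendsto_const[of c] filterlim_ident] by (simp add: add.commute)

text \<open>The mean value of \<open>g\<close> over a short window is small because \<open>f\<close>
  converges, and the bound on \<open>h\<close> keeps \<open>g\<close> close to that value inside the
  window.\<close>

lemma derivative_tendsto_zero:
  fixes f g h :: "real \<Rightarrow> real"
  assumes f: "\<And>t. t \<ge> a \<Longrightarrow> (f has_real_derivative g t) (at t)"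
    and g: "\<And>t. t \<ge> a \<Longrightarrow> (g has_real_derivative h t) (at t)"
    and K: "\<And>t. t \<ge> a \<Longrightarrow> \<bar>h t\<bar> \<le> K" and lim: "(f \<longlongrightarrow> l) at_top"
  shows "(g \<longlongrightarrow> 0) at_top"
proof (rule tendstoI)
  fix e :: real assume e: "e > 0"
  define K' where "K' = \<bar>K\<bar> + 1"
  \<comment> \<open>Over a window of this length \<open>g\<close> varies by at most
    \<open>e / 2\<close>.\<close>
  define \<tau> where "\<tau> = e / (2 * K')"
  have K': "K' > 0" and \<tau>: "\<tau> > 0" using e by (auto simp: K'_def \<tau>_def)
  have "((\<lambda>t. f (t + \<tau>)) \<longlongrightarrow> l) at_top"
    by (rule filterlim_compose[OF lim filterlim_shift_at_top])
  then have "((\<lambda>t. (f (t + \<tau>) - f t) / \<tau>) \<longlongrightarrow> (l - l) / \<tau>) at_top"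
    by (intro tendsto_intros lim) (use \<tau> in auto)
  then have "((\<lambda>t. (f (t + \<tau>) - f t) / \<tau>) \<longlongrightarrow> 0) at_top" by simp
  then have "eventually (\<lambda>t. dist ((f (t + \<tau>) - f t) / \<tau>) 0 < e / 2) at_top"
    by (rule tendstoD) (use e in auto)
  then show "eventually (\<lambda>t. dist (g t) 0 < e) at_top"
    using eventually_ge_at_top[of a]
  proof eventually_elim
    case (elim t)
    obtain \<xi> where \<xi>: "t < \<xi>" "\<xi> < t + \<tau>" "f (t + \<tau>) - f t = (t + \<tau> - t) * g \<xi>"
      using MVT2[of t "t + \<tau>" f g] \<tau> f elim by force
    obtain \<eta> where \<eta>: "t < \<eta>" "\<eta> < \<xi>" "g \<xi> - g t = (\<xi> - t) * h \<eta>"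
      using MVT2[of t \<xi> g h] \<xi> g elim by force
    have "\<bar>g \<xi> - g t\<bar> = (\<xi> - t) * \<bar>h \<eta>\<bar>" using \<eta> \<xi> by (simp add: abs_mult)
    also have "\<dots> \<le> \<tau> * K'" using K[of \<eta>] \<eta> \<xi> elim K' by (intro mult_mono) (auto simp: K'_def)
    also have "\<dots> = e / 2" using K' by (simp add: \<tau>_def)
    finally have "\<bar>g \<xi> - g t\<bar> \<le> e / 2" .
    moreover have "\<bar>g \<xi>\<bar> < e / 2" using elim(1) \<xi>(3) \<tau> by (simp add: dist_real_def)
    ultimately have "\<bar>g t\<bar> < e" by linarith
    then show ?case by simp
  qed
qed

lemma derivative_limit_eq_zero:
  fixes f g :: "real \<Rightarrow> real"
  assumes f: "\<And>t. t \<ge> a \<Longrightarrow> (f has_real_derivative g t) (at t)"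
    and lim: "(f \<longlongrightarrow> l) at_top" and g: "(g \<longlongrightarrow> c) at_top"
  shows "c = 0"
proof (rule ccontr)
  assume "c \<noteq> 0"
  have "((\<lambda>t. f (t + 1)) \<longlongrightarrow> l) at_top"
    by (rule filterlim_compose[OF lim filterlim_shift_at_top])
  then have "((\<lambda>t. f (t + 1) - f t) \<longlongrightarrow> l - l) at_top" by (intro tendsto_intros lim)
  then have near: "eventually (\<lambda>t. dist (f (t + 1) - f t) 0 < \<bar>c\<bar> / 2) at_top"
    by (intro tendstoD) (use \<open>c \<noteq> 0\<close> in auto)
  have "eventually (\<lambda>t. dist (g t) c < \<bar>c\<bar> / 2) at_top"
    by (rule tendstoD[OF g]) (use \<open>c \<noteq> 0\<close> in auto)
  then obtain b where b: "\<And>t. t \<ge> b \<Longrightarrow> dist (g t) c < \<bar>c\<bar> / 2"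
    by (auto simp: eventually_at_top_linorder)
  from near eventually_ge_at_top[of "max a b"] have "eventually (\<lambda>t. False) (at_top :: real filter)"
  proof eventually_elim
    case (elim t)
    obtain \<xi> where \<xi>: "t < \<xi>" "\<xi> < t + 1" "f (t + 1) - f t = (t + 1 - t) * g \<xi>"
      using MVT2[of t "t + 1" f g] f elim by force
    have "dist (g \<xi>) c < \<bar>c\<bar> / 2" using b \<xi> elim by simp
    moreover have "\<bar>g \<xi>\<bar> < \<bar>c\<bar> / 2" using elim \<xi> by (simp add: dist_real_def)
    ultimately show False unfolding dist_real_def by linarith
  qed
  then show False by simp
qed

text \<open>The assumption is the negativity of the discriminant of the linearisation at
  \<open>rest\<close>, multiplied by \<open>p * L\<close>.\<close>

locale profile_spiral = profile_ODE +
  assumes spiral: "(n + 1)\<^sup>2 * (p * L) < 8 * n * (p * L - n)"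
begin

definition rest :: real where "rest = sqrt ((p * L - n) / ((n - p) * L))"

lemma pL_gt: "p * L > n"
proof -
  have "(n + 1)\<^sup>2 * (p * L) > 0" using p L_pos by (intro mult_pos_pos zero_less_power) auto
  then have "8 * n * (p * L - n) > 0" using spiral by linarith
  then show ?thesis using p by (simp add: zero_less_mult_iff)
qed

lemma rest_pos: "rest > 0" and rest_sq: "rest\<^sup>2 = (p * L - n) / ((n - p) * L)"
  using pL_gt p L_pos by (auto simp: rest_def)

text \<open>Separates damping from a restoring term. The latter is positive for
  \<open>0 < x < rest\<close> and divisible by \<open>rest - x\<close>; the first fact drives
  monotonicity, the second the Riccati substitution.\<close>

lemma field_eq: "field x y = - y * (1 + (n - p + p * q x) * (1 + (x + y)\<^sup>2)) +
    (n - p) * L * q x * (rest\<^sup>2 - x\<^sup>2) * x * (1 + (x + y)\<^sup>2)"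
proof -
  have q1: "q x * (1 + L * x\<^sup>2) = 1" using denom_pos[of x] by (simp add: q_def)
  have r: "(n - p) * L * rest\<^sup>2 = p * L - n"
    unfolding rest_sq using p L_pos by simp
  have "(n - p) * L * q x * (x\<^sup>2 - rest\<^sup>2) = q x * ((n - p) * L * x\<^sup>2 - (n - p) * L * rest\<^sup>2)"
    by (simp add: algebra_simps)
  also have "\<dots> = (n - p) * (q x * (1 + L * x\<^sup>2)) - q x * (n - p) - q x * (p * L - n)"
    unfolding r by (simp add: algebra_simps)
  also have "\<dots> = n - p + (1 - L) * p * q x" unfolding q1 by (simp add: algebra_simps)
  finally have B: "n - p + (1 - L) * p * q x = (n - p) * L * q x * (x\<^sup>2 - rest\<^sup>2)" ..
  show ?thesis unfolding field_def B by (simp add: algebra_simps)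
qed

lemma solution_rest: "solution S (\<lambda>_. rest) (\<lambda>_. 0)"
  by (simp add: solution_def field_eq)

end

text \<open>\<open>\<phi>o\<close> and \<open>\<psi>o\<close> are the germ at time minus infinity
  that the power series will supply; an \<open>orbit\<close> is a continuation of it.\<close>

locale profile_orbit = profile_spiral +
  fixes T0 :: real and \<phi>o \<psi>o :: "real \<Rightarrow> real"
  assumes solution_o: "solution {..<T0} \<phi>o \<psi>o"
    and pos_o: "\<And>t. t < T0 \<Longrightarrow> 0 < \<phi>o t \<and> \<phi>o t < rest \<and> 0 < \<psi>o t"
begin

definition orbit :: "real \<Rightarrow> (real \<Rightarrow> real) \<Rightarrow> (real \<Rightarrow> real) \<Rightarrow> bool" where
  "orbit T \<phi> \<psi> \<longleftrightarrow> T0 \<le> T \<and> solution {..<T} \<phi> \<psi> \<and> (\<forall>t<T0. \<phi> t = \<phi>o t \<and> \<psi> t = \<psi>o t)"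

lemma orbit_derivative:
  assumes "orbit T \<phi> \<psi>" "t < T"
  shows "(\<phi> has_real_derivative \<psi> t) (at t)" "(\<psi> has_real_derivative field (\<phi> t) (\<psi> t)) (at t)"
  using assms solutionD[of "{..<T}" \<phi> \<psi> t] by (auto simp: orbit_def)

lemma orbit_solution: "orbit T \<phi> \<psi> \<Longrightarrow> b < T \<Longrightarrow> solution {a..b} \<phi> \<psi>"
  unfolding orbit_def by (auto intro: solution_subset)

lemma orbit_unique:
  assumes "orbit T1 \<phi>1 \<psi>1" "orbit T2 \<phi>2 \<psi>2" "t < T1" "t < T2"
  shows "\<phi>1 t = \<phi>2 t" "\<psi>1 t = \<psi>2 t"
proof -
  have T: "T0 \<le> T1" "T0 \<le> T2" using assms by (auto simp: orbit_def)
  define a b where "a = min t (T0 - 1)" and "b = max t (T0 - 1)"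
  have b: "b < T1" "b < T2" using assms T by (auto simp: b_def)
  have "\<phi>1 (T0 - 1) = \<phi>2 (T0 - 1)" "\<psi>1 (T0 - 1) = \<psi>2 (T0 - 1)" using assms by (auto simp: orbit_def)
  then show "\<phi>1 t = \<phi>2 t" "\<psi>1 t = \<psi>2 t"
    using solution_unique[OF orbit_solution[OF assms(1) b(1), of a] orbit_solution[OF assms(2) b(2), of a], of "T0 - 1" t]
    by (auto simp: a_def b_def)
qed

text \<open>Where \<open>\<psi>\<close> vanishes with \<open>0 < \<phi> < rest\<close> the field is
  positive, so \<open>\<psi>\<close> cannot reach 0 from above. Monotonicity then turns the weak
  bound by \<open>rest\<close> into a strict one.\<close>

lemma orbit_increasing_pos:
  assumes o: "orbit T \<phi> \<psi>" and le: "\<And>t. t < T \<Longrightarrow> \<phi> t \<le> rest" and t: "t < T"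
  shows "0 < \<phi> t \<and> \<phi> t < rest \<and> 0 < \<psi> t"
proof (cases "t < T0")
  case True
  then show ?thesis using o pos_o[of t] by (simp add: orbit_def)
next
  case False
  define a where "a = T0 - 1"
  have a: "a < T0" "\<phi> a = \<phi>o a" "\<psi> a = \<psi>o a" "0 < \<phi> a" "\<phi> a < rest" "0 < \<psi> a"
    using o pos_o[of a] by (auto simp: orbit_def a_def)
  note d = orbit_derivative[OF o]
  have psi: "\<psi> s > 0" if s: "a \<le> s" "s < T" for s
  proof (rule positive_until_crossing[where f=\<psi> and a=a and b=s and f'="\<lambda>t. field (\<phi> t) (\<psi> t)"])
    fix r assume r: "a \<le> r" "r \<le> s" and r0: "\<psi> r = 0" and before: "\<And>s. a \<le> s \<Longrightarrow> s < r \<Longrightarrow> 0 < \<psi> s"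
    have "\<phi> a \<le> \<phi> r"
    proof (rule DERIV_nonneg_imp_nondecreasing[OF r(1)])
      fix x assume "a \<le> x" "x \<le> r"
      then show "\<exists>y. (\<phi> has_real_derivative y) (at x) \<and> 0 \<le> y"
        using d(1)[of x] before[of x] r0 s r by (intro exI[of _ "\<psi> x"]) (cases "x = r", auto)
    qed
    then have pos: "\<phi> r > 0" using a by linarith
    \<comment> \<open>Arriving at \<open>rest\<close> with zero velocity would, by uniqueness, make
      the orbit constant.\<close>
    have "\<phi> r \<noteq> rest"
    proof
      assume "\<phi> r = rest"
      then have "\<phi> a = rest"
        using solution_unique(1)[OF orbit_solution[OF o, of r a] solution_rest, of r a] r0 r s by simp
      then show False using a by simp
    qed
    then have "\<phi> r < rest" using le[of r] s r by simp
    then have "(\<phi> r)\<^sup>2 < rest\<^sup>2" using pos by (intro power_strict_mono) auto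
    then show "0 < field (\<phi> r) (\<psi> r)"
      unfolding field_eq r0 using pos p L_pos q_pos[of "\<phi> r"]
      by (auto intro!: mult_pos_pos add_pos_nonneg)
  qed (use s a d in auto)
  have inc: "\<phi> s < \<phi> r" if "a \<le> s" "s < r" "r < T" for s r
  proof (rule DERIV_pos_imp_increasing[OF that(2)])
    fix x assume "s \<le> x" "x \<le> r"
    then have "a \<le> x" "x < T" using that by auto
    then show "\<exists>y. (\<phi> has_real_derivative y) (at x) \<and> 0 < y" using d(1) psi by blast
  qed
  have "\<phi> a < \<phi> t" using inc[of a t] False t a by simp
  \<comment> \<open>Any later time will do; the midpoint still lies in the domain.\<close>
  moreover have "\<phi> t < \<phi> ((t + T) / 2)" using inc[of t "(t + T) / 2"] False t a by simp
  moreover have "\<phi> ((t + T) / 2) \<le> rest" using le t by simp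
  moreover have "0 < \<psi> t" using psi[of t] False t a by simp
  ultimately show ?thesis using a by linarith
qed

text \<open>Above the first entry of the maximum the damping \<open>(n - p) * \<psi>\<close>
  outweighs \<open>L * p * q \<phi> * \<phi>\<close>, the only term that can push
  \<open>\<psi>\<close> up, as long as \<open>0 < \<phi> < rest\<close>. The second entry covers the
  starting time, and the summand 1 makes both comparisons strict.\<close>

definition psi_bound :: real where
  "psi_bound = max (L * p * rest / (n - p)) (\<psi>o (T0 - 1)) + 1"

lemma psi_bound_pos: "psi_bound > 0"
  using pos_o[of "T0 - 1"] max.cobounded2[of "\<psi>o (T0 - 1)" "L * p * rest / (n - p)"]
  unfolding psi_bound_def by linarith

lemma orbit_bounded:
  assumes o: "orbit T \<phi> \<psi>" and le: "\<And>t. t < T \<Longrightarrow> \<phi> t \<le> rest" and t: "T0 - 1 \<le> t" "t < T"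
  shows "\<psi> t < psi_bound"
proof -
  have "psi_bound - \<psi> t > 0"
  proof (rule positive_until_crossing[where a="T0 - 1" and b=t and f="\<lambda>t. psi_bound - \<psi> t"
        and f'="\<lambda>t. - field (\<phi> t) (\<psi> t)"])
    show "((\<lambda>t. psi_bound - \<psi> t) has_real_derivative - field (\<phi> s) (\<psi> s)) (at s)" if "s \<le> t" for s
      using orbit_derivative(2)[OF o, of s] that t by (auto intro!: derivative_eq_intros)
    show "psi_bound - \<psi> (T0 - 1) > 0" using o by (simp add: orbit_def psi_bound_def)
  next
    fix s assume s: "T0 - 1 \<le> s" "s \<le> t" "psi_bound - \<psi> s = 0"
    have x: "0 < \<phi> s" "\<phi> s < rest" using orbit_increasing_pos[OF o le, of s] s t by auto
    have y: "\<psi> s = psi_bound" "\<psi> s > 0" using s psi_bound_pos by auto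
    have "L * p * rest / (n - p) < \<psi> s" using y(1) by (simp add: psi_bound_def)
    then have "L * p * rest < (n - p) * \<psi> s" using p by (simp add: divide_less_eq mult.commute)
    moreover have "L * p * (q (\<phi> s) * \<phi> s) \<le> L * p * (1 * rest)"
      using x q_le_1[of "\<phi> s"] q_pos[of "\<phi> s"] L_pos p by (intro mult_left_mono mult_mono) auto
    moreover have "0 \<le> p * q (\<phi> s) * \<psi> s + (n - p) * \<phi> s + p * q (\<phi> s) * \<phi> s"
      using x y p q_pos[of "\<phi> s"] by (auto intro!: add_nonneg_nonneg mult_nonneg_nonneg)
    ultimately have "(n - p + p * q (\<phi> s)) * \<psi> s + (n - p + (1 - L) * p * q (\<phi> s)) * \<phi> s > 0"
      by (simp add: algebra_simps)
    then have "((n - p + p * q (\<phi> s)) * \<psi> s + (n - p + (1 - L) * p * q (\<phi> s)) * \<phi> s) * (1 + (\<phi> s + \<psi> s)\<^sup>2) > 0"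
      by (rule mult_pos_pos) (simp add: add_pos_nonneg)
    then show "0 < - field (\<phi> s) (\<psi> s)" using y by (simp add: field_def)
  qed (use t in auto)
  then show ?thesis by simp
qed

text \<open>The a priori bounds on \<open>\<phi>\<close> and \<open>\<psi>\<close> meet the uniform
  step of \<open>local_solution\<close>, so one \<open>\<delta>\<close> serves every
  \<open>T\<close>. The restart is made before \<open>T\<close>, because nothing is known at
  \<open>T\<close> itself.\<close>

lemma orbit_extend:
  shows "\<exists>\<delta>>0. \<forall>T \<phi> \<psi>. orbit T \<phi> \<psi> \<longrightarrow> (\<forall>t<T. \<phi> t \<le> rest) \<longrightarrow> (\<exists>\<phi>' \<psi>'. orbit (T + \<delta>) \<phi>' \<psi>')"
proof -
  define A where "A = max rest psi_bound"
  have "A \<ge> 0" using rest_pos by (simp add: A_def)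
  from local_solution[OF this] obtain \<delta> where \<delta>: "\<delta> > 0" "\<And>t0 x y. \<bar>x\<bar> \<le> A \<Longrightarrow> \<bar>y\<bar> \<le> A \<Longrightarrow>
     \<exists>\<phi> \<psi>. \<phi> t0 = x \<and> \<psi> t0 = y \<and> solution {t0 - \<delta><..<t0 + \<delta>} \<phi> \<psi>" by blast
  \<comment> \<open>From \<open>T - e\<close> the local solution reaches
    \<open>T - e + \<delta>\<close>, at least \<open>T + e\<close>; and \<open>e < 1\<close> keeps
    the restart above \<open>T0 - 1\<close>, where the bound on \<open>\<psi>\<close> holds.\<close>
  define e where "e = min \<delta> 1 / 2"
  have e: "e > 0" "2 * e \<le> \<delta>" "e < 1" using \<delta>(1) by (auto simp: e_def)
  have "\<exists>\<phi>' \<psi>'. orbit (T + e) \<phi>' \<psi>'" if o: "orbit T \<phi> \<psi>" and le: "\<forall>t<T. \<phi> t \<le> rest" for T \<phi> \<psi>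
  proof -
    have T: "T0 \<le> T" using o by (simp add: orbit_def)
    define t0 where "t0 = T - e"
    have t0: "t0 < T" "T0 - 1 \<le> t0" using e T by (auto simp: t0_def)
    have "0 < \<phi> t0 \<and> \<phi> t0 < rest \<and> 0 < \<psi> t0" "\<psi> t0 < psi_bound"
      using orbit_increasing_pos[OF o _ t0(1)] orbit_bounded[OF o _ t0(2,1)] le by auto
    then have "\<bar>\<phi> t0\<bar> \<le> A" "\<bar>\<psi> t0\<bar> \<le> A" by (auto simp: A_def)
    from \<delta>(2)[OF this] obtain \<phi>1 \<psi>1 where n: "\<phi>1 t0 = \<phi> t0" "\<psi>1 t0 = \<psi> t0"
      "solution {t0 - \<delta><..<t0 + \<delta>} \<phi>1 \<psi>1" by blast
    have agree: "\<phi> s = \<phi>1 s \<and> \<psi> s = \<psi>1 s" if s: "t0 - \<delta> < s" "s < T" for s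
    proof -
      have s1: "solution {min s t0..max s t0} \<phi> \<psi>"
        by (rule orbit_solution[OF o]) (use s t0 in auto)
      have s2: "solution {min s t0..max s t0} \<phi>1 \<psi>1"
        by (rule solution_subset[OF n(3)]) (use s t0 e \<delta>(1) in \<open>auto simp: t0_def\<close>)
      show ?thesis using solution_unique[OF s1 s2, of t0 s] n by auto
    qed
    define \<phi>' \<psi>' where "\<phi>' t = (if t < T then \<phi> t else \<phi>1 t)" and "\<psi>' t = (if t < T then \<psi> t else \<psi>1 t)" for t
    have eq1: "\<phi>1 s = \<phi>' s" "\<psi>1 s = \<psi>' s" if "s \<in> {t0 - \<delta><..<t0 + \<delta>}" for s
      using agree[of s] that by (auto simp: \<phi>'_def \<psi>'_def)
    have "solution {..<T + e} \<phi>' \<psi>'"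
      unfolding solution_def
    proof
      fix t assume t: "t \<in> {..<T + e}"
      show "(\<phi>' has_real_derivative \<psi>' t) (at t) \<and> (\<psi>' has_real_derivative field (\<phi>' t) (\<psi>' t)) (at t)"
      proof (cases "t < T")
        case True
        then have m: "t \<in> {..<T}" by simp
        have "(\<phi>' has_real_derivative \<psi> t) (at t)"
          by (rule has_field_derivative_transform_within_open[OF orbit_derivative(1)[OF o True] open_lessThan m])
            (simp add: \<phi>'_def)
        moreover have "(\<psi>' has_real_derivative field (\<phi> t) (\<psi> t)) (at t)"
          by (rule has_field_derivative_transform_within_open[OF orbit_derivative(2)[OF o True] open_lessThan m])
            (simp add: \<psi>'_def)
        ultimately show ?thesis using True by (simp add: \<phi>'_def \<psi>'_def)
      next
        case False
        then have m: "t \<in> {t0 - \<delta><..<t0 + \<delta>}" using t e \<delta>(1) by (auto simp: t0_def)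
        have "(\<phi>' has_real_derivative \<psi>1 t) (at t)"
          by (rule has_field_derivative_transform_within_open[OF solutionD(1)[OF n(3) m] open_greaterThanLessThan m eq1(1)])
        moreover have "(\<psi>' has_real_derivative field (\<phi>1 t) (\<psi>1 t)) (at t)"
          by (rule has_field_derivative_transform_within_open[OF solutionD(2)[OF n(3) m] open_greaterThanLessThan m eq1(2)])
        ultimately show ?thesis using eq1[OF m] by simp
      qed
    qed
    then have "orbit (T + e) \<phi>' \<psi>'"
      using o T e(1) by (auto simp: orbit_def \<phi>'_def \<psi>'_def)
    then show ?thesis by blast
  qed
  then show ?thesis using e(1) by blast
qed

text \<open>Steps of constant length exhaust the line. By uniqueness the value at \<open>t\<close>
  may be taken from any piece that reaches beyond \<open>t\<close>.\<close>

lemma global_orbit: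
  assumes le: "\<And>T \<phi> \<psi> t. orbit T \<phi> \<psi> \<Longrightarrow> t < T \<Longrightarrow> \<phi> t \<le> rest"
  shows "\<exists>\<phi> \<psi>. \<forall>T\<ge>T0. orbit T \<phi> \<psi>"
proof -
  obtain \<delta> where \<delta>1: "\<delta> > 0"
    and ext: "\<forall>T \<phi> \<psi>. orbit T \<phi> \<psi> \<longrightarrow> (\<forall>t<T. \<phi> t \<le> rest) \<longrightarrow> (\<exists>\<phi>' \<psi>'. orbit (T + \<delta>) \<phi>' \<psi>')"
    using orbit_extend by blast
  have \<delta>2: "\<exists>\<phi>' \<psi>'. orbit (T + \<delta>) \<phi>' \<psi>'" if o: "orbit T \<phi> \<psi>" for T \<phi> \<psi>
    by (rule ext[rule_format, OF o le[OF o]])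
  note \<delta> = \<delta>1 \<delta>2
  have steps: "\<exists>\<phi> \<psi>. orbit (T0 + real N * \<delta>) \<phi> \<psi>" for N
  proof (induction N)
    case 0
    have "orbit T0 \<phi>o \<psi>o" using solution_o by (simp add: orbit_def)
    then show ?case by auto
  next
    case (Suc N)
    then show ?case using \<delta>(2)[of "T0 + real N * \<delta>"] by (auto simp: algebra_simps)
  qed
  then obtain f g where fg: "\<And>N. orbit (T0 + real N * \<delta>) (f N) (g N)" by metis
  have "\<exists>N. t < T0 + real N * \<delta>" for t
  proof -
    obtain N where "(t - T0) / \<delta> < real N" using reals_Archimedean2 by blast
    then show ?thesis using \<delta>(1) by (intro exI[of _ N]) (simp add: divide_less_eq)
  qed
  then obtain N where N: "\<And>t. t < T0 + real (N t) * \<delta>" by metis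
  define \<phi> \<psi> where "\<phi> t = f (N t) t" and "\<psi> t = g (N t) t" for t
  have eq: "f M t = \<phi> t" "g M t = \<psi> t" if "t < T0 + real M * \<delta>" for M t
    unfolding \<phi>_def \<psi>_def by (rule orbit_unique[OF fg fg that N])+
  have sol: "solution UNIV \<phi> \<psi>"
    unfolding solution_def
  proof
    fix t
    let ?S = "{..<T0 + real (N t) * \<delta>}"
    have m: "t \<in> ?S" using N by simp
    have "(\<phi> has_real_derivative g (N t) t) (at t)"
      by (rule has_field_derivative_transform_within_open[OF orbit_derivative(1)[OF fg N] open_lessThan m]) (use eq in auto)
    moreover have "(\<psi> has_real_derivative field (f (N t) t) (g (N t) t)) (at t)"
      by (rule has_field_derivative_transform_within_open[OF orbit_derivative(2)[OF fg N] open_lessThan m]) (use eq in auto)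
    ultimately show "(\<phi> has_real_derivative \<psi> t) (at t) \<and> (\<psi> has_real_derivative field (\<phi> t) (\<psi> t)) (at t)"
      by (simp add: \<phi>_def \<psi>_def)
  qed
  have "\<phi> t = \<phi>o t \<and> \<psi> t = \<psi>o t" if "t < T0" for t
    using fg[of "N t"] that by (simp add: orbit_def \<phi>_def \<psi>_def)
  then have "orbit T \<phi> \<psi>" if "T \<ge> T0" for T
    using that solution_subset[OF sol subset_UNIV] by (auto simp: orbit_def)
  then show ?thesis by blast
qed

end


text \<open>\<open>arctan (w t) - c * t\<close> is nondecreasing, so within time
  \<open>pi / c\<close> the arctangent would have to gain \<open>pi\<close>, the full length of its
  open range.\<close>

lemma arctan_blow_up:
  fixes w w' :: "real \<Rightarrow> real"
  assumes c: "c > 0" and w: "\<And>t. t \<ge> a \<Longrightarrow> (w has_real_derivative w' t) (at t)"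
    and le: "\<And>t. t \<ge> a \<Longrightarrow> c * (1 + (w t)\<^sup>2) \<le> w' t"
  shows False
proof -
  define b where "b = a + pi / c"
  have ab: "a \<le> b" using c by (simp add: b_def)
  have "arctan (w a) - c * a \<le> arctan (w b) - c * b"
  proof (rule DERIV_nonneg_imp_nondecreasing[where f="\<lambda>t. arctan (w t) - c * t", OF ab])
    fix t assume t: "a \<le> t" "t \<le> b"
    have pos: "1 + (w t)\<^sup>2 > 0" by (simp add: add_pos_nonneg)
    have "((\<lambda>t. arctan (w t) - c * t) has_real_derivative w' t / (1 + (w t)\<^sup>2) - c) (at t)"
      using w[OF t(1)] pos by (auto intro!: derivative_eq_intros simp: divide_inverse mult.commute)
    moreover have "0 \<le> w' t / (1 + (w t)\<^sup>2) - c"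
      using le[OF t(1)] pos by (simp add: le_divide_eq)
    ultimately show "\<exists>y. ((\<lambda>t. arctan (w t) - c * t) has_real_derivative y) (at t) \<and> 0 \<le> y" by blast
  qed
  moreover have "c * b - c * a = pi" using c by (simp add: b_def algebra_simps)
  moreover have "arctan (w b) < pi / 2" "- (pi / 2) < arctan (w a)"
    by (rule arctan_ubound arctan_lbound)+
  ultimately show False by linarith
qed

section \<open>An orbit below the rest point leads to a contradiction\<close>

context profile_orbit
begin

lemma field_tendsto:
  assumes "(f \<longlongrightarrow> x) F" "(g \<longlongrightarrow> y) F"
  shows "((\<lambda>t. field (f t) (g t)) \<longlongrightarrow> field x y) F"
  unfolding field_def q_def by (intro tendsto_intros assms less_imp_neq[OF denom_pos, symmetric])

lemma q_tendsto:
  assumes "(f \<longlongrightarrow> x) F"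
  shows "((\<lambda>t. q (f t)) \<longlongrightarrow> q x) F"
  unfolding q_def by (intro tendsto_intros assms less_imp_neq[OF denom_pos, symmetric])

lemma field_bounded:
  "\<exists>K. \<forall>x y. 0 \<le> x \<longrightarrow> x \<le> M \<longrightarrow> 0 \<le> y \<longrightarrow> y \<le> N \<longrightarrow> \<bar>field x y\<bar> \<le> K"
proof -
  have nz: "1 + L * (fst z)\<^sup>2 \<noteq> 0" for z :: "real \<times> real"
    using denom_pos[of "fst z"] by simp
  have "continuous_on ({0..M} \<times> {0..N}) (\<lambda>z. field (fst z) (snd z))"
    unfolding field_def q_def by (intro continuous_intros ballI nz)
  then have "bounded ((\<lambda>z. field (fst z) (snd z)) ` ({0..M} \<times> {0..N}))"
    by (intro compact_imp_bounded compact_continuous_image compact_Times) auto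
  then obtain K where "\<And>z. z \<in> {0..M} \<times> {0..N} \<Longrightarrow> \<bar>field (fst z) (snd z)\<bar> \<le> K"
    unfolding bounded_iff real_norm_def by blast
  from this[of "(x, y)" for x y] show ?thesis by (intro exI[of _ K]) auto
qed

text \<open>An orbit that never passes the rest point converges to it. There the linearisation has
  non-real eigenvalues, so the Riccati equation for \<open>w = \<psi> / (rest - \<phi>)\<close> makes \<open>w\<close> blow up.\<close>

theorem overshoot: "\<exists>T \<phi> \<psi> t. orbit T \<phi> \<psi> \<and> t < T \<and> rest < \<phi> t"
proof (rule ccontr)
  assume "\<not> ?thesis"
  then have le: "\<phi> t \<le> rest" if "orbit T \<phi> \<psi>" "t < T" for T \<phi> \<psi> t
    using that by (meson not_le)
  then obtain \<phi> \<psi> where o: "\<And>T. T \<ge> T0 \<Longrightarrow> orbit T \<phi> \<psi>" using global_orbit by blast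
  have orb: "orbit (max T0 (t + 1)) \<phi> \<psi>" "t < max T0 (t + 1)" for t by (auto intro: o)
  have le': "\<phi> s \<le> rest" for s by (rule le[OF orb])
  have d: "(\<phi> has_real_derivative \<psi> t) (at t)" "(\<psi> has_real_derivative field (\<phi> t) (\<psi> t)) (at t)" for t
    by (rule orbit_derivative[OF orb])+
  have pos: "0 < \<phi> t" "\<phi> t < rest" "0 < \<psi> t" for t
    using orbit_increasing_pos[OF orb(1) le' orb(2), of t] by simp_all
  have bd: "\<psi> t < psi_bound" if "T0 - 1 \<le> t" for t
    by (rule orbit_bounded[OF orb(1) le' that orb(2)])
  have mono: "\<phi> s \<le> \<phi> t" if "s \<le> t" for s t
    by (rule DERIV_nonneg_imp_nondecreasing[OF that]) (use d(1) pos(3) less_imp_le in blast)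
  define l where "l = (SUP t. \<phi> t)"
  have bdd: "bdd_above (range \<phi>)" using pos(2) by (meson bdd_aboveI2 less_imp_le)
  have lim: "(\<phi> \<longlongrightarrow> l) at_top"
  proof (rule increasing_tendsto)
    show "eventually (\<lambda>t. \<phi> t \<le> l) at_top" unfolding l_def by (rule always_eventually) (intro allI cSUP_upper UNIV_I bdd)
    fix x assume "x < l"
    then obtain s where "x < \<phi> s" unfolding l_def using less_cSUP_iff[OF _ bdd] by auto
    then show "eventually (\<lambda>t. x < \<phi> t) at_top"
      using mono by (auto simp: eventually_at_top_linorder intro!: exI[of _ s] intro: less_le_trans)
  qed
  have l: "0 < l" "l \<le> rest"
    unfolding l_def using less_le_trans[OF pos(1) cSUP_upper[OF UNIV_I bdd]]
    by (blast, intro cSUP_least less_imp_le pos) simp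
  obtain K where K: "\<forall>x y. 0 \<le> x \<longrightarrow> x \<le> rest \<longrightarrow> 0 \<le> y \<longrightarrow> y \<le> psi_bound \<longrightarrow> \<bar>field x y\<bar> \<le> K"
    using field_bounded by blast
  have Kt: "\<bar>field (\<phi> t) (\<psi> t)\<bar> \<le> K" if "t \<ge> T0 - 1" for t
    by (rule K[rule_format]) (intro less_imp_le pos bd that)+
  have psi0: "(\<psi> \<longlongrightarrow> 0) at_top"
    by (rule derivative_tendsto_zero[where a="T0 - 1" and f=\<phi> and h="\<lambda>t. field (\<phi> t) (\<psi> t)",
          OF d(1) d(2) Kt lim])
  \<comment> \<open>The limit of a convergent orbit is a zero of the field with zero velocity, and
    \<open>rest\<close> is the only positive one.\<close>
  have "field l 0 = 0"
    by (rule derivative_limit_eq_zero[where a=0, OF d(2) psi0 field_tendsto[OF lim psi0]])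
  then have "rest\<^sup>2 - l\<^sup>2 = 0"
    using l p L_pos q_pos[of l] by (simp add: field_eq add_nonneg_eq_0_iff)
  then have l_rest: "l = rest" using l rest_pos by (simp add: power2_eq_iff)
  \<comment> \<open>Along the orbit the field equals
    \<open>- \<alpha> * \<psi> + \<beta> * (rest - \<phi>)\<close>; the limits \<open>n + 1\<close>
    and \<open>\<beta>0\<close> are the coefficients of the linearisation.\<close>
  define \<alpha> where "\<alpha> t = 1 + (n - p + p * q (\<phi> t)) * (1 + (\<phi> t + \<psi> t)\<^sup>2)" for t
  define \<beta> where "\<beta> t = (n - p) * L * q (\<phi> t) * (rest + \<phi> t) * \<phi> t * (1 + (\<phi> t + \<psi> t)\<^sup>2)" for t
  define \<beta>0 where "\<beta>0 = 2 * n * (p * L - n) / (p * L)"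
  have L1: "L > 1" using pL_gt p by (metis less_trans mult_less_cancel_left_pos mult.right_neutral)
  have qr: "q rest = (n - p) / (p * (L - 1))"
  proof -
    have "1 + L * rest\<^sup>2 = p * (L - 1) / (n - p)"
      unfolding rest_sq using p L_pos by (simp add: field_simps)
    then show ?thesis by (simp add: q_def)
  qed
  have r1: "1 + rest\<^sup>2 = n * (L - 1) / ((n - p) * L)"
    unfolding rest_sq using p L_pos by (simp add: field_simps)
  have a0: "1 + (n - p + p * q rest) * (1 + (rest + 0)\<^sup>2) = n + 1"
  proof -
    have "n - p + p * q rest = (n - p) * L / (L - 1)"
      unfolding qr using p L1 by (simp add: field_simps)
    then show ?thesis using p L1 L_pos by (simp add: r1)
  qed
  have b0: "(n - p) * L * q rest * (rest + rest) * rest * (1 + (rest + 0)\<^sup>2) = \<beta>0"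
  proof -
    have "(n - p) * L * q rest * (rest + rest) * rest * (1 + (rest + 0)\<^sup>2) =
        2 * ((n - p) * L * rest\<^sup>2) * q rest * (1 + rest\<^sup>2)" by (simp add: power2_eq_square)
    also have "\<dots> = 2 * (p * L - n) * ((n - p) / (p * (L - 1))) * (n * (L - 1) / ((n - p) * L))"
      unfolding r1 qr unfolding rest_sq using p L_pos by simp
    also have "\<dots> = \<beta>0" unfolding \<beta>0_def using p L1 L_pos by simp
    finally show ?thesis .
  qed
  have lim': "(\<phi> \<longlongrightarrow> rest) at_top" using lim l_rest by simp
  have \<alpha>_lim: "(\<alpha> \<longlongrightarrow> n + 1) at_top"
    unfolding \<alpha>_def[abs_def] a0[symmetric] by (intro tendsto_intros q_tendsto lim' psi0)
  have \<beta>_lim: "(\<beta> \<longlongrightarrow> \<beta>0) at_top"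
    unfolding \<beta>_def[abs_def] b0[symmetric] by (intro tendsto_intros q_tendsto lim' psi0)
  have disc: "(n + 1)\<^sup>2 < 4 * \<beta>0"
  proof -
    have "(n + 1)\<^sup>2 < 8 * n * (p * L - n) / (p * L)"
      using spiral p L_pos by (simp add: less_divide_eq)
    then show ?thesis by (simp add: \<beta>0_def)
  qed
  \<comment> \<open>A margin \<open>c\<close> is taken off the leading and the constant coefficient
    of the Riccati polynomial; since the discriminant is strictly negative, a small positive margin
    is affordable.\<close>
  have "((\<lambda>c. 4 * (1 - c) * (\<beta>0 - c)) \<longlongrightarrow> 4 * (1 - 0) * (\<beta>0 - 0)) (at_right 0)"
    by (intro tendsto_intros)
  then have "eventually (\<lambda>c. (n + 1)\<^sup>2 < 4 * (1 - c) * (\<beta>0 - c)) (at_right 0)"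
    by (rule order_tendstoD) (use disc in simp)
  moreover have "eventually (\<lambda>c::real. c < 1) (at_right 0)"
    using eventually_at_right_real[of 0 1] by (rule eventually_mono) auto
  ultimately have "eventually (\<lambda>c. (n + 1)\<^sup>2 < 4 * (1 - c) * (\<beta>0 - c) \<and> c < 1 \<and> c > 0) (at_right 0)"
    using eventually_at_right_less[of 0] by eventually_elim auto
  then obtain c where c: "(n + 1)\<^sup>2 < 4 * (1 - c) * (\<beta>0 - c)" "c < 1" "c > 0"
    using eventually_happens'[OF trivial_limit_at_right_real] by blast
  have "((\<lambda>t. 4 * (1 - c) * (\<beta> t - c) - (\<alpha> t)\<^sup>2) \<longlongrightarrow> 4 * (1 - c) * (\<beta>0 - c) - (n + 1)\<^sup>2) at_top"
    by (intro tendsto_intros \<alpha>_lim \<beta>_lim)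
  then have "eventually (\<lambda>t. 0 < 4 * (1 - c) * (\<beta> t - c) - (\<alpha> t)\<^sup>2) at_top"
    by (rule order_tendstoD) (use c in simp)
  then obtain a where a: "\<And>t. t \<ge> a \<Longrightarrow> (\<alpha> t)\<^sup>2 < 4 * (1 - c) * (\<beta> t - c)"
    by (auto simp: eventually_at_top_linorder)
  \<comment> \<open>The slope of the orbit as seen from the rest point. It is finite for all times
    because \<open>\<phi>\<close> stays strictly below \<open>rest\<close>.\<close>
  define w where "w t = \<psi> t / (rest - \<phi> t)" for t
  have w': "(w has_real_derivative (w t)\<^sup>2 - \<alpha> t * w t + \<beta> t) (at t)" for t
  proof -
    have nz: "rest - \<phi> t \<noteq> 0" using pos(2)[of t] by simp
    have "(w has_real_derivative (field (\<phi> t) (\<psi> t) * (rest - \<phi> t) - \<psi> t * (- \<psi> t)) / ((rest - \<phi> t) * (rest - \<phi> t))) (at t)"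
      unfolding w_def[abs_def] using d[of t] nz by (auto intro!: derivative_eq_intros)
    moreover have "field (\<phi> t) (\<psi> t) = - \<alpha> t * \<psi> t + \<beta> t * (rest - \<phi> t)"
      unfolding field_eq \<alpha>_def \<beta>_def by (simp add: algebra_simps power2_eq_square)
    moreover have "((- A * y + B * z) * z - y * (- y)) / (z * z) = (y / z)\<^sup>2 - A * (y / z) + B" if "z \<noteq> 0" for A B y z :: real
      using that by (simp add: field_simps power2_eq_square)
    ultimately show ?thesis using nz by (simp add: w_def)
  qed
  have "c * (1 + (w t)\<^sup>2) \<le> (w t)\<^sup>2 - \<alpha> t * w t + \<beta> t" if t: "t \<ge> a" for t
  proof -
    \<comment> \<open>Completing the square: \<open>4 * (1 - c)\<close> times the difference of the
      two sides is a square plus minus the discriminant.\<close>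
    have "0 \<le> (2 * (1 - c) * w t - \<alpha> t)\<^sup>2 + (4 * (1 - c) * (\<beta> t - c) - (\<alpha> t)\<^sup>2)"
      using a[OF t] by simp
    also have "\<dots> = 4 * (1 - c) * ((w t)\<^sup>2 - \<alpha> t * w t + \<beta> t - c * (1 + (w t)\<^sup>2))"
      by (simp add: algebra_simps power2_eq_square)
    finally show ?thesis using c by (simp add: zero_le_mult_iff)
  qed
  then show False using arctan_blow_up[OF c(3) w'] by blast
qed

end

section \<open>From the overshooting orbit to the radial factor\<close>

theorem (in profile_spiral) profile_exists:
  obtains T \<phi> \<psi> R h T0 \<Phi> where "solution {..<T} \<phi> \<psi>" "R > 0" "analytic_real {x. \<bar>x\<bar> < R} h" "T0 \<le> T"
    "\<And>t. t < T0 \<Longrightarrow> exp (2 * \<kappa> * t) < R \<and> \<phi> t = exp (\<kappa> * t) * h (exp (2 * \<kappa> * t))"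
    "rest < \<Phi>" "\<And>x. rest < x \<Longrightarrow> x < \<Phi> \<Longrightarrow> \<exists>t<T. \<phi> t = x"
proof -
  obtain R h d where o: "R > 0" "analytic_real {x. \<bar>x\<bar> < R} h" "h 0 = (1::real)" "d 0 = (0::real)" "isCont d 0"
    "solution {t. exp (2 * \<kappa> * t) < R} (\<lambda>t. exp (\<kappa> * t) * h (exp (2 * \<kappa> * t)))
       (\<lambda>t. exp (\<kappa> * t) * (\<kappa> * h (exp (2 * \<kappa> * t)) + d (exp (2 * \<kappa> * t))))"
    using origin_orbit by blast
  define \<phi>o where "\<phi>o t = exp (\<kappa> * t) * h (exp (2 * \<kappa> * t))" for t
  define \<psi>o where "\<psi>o t = exp (\<kappa> * t) * (\<kappa> * h (exp (2 * \<kappa> * t)) + d (exp (2 * \<kappa> * t)))" for t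
  have e0: "((\<lambda>t. exp (c * t)) \<longlongrightarrow> 0) at_bot" if "c > 0" for c :: real
    by (rule filterlim_compose[OF exp_at_bot]) (rule filterlim_tendsto_pos_mult_at_bot[OF tendsto_const that filterlim_ident])
  have e2: "((\<lambda>t. exp (2 * \<kappa> * t)) \<longlongrightarrow> 0) at_bot" and e1: "((\<lambda>t. exp (\<kappa> * t)) \<longlongrightarrow> 0) at_bot"
    using e0[of "2 * \<kappa>"] e0[of \<kappa>] \<kappa> by auto
  have "isCont h 0" by (rule analytic_real_isCont[OF o(2)]) (use o(1) in simp)
  then have hl: "((\<lambda>t. h (exp (2 * \<kappa> * t))) \<longlongrightarrow> 1) at_bot"
    using isCont_tendsto_compose[OF _ e2] o(3) by metis
  have dl: "((\<lambda>t. d (exp (2 * \<kappa> * t))) \<longlongrightarrow> 0) at_bot"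
    using isCont_tendsto_compose[OF o(5) e2] o(4) by simp
  have "((\<lambda>t. \<kappa> * h (exp (2 * \<kappa> * t)) + d (exp (2 * \<kappa> * t))) \<longlongrightarrow> \<kappa> * 1 + 0) at_bot"
    by (intro tendsto_intros hl dl)
  then have g: "eventually (\<lambda>t. 0 < \<kappa> * h (exp (2 * \<kappa> * t)) + d (exp (2 * \<kappa> * t))) at_bot"
    by (rule order_tendstoD) (use \<kappa> in simp)
  have "(\<phi>o \<longlongrightarrow> 0 * 1) at_bot" unfolding \<phi>o_def[abs_def] by (intro tendsto_intros e1 hl)
  then have "eventually (\<lambda>t. \<phi>o t < rest) at_bot" by (intro order_tendstoD) (use rest_pos in auto)
  moreover have "eventually (\<lambda>t. 0 < h (exp (2 * \<kappa> * t))) at_bot" by (rule order_tendstoD[OF hl]) simp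
  moreover have "eventually (\<lambda>t. exp (2 * \<kappa> * t) < R) at_bot" by (rule order_tendstoD(2)[OF e2 o(1)])
  ultimately have "eventually (\<lambda>t. exp (2 * \<kappa> * t) < R \<and> 0 < \<phi>o t \<and> \<phi>o t < rest \<and> 0 < \<psi>o t) at_bot"
    using g by eventually_elim (simp add: \<phi>o_def \<psi>o_def)
  then obtain T0 where T0: "\<And>t. t \<le> T0 \<Longrightarrow> exp (2 * \<kappa> * t) < R \<and> 0 < \<phi>o t \<and> \<phi>o t < rest \<and> 0 < \<psi>o t"
    by (auto simp: eventually_at_bot_linorder)
  interpret profile_orbit n p L \<kappa> T0 \<phi>o \<psi>o
  proof
    show "solution {..<T0} \<phi>o \<psi>o"
      unfolding \<phi>o_def[abs_def] \<psi>o_def[abs_def] by (rule solution_subset[OF o(6)]) (use T0 in auto)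
  qed (use T0 less_imp_le in blast)
  obtain T \<phi> \<psi> t1 where orb: "orbit T \<phi> \<psi>" "t1 < T" "rest < \<phi> t1" using overshoot by blast
  have eq: "T0 \<le> T" "solution {..<T} \<phi> \<psi>" "\<And>t. t < T0 \<Longrightarrow> \<phi> t = \<phi>o t" using orb(1) by (auto simp: orbit_def)
  have surj: "\<exists>t<T. \<phi> t = x" if x: "rest < x" "x < \<phi> t1" for x
  proof -
    \<comment> \<open>A time not after \<open>t1\<close> at which the orbit is still in the germ,
      hence below \<open>rest\<close>, as left end for the intermediate value theorem.\<close>
    define s where "s = min (T0 - 1) t1"
    have s: "s \<le> t1" "s < T0" by (auto simp: s_def)
    have "\<phi> s < rest" using eq(3)[OF s(2)] T0[of s] s by simp
    have "\<exists>t. s \<le> t \<and> t \<le> t1 \<and> \<phi> t = x"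
    proof (rule IVT)
      show "\<forall>t. s \<le> t \<and> t \<le> t1 \<longrightarrow> isCont \<phi> t"
        using DERIV_isCont[OF orbit_derivative(1)[OF orb(1)]] orb(2) by simp
    qed (use x \<open>\<phi> s < rest\<close> s in auto)
    then show ?thesis using orb(2) le_less_trans by blast
  qed
  have exp_form: "exp (2 * \<kappa> * t) < R \<and> \<phi> t = exp (\<kappa> * t) * h (exp (2 * \<kappa> * t))" if "t < T0" for t
    using eq(3)[OF that] T0[of t] that by (simp add: \<phi>o_def)
  show thesis
    by (rule that[OF eq(2) o(1,2) eq(1) exp_form orb(3) surj])
qed


text \<open>With \<open>v = exp (2 * \<tau>)\<close>, the squared radius, the factor is
  \<open>v^(- \<kappa> / 2)\<close> times \<open>\<phi> (t1 + ln v / 2)\<close>, clearly analytic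
  for \<open>v > 0\<close>. Near 0 the factor \<open>exp (\<kappa> t)\<close> of the orbit cancels
  the negative power, and \<open>exp (2 \<kappa> t)\<close> becomes a constant times
  \<open>v ^ j\<close>, which is analytic at 0 as \<open>j\<close> is a natural number.\<close>

theorem (in profile_spiral) radial_profile:
  fixes j :: nat
  assumes j: "\<kappa> = real j"
  shows "\<exists>\<Phi>>rest. \<forall>x\<in>{rest<..<\<Phi>}. \<exists>K u \<phi> \<psi>. u > 1 \<and> analytic_real {0..<u} K \<and> \<phi> 0 = x \<and>
    (\<forall>\<tau>. exp (2 * \<tau>) < u \<longrightarrow> K (exp (2 * \<tau>)) = exp (- \<kappa> * \<tau>) * \<phi> \<tau> \<and>
       (\<phi> has_real_derivative \<psi> \<tau>) (at \<tau>) \<and> (\<psi> has_real_derivative field (\<phi> \<tau>) (\<psi> \<tau>)) (at \<tau>))"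
proof -
  obtain T \<phi> \<psi> R h T0 \<Phi> where o: "solution {..<T} \<phi> \<psi>" "R > 0" "analytic_real {x. \<bar>x\<bar> < R} h" "T0 \<le> T"
    "\<And>t. t < T0 \<Longrightarrow> exp (2 * \<kappa> * t) < R \<and> \<phi> t = exp (\<kappa> * t) * h (exp (2 * \<kappa> * t))"
    "rest < \<Phi>" "\<And>x. rest < x \<Longrightarrow> x < \<Phi> \<Longrightarrow> \<exists>t<T. \<phi> t = x"
    using profile_exists by blast
  have an: "analytic_real {..<T} \<phi>" by (rule solution_analytic[OF o(1) open_lessThan])
  have "\<exists>K u \<phi> \<psi>. u > 1 \<and> analytic_real {0..<u} K \<and> \<phi> 0 = x \<and>
    (\<forall>\<tau>. exp (2 * \<tau>) < u \<longrightarrow> K (exp (2 * \<tau>)) = exp (- \<kappa> * \<tau>) * \<phi> \<tau> \<and>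
       (\<phi> has_real_derivative \<psi> \<tau>) (at \<tau>) \<and> (\<psi> has_real_derivative field (\<phi> \<tau>) (\<psi> \<tau>)) (at \<tau>))"
    if x: "x \<in> {rest<..<\<Phi>}" for x
  proof -
    obtain t1 where t1: "t1 < T" "\<phi> t1 = x" using o(7)[of x] x by auto
    define u0 where "u0 = exp (2 * (T0 - t1))"
    define u where "u = exp (2 * (T - t1))"
    define K1 where "K1 v = exp (\<kappa> * t1) * h (exp (2 * \<kappa> * t1) * v ^ j)" for v
    define K2 where "K2 v = exp (- (\<kappa> / 2) * ln v) * \<phi> (t1 + 1 / 2 * ln v)" for v
    \<comment> \<open>The switch at \<open>u0 / 2\<close> lies inside the interval where the two
      formulas agree, so it leaves no trace. \<open>K1\<close> also makes sense for
      \<open>v < 0\<close>, as analyticity at 0 requires.\<close>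
    define K where "K v = (if v < u0 / 2 then K1 v else K2 v)" for v
    have u0: "u0 > 0" by (simp add: u0_def)
    have expj: "exp (2 * \<kappa> * t1) * exp (2 * \<tau>) ^ j = exp (2 * \<kappa> * (t1 + \<tau>))" for \<tau>
      by (simp add: j exp_add[symmetric] exp_of_nat_mult[symmetric] algebra_simps)
    have K12e: "K1 (exp (2 * \<tau>)) = K2 (exp (2 * \<tau>))" and inR: "exp (2 * \<kappa> * t1) * exp (2 * \<tau>) ^ j < R"
      if "exp (2 * \<tau>) < u0" for \<tau>
    proof -
      have "t1 + \<tau> < T0" using that by (simp add: u0_def)
      note e = o(5)[OF this]
      show "exp (2 * \<kappa> * t1) * exp (2 * \<tau>) ^ j < R" unfolding expj using e by blast
      show "K1 (exp (2 * \<tau>)) = K2 (exp (2 * \<tau>))"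
        unfolding K1_def K2_def expj using e by (simp add: exp_add[symmetric] algebra_simps)
    qed
    have half: "exp (2 * (ln v / 2)) = v" if "v > 0" for v :: real using that by simp
    have K12: "K1 v = K2 v" if "0 < v" "v < u0" for v
      using K12e[of "ln v / 2"] that by simp
    have inR': "\<bar>exp (2 * \<kappa> * t1) * v ^ j\<bar> < R" if "0 \<le> v" "v < u0" for v
    proof (cases "v = 0")
      case True
      then show ?thesis using o(2) \<kappa> j by (cases j) auto
    next
      case False
      then show ?thesis using inR[of "ln v / 2"] that by (simp add: abs_mult)
    qed
    have aK1: "analytic_real {0..<u0} K1"
    proof -
      have "analytic_real {0..<u0} (\<lambda>v. exp (2 * \<kappa> * t1) * v ^ j)"
        by (rule analytic_real_compose[where g="\<lambda>v. exp (2 * \<kappa> * t1) * v", OF analytic_real_const_mult[of UNIV] analytic_real_power]) simp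
      then have "analytic_real {0..<u0} (\<lambda>v. h (exp (2 * \<kappa> * t1) * v ^ j))"
        by (rule analytic_real_compose[OF o(3)]) (use inR' in simp)
      then show ?thesis unfolding K1_def[abs_def]
        by (rule analytic_real_compose[where g="\<lambda>v. exp (\<kappa> * t1) * v", OF analytic_real_const_mult[of UNIV]]) simp
    qed
    have aK2: "analytic_real {0<..<u} K2"
    proof -
      have ln: "analytic_real {0<..<u} ln"
        using analytic_real_ln unfolding analytic_real_def by auto
      have c: "analytic_real {0<..<u} (\<lambda>v. c * ln v)" for c
        by (rule analytic_real_compose[where g="\<lambda>v. c * v", OF analytic_real_const_mult[of UNIV] ln]) simp
      have e: "analytic_real {0<..<u} (\<lambda>v. exp (- (\<kappa> / 2) * ln v))"
        by (rule analytic_real_compose[where g=exp, OF analytic_real_exp[of UNIV] c]) simp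
      have s: "analytic_real UNIV (\<lambda>v. t1 + v)"
        by (rule analytic_real_holomorphic[where r="\<lambda>_. 1" and g="\<lambda>z. of_real t1 + z"])
          (auto intro!: holomorphic_intros)
      have "analytic_real {0<..<u} (\<lambda>v. t1 + 1 / 2 * ln v)"
        by (rule analytic_real_compose[where g="\<lambda>v. t1 + v", OF s c]) simp
      then have "analytic_real {0<..<u} (\<lambda>v. \<phi> (t1 + 1 / 2 * ln v))"
      proof (rule analytic_real_compose[OF an])
        fix v assume v: "v \<in> {0<..<u}"
        then have "ln v < ln u" by simp
        then show "t1 + 1 / 2 * ln v \<in> {..<T}" by (simp add: u_def)
      qed
      then show ?thesis unfolding K2_def[abs_def] by (rule analytic_real_mult[OF e])
    qed
    have "analytic_real {0..<u0} K"
    proof (rule analytic_real_cong[OF aK1])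
      fix a assume a: "a \<in> {0..<u0}"
      have "K1 x = K x" if "\<bar>x - a\<bar> < u0 - a" for x
        using that K12[of x] u0 by (cases "x < u0 / 2") (simp_all add: K_def abs_less_iff)
      then show "\<exists>e>0. \<forall>x. \<bar>x - a\<bar> < e \<longrightarrow> K1 x = K x"
        using a by (intro exI[of _ "u0 - a"]) simp
    qed
    moreover have "analytic_real {0<..<u} K"
    proof (rule analytic_real_cong[OF aK2])
      fix a assume a: "a \<in> {0<..<u}"
      have "K2 x = K x" if "\<bar>x - a\<bar> < a" for x
        using that K12[of x] u0 by (cases "x < u0 / 2") (simp_all add: K_def abs_less_iff)
      then show "\<exists>e>0. \<forall>x. \<bar>x - a\<bar> < e \<longrightarrow> K2 x = K x"
        using a by (intro exI[of _ a]) simp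
    qed
    ultimately have "analytic_real {0..<u} K"
      using u0 unfolding analytic_real_def by (metis atLeastLessThan_iff greaterThanLessThan_iff less_eq_real_def)
    moreover have "u > 1" using t1 by (simp add: u_def)
    moreover have "K (exp (2 * \<tau>)) = exp (- \<kappa> * \<tau>) * \<phi> (t1 + \<tau>)" for \<tau>
    proof -
      have "K (exp (2 * \<tau>)) = K2 (exp (2 * \<tau>))"
        unfolding K_def using K12e[of \<tau>] u0 by auto
      then show ?thesis by (simp add: K2_def)
    qed
    moreover have "((\<lambda>\<tau>. \<phi> (t1 + \<tau>)) has_real_derivative \<psi> (t1 + \<tau>)) (at \<tau>)"
      "((\<lambda>\<tau>. \<psi> (t1 + \<tau>)) has_real_derivative field (\<phi> (t1 + \<tau>)) (\<psi> (t1 + \<tau>))) (at \<tau>)"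
      if "exp (2 * \<tau>) < u" for \<tau>
    proof -
      have m: "t1 + \<tau> \<in> {..<T}" using that by (simp add: u_def)
      have sh: "((\<lambda>\<tau>. t1 + \<tau>) has_real_derivative 1) (at \<tau>)" by (auto intro!: derivative_eq_intros)
      show "((\<lambda>\<tau>. \<phi> (t1 + \<tau>)) has_real_derivative \<psi> (t1 + \<tau>)) (at \<tau>)"
        "((\<lambda>\<tau>. \<psi> (t1 + \<tau>)) has_real_derivative field (\<phi> (t1 + \<tau>)) (\<psi> (t1 + \<tau>))) (at \<tau>)"
        using DERIV_chain2[OF solutionD(1)[OF o(1) m] sh] DERIV_chain2[OF solutionD(2)[OF o(1) m] sh] by simp_all
    qed
    ultimately show ?thesis using t1(2)
      by (intro exI[of _ K] exI[of _ u] exI[of _ "\<lambda>\<tau>. \<phi> (t1 + \<tau>)"] exI[of _ "\<lambda>\<tau>. \<psi> (t1 + \<tau>)"]) simp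
  qed
  then show ?thesis using o(6) by blast
qed

section \<open>Linear algebra of singular values\<close>

text \<open>Orthogonal images of known squared length only need rescaling. Injectivity is recorded
  so that sums over the new basis can be pulled back to \<open>B\<close>.\<close>

lemma orthonormal_basis_scaled_image:
  fixes Y :: "'a::euclidean_space \<Rightarrow> 'e::euclidean_space"
  assumes Y: "linear Y" and B: "span B = T"
    and w: "\<And>v. v \<in> B \<Longrightarrow> w v > 0"
    and Yw: "\<And>u v. u \<in> B \<Longrightarrow> v \<in> B \<Longrightarrow> Y u \<bullet> Y v = (if u = v then w v else 0)"
  shows "orthonormal_basis_of (Y ` T) ((\<lambda>v. (1 / sqrt (w v)) *\<^sub>R Y v) ` B)"
    and "inj_on (\<lambda>v. (1 / sqrt (w v)) *\<^sub>R Y v) B"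
proof -
  let ?g = "\<lambda>v. (1 / sqrt (w v)) *\<^sub>R Y v"
  have g: "?g u \<bullet> ?g v = (if u = v then 1 else 0)" if "u \<in> B" "v \<in> B" for u v
    using Yw[OF that] w[OF that(2)] by (auto simp flip: real_sqrt_mult)
  show "inj_on ?g B"
  proof (rule inj_onI, rule ccontr)
    fix u v assume uv: "u \<in> B" "v \<in> B" "?g u = ?g v" "u \<noteq> v"
    then show False using g[of u v] g[of v v] by simp
  qed
  have "span (?g ` B) = span (Y ` B)"
  proof (rule subset_antisym; rule span_minimal)
    show "?g ` B \<subseteq> span (Y ` B)" by (auto intro: span_scale span_base)
    show "Y ` B \<subseteq> span (?g ` B)"
    proof
      fix y assume "y \<in> Y ` B"
      then obtain v where v: "v \<in> B" "y = Y v" by blast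
      have "sqrt (w v) *\<^sub>R ?g v \<in> span (?g ` B)" using v(1) by (intro span_scale span_base imageI)
      moreover have "sqrt (w v) *\<^sub>R ?g v = y" using w[OF v(1)] v(2) by simp
      ultimately show "y \<in> span (?g ` B)" by (simp only:)
    qed
  qed auto
  also have "\<dots> = Y ` T" unfolding B[symmetric] by (rule linear_span_image[OF Y])
  finally have sp: "span (?g ` B) = Y ` T" .
  moreover have "\<forall>b\<in>?g ` B. norm b = 1"
  proof
    fix b assume "b \<in> ?g ` B"
    then obtain v where v: "v \<in> B" "b = ?g v" by blast
    show "norm b = 1" unfolding v(2) norm_eq_1 g[OF v(1) v(1)] by simp
  qed
  moreover have "pairwise orthogonal (?g ` B)"
    unfolding pairwise_def
  proof (intro ballI impI)
    fix x y assume "x \<in> ?g ` B" "y \<in> ?g ` B" "x \<noteq> y"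
    then obtain u v where uv: "u \<in> B" "v \<in> B" "x = ?g u" "y = ?g v" "u \<noteq> v" by blast
    then show "orthogonal x y" unfolding orthogonal_def uv(3,4) g[OF uv(1,2)] by simp
  qed
  ultimately show "orthonormal_basis_of (Y ` T) (?g ` B)"
    unfolding orthonormal_basis_of_def using span_superset[of "?g ` B"] by blast
qed

lemma orthonormal_basis_of_card:
  fixes L :: "'a::euclidean_space set"
  assumes "orthonormal_basis_of L B"
  shows "card B = dim L"
proof -
  have "0 \<notin> B" using assms unfolding orthonormal_basis_of_def by fastforce
  then have "independent B"
    using assms pairwise_orthogonal_independent unfolding orthonormal_basis_of_def by blast
  then show ?thesis using assms dim_span_eq_card_independent unfolding orthonormal_basis_of_def by metis
qed

lemma orthonormal_basis_of_Un:
  fixes S R T :: "'a::euclidean_space set"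
  assumes B: "orthonormal_basis_of S B" and C: "orthonormal_basis_of R C"
    and orth: "\<And>u v. u \<in> S \<Longrightarrow> v \<in> R \<Longrightarrow> u \<bullet> v = 0" and T: "subspace T" "S \<subseteq> T" "R \<subseteq> T"
    and dec: "\<And>v. v \<in> T \<Longrightarrow> \<exists>u\<in>S. v - u \<in> R"
  shows "orthonormal_basis_of T (B \<union> C)" and "B \<inter> C = {}"
proof -
  have BS: "B \<subseteq> S" "span B = S" "pairwise orthogonal B" "\<And>b. b \<in> B \<Longrightarrow> norm b = 1"
    and CR: "C \<subseteq> R" "span C = R" "pairwise orthogonal C" "\<And>b. b \<in> C \<Longrightarrow> norm b = 1"
    using B C unfolding orthonormal_basis_of_def by auto
  have bc: "b \<bullet> c = 0" "c \<bullet> b = 0" if "b \<in> B" "c \<in> C" for b c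
    using orth[of b c] that BS CR by (auto simp: inner_commute)
  show "B \<inter> C = {}"
  proof (rule ccontr)
    assume "B \<inter> C \<noteq> {}"
    then obtain b where b: "b \<in> B" "b \<in> C" by blast
    then show False using bc(1)[OF b] BS(4)[OF b(1)] by simp
  qed
  have "span (B \<union> C) = T"
  proof
    show "span (B \<union> C) \<subseteq> T" using BS CR T by (intro span_minimal) auto
    show "T \<subseteq> span (B \<union> C)"
    proof
      fix v assume "v \<in> T"
      then obtain u where u: "u \<in> S" "v - u \<in> R" using dec by blast
      have "u \<in> span (B \<union> C)" "v - u \<in> span (B \<union> C)"
        using u BS CR span_mono[of B "B \<union> C"] span_mono[of C "B \<union> C"] by auto
      then have "u + (v - u) \<in> span (B \<union> C)" by (rule span_add)
      then show "v \<in> span (B \<union> C)" by simp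
    qed
  qed
  moreover have "pairwise orthogonal (B \<union> C)"
    using BS(3) CR(3) bc by (auto simp: pairwise_def orthogonal_def)
  ultimately show "orthonormal_basis_of T (B \<union> C)"
    unfolding orthonormal_basis_of_def using BS CR T by auto
qed

text \<open>A direction of maximal stretching orthogonal to a singular space is again singular.\<close>

theorem singular_decomposition:
  fixes T :: "'a::euclidean_space set" and A :: "'a \<Rightarrow> 'b::euclidean_space"
  assumes T: "subspace T" and A: "linear A" and s: "s > 0"
    and uniq: "\<And>m. m \<noteq> 0 \<Longrightarrow> singular_value T A m \<Longrightarrow> m = s"
  shows "\<exists>B C. orthonormal_basis_of T (B \<union> C) \<and> B \<inter> C = {} \<and> card B = dim (singular_space T A s) \<and>
    card (B \<union> C) = dim T \<and>
    (\<forall>v\<in>B. \<forall>u\<in>T. A v \<bullet> A u = s\<^sup>2 * (v \<bullet> u)) \<and> (\<forall>v\<in>C. A v = 0)"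
proof -
  define S where "S = singular_space T A s"
  have S: "subspace S"
    unfolding S_def singular_space_def subspace_def
    using T A by (auto simp: subspace_0 subspace_add subspace_scale linear_0 linear_add linear_cmul inner_add_left distrib_left)
  have ST: "S \<subseteq> T" and SA: "\<And>v u. v \<in> S \<Longrightarrow> u \<in> T \<Longrightarrow> A v \<bullet> A u = s\<^sup>2 * (v \<bullet> u)"
    unfolding S_def singular_space_def by auto
  define R where "R = {v \<in> T. \<forall>u\<in>S. u \<bullet> v = 0}"
  have R: "subspace R"
    unfolding R_def subspace_def
    using T by (auto simp: subspace_0 subspace_add subspace_scale inner_add_right)
  have RT: "R \<subseteq> T" by (auto simp: R_def)
  have dec: "\<exists>u\<in>S. v - u \<in> R" if v: "v \<in> T" for v
  proof -
    obtain y z where yz: "y \<in> span S" "\<And>w. w \<in> span S \<Longrightarrow> orthogonal z w" "v = y + z"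
      using orthogonal_subspace_decomp_exists[of S v] by metis
    have y: "y \<in> S" using yz(1) S by (metis span_eq_iff)
    moreover have "v - y \<in> R"
      using yz(2,3) subspace_diff[OF T v, of y] y ST
      by (auto simp: R_def orthogonal_def inner_commute span_base)
    ultimately show ?thesis by blast
  qed
  have zero: "A v = 0" if v: "v \<in> R" for v
  proof (rule ccontr)
    assume nz: "A v \<noteq> 0"
    then have "v \<noteq> 0" using A linear_0 by auto
    \<comment> \<open>Unit vectors orthogonal to the singular space; a maximiser of the stretching
      exists by compactness.\<close>
    define Q where "Q = R \<inter> sphere 0 1"
    have "compact Q" unfolding Q_def
      by (metis R closed_subspace compact_sphere closed_Int_compact)
    moreover have vQ: "(1 / norm v) *\<^sub>R v \<in> Q"
      using v R \<open>v \<noteq> 0\<close> by (auto simp: Q_def subspace_scale)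
    moreover have "continuous_on Q (\<lambda>v. norm (A v))"
      using A by (intro continuous_on_norm linear_continuous_on) (simp add: linear_conv_bounded_linear)
    ultimately obtain v0 where v0: "v0 \<in> Q" "\<And>u. u \<in> Q \<Longrightarrow> norm (A u) \<le> norm (A v0)"
      using continuous_attains_sup[of Q "\<lambda>v. norm (A v)"] by blast
    define m where "m = norm (A v0)"
    have v0R: "v0 \<in> R" "v0 \<bullet> v0 = 1" using v0(1) by (auto simp: Q_def norm_eq_1)
    have "norm (A ((1 / norm v) *\<^sub>R v)) \<le> m" using v0(2)[OF vQ] by (simp add: m_def)
    moreover have "norm (A ((1 / norm v) *\<^sub>R v)) > 0"
      using nz \<open>v \<noteq> 0\<close> A by (simp add: linear_cmul)
    ultimately have m: "m > 0" by linarith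
    have max: "A u \<bullet> A u \<le> m\<^sup>2 * (u \<bullet> u)" if u: "u \<in> R" for u
    proof (cases "u = 0")
      case True
      then show ?thesis by (simp add: linear_0[OF A])
    next
      case False
      have "(1 / norm u) *\<^sub>R u \<in> Q" using u R False by (auto simp: Q_def subspace_scale)
      from v0(2)[OF this] have "norm (A u) / norm u \<le> m"
        using A by (simp add: linear_cmul m_def)
      then have "norm (A u) \<le> m * norm u" using False by (simp add: divide_le_eq)
      then have "(norm (A u))\<^sup>2 \<le> (m * norm u)\<^sup>2" by (intro power_mono) auto
      then show ?thesis by (simp add: power_mult_distrib power2_norm_eq_inner)
    qed
    have mm: "A v0 \<bullet> A v0 = m\<^sup>2" by (simp add: m_def power2_norm_eq_inner)
    \<comment> \<open>First variation at the maximiser: \<open>v0 + \<tau> *\<^sub>R u\<close> stays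
      in \<open>R\<close>, which bounds a linear function of \<open>\<tau>\<close> by a quadratic
      one and forces its slope to vanish.\<close>
    have orth: "A v0 \<bullet> A u = 0" if u: "u \<in> R" "v0 \<bullet> u = 0" for u
    proof -
      define a where "a = A v0 \<bullet> A u"
      define b where "b = m\<^sup>2 * (u \<bullet> u)"
      have b: "b \<ge> 0" by (simp add: b_def)
      have le: "2 * \<tau> * a \<le> \<tau>\<^sup>2 * b" for \<tau>
      proof -
        have "v0 + \<tau> *\<^sub>R u \<in> R" using v0R u R by (auto intro: subspace_add subspace_scale)
        from max[OF this] have "m\<^sup>2 + 2 * \<tau> * a + \<tau>\<^sup>2 * (A u \<bullet> A u) \<le> m\<^sup>2 * (1 + \<tau>\<^sup>2 * (u \<bullet> u))"
          using A u v0R mm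
          by (simp add: linear_add linear_cmul inner_add_left inner_add_right inner_commute a_def power2_eq_square algebra_simps)
        moreover have "0 \<le> \<tau>\<^sup>2 * (A u \<bullet> A u)" by simp
        moreover have "m\<^sup>2 * (1 + \<tau>\<^sup>2 * (u \<bullet> u)) = m\<^sup>2 + \<tau>\<^sup>2 * b" by (simp add: b_def algebra_simps)
        ultimately show ?thesis by linarith
      qed
      \<comment> \<open>The choice \<open>\<tau> = a / (b + 1)\<close> also covers
        \<open>b = 0\<close>.\<close>
      have "2 * (a / (b + 1)) * a \<le> (a / (b + 1))\<^sup>2 * b" by (rule le)
      also have "\<dots> \<le> (a / (b + 1))\<^sup>2 * (b + 1)" by (intro mult_left_mono) auto
      also have "\<dots> = (a / (b + 1)) * a" using b by (simp add: power2_eq_square)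
      finally have "a * a / (b + 1) \<le> 0" by simp
      then have "a * a \<le> 0" using b by (simp add: divide_le_0_iff)
      then show ?thesis by (metis a_def mult_le_0_iff order_antisym)
    qed
    have "v0 \<in> singular_space T A m"
      unfolding singular_space_def
    proof (intro CollectI conjI ballI)
      show "v0 \<in> T" using v0R RT by auto
      fix u assume "u \<in> T"
      then obtain u1 where u1: "u1 \<in> S" "u - u1 \<in> R" using dec by blast
      define u2 where "u2 = u - u1"
      define u3 where "u3 = u2 - (v0 \<bullet> u2) *\<^sub>R v0"
      have u3: "u3 \<in> R" "v0 \<bullet> u3 = 0"
        using u1 v0R R by (auto simp: u2_def u3_def inner_diff_right intro: subspace_diff subspace_scale)
      have "v0 \<bullet> u1 = 0" using u1(1) v0R(1) by (auto simp: R_def inner_commute)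
      moreover have "A v0 \<bullet> A u1 = 0"
        using SA[OF u1(1), of v0] v0R RT \<open>v0 \<bullet> u1 = 0\<close> by (auto simp: inner_commute)
      moreover have "u = u1 + (v0 \<bullet> u2) *\<^sub>R v0 + u3" by (simp add: u2_def u3_def)
      then have "A u = A u1 + (v0 \<bullet> u2) *\<^sub>R A v0 + A u3"
        using A by (metis linear_add linear_cmul)
      moreover have "v0 \<bullet> u = v0 \<bullet> u1 + v0 \<bullet> u2" by (simp add: u2_def inner_diff_right)
      ultimately show "A v0 \<bullet> A u = m\<^sup>2 * (v0 \<bullet> u)"
        using orth[OF u3] mm by (simp add: inner_add_right)
    qed
    moreover have "v0 \<noteq> 0" using v0R by auto
    ultimately have "singular_value T A m" using m by (auto simp: singular_value_def)
    \<comment> \<open>This puts the maximiser into the very space to which it is orthogonal.\<close>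
    then have "m = s" using uniq m by auto
    then have "v0 \<in> S" using \<open>v0 \<in> singular_space T A m\<close> by (simp add: S_def)
    then have "v0 \<bullet> v0 = 0" using v0R by (auto simp: R_def)
    then show False using v0R by simp
  qed
  obtain B where B: "orthonormal_basis_of S B" using orthonormal_basis_of_exists[OF S] by blast
  obtain C where C: "orthonormal_basis_of R C" using orthonormal_basis_of_exists[OF R] by blast
  have orth: "u \<bullet> v = 0" if "u \<in> S" "v \<in> R" for u v using that by (auto simp: R_def)
  note BC = orthonormal_basis_of_Un[OF B C orth T ST RT dec]
  have "B \<subseteq> S" "C \<subseteq> R" using B C unfolding orthonormal_basis_of_def by auto
  then show ?thesis
    using BC orthonormal_basis_of_card[OF B] orthonormal_basis_of_card[OF BC(1)] SA zero
    by (intro exI[of _ B] exI[of _ C]) (auto simp: S_def)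
qed


section \<open>Radial multiples of homogeneous maps\<close>

text \<open>Covers three maps at once: the normalisation of \<open>y\<close>, the map
  \<open>P\<close> evaluated at the normalised \<open>y\<close>, and the Dirichlet solution
  itself.\<close>

locale radial_multiple =
  fixes U :: "'a::euclidean_space set" and V :: "real set" and K :: "real \<Rightarrow> real"
    and Q :: "'a \<Rightarrow> 'b::euclidean_space" and Q' :: "'a \<Rightarrow> 'a \<Rightarrow> 'b" and Q'' :: "'a \<Rightarrow> 'a \<Rightarrow> 'a \<Rightarrow> 'b"
  assumes U: "open U" and V: "\<And>y. y \<in> U \<Longrightarrow> y \<bullet> y \<in> V" and K: "analytic_real V K"
    and Q: "smooth_on UNIV Q" "\<And>y. (Q has_derivative Q' y) (at y)"
      "\<And>y u. ((\<lambda>y. Q' y u) has_derivative Q'' y u) (at y)"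
begin

definition G :: "'a \<Rightarrow> 'b" where "G y = K (y \<bullet> y) *\<^sub>R Q y"

definition G' :: "'a \<Rightarrow> 'a \<Rightarrow> 'b" where
  "G' y v = K (y \<bullet> y) *\<^sub>R Q' y v + (2 * deriv K (y \<bullet> y) * (y \<bullet> v)) *\<^sub>R Q y"

definition G'' :: "'a \<Rightarrow> 'a \<Rightarrow> 'a \<Rightarrow> 'b" where
  "G'' y u w = K (y \<bullet> y) *\<^sub>R Q'' y u w + (2 * deriv K (y \<bullet> y) * (y \<bullet> w)) *\<^sub>R Q' y u +
     ((2 * deriv K (y \<bullet> y) * (y \<bullet> u)) *\<^sub>R Q' y w +
      (2 * (2 * deriv (deriv K) (y \<bullet> y) * (y \<bullet> w) * (y \<bullet> u) + deriv K (y \<bullet> y) * (w \<bullet> u))) *\<^sub>R Q y)"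

lemma smooth_G: "smooth_on U G"
proof -
  have "smooth_on U (\<lambda>y. y \<bullet> y)" by (rule smooth_on_inner[OF U smooth_on_ident smooth_on_ident])
  from smooth_on_analytic_compose[OF U this V K] smooth_on_subset[OF Q(1), of U]
  show ?thesis unfolding G_def[abs_def] by (intro smooth_on_scaleR U) auto
qed

lemma radial_has_derivative:
  assumes "analytic_real V H" "y \<in> U"
  shows "((\<lambda>y. H (y \<bullet> y)) has_derivative (\<lambda>v. 2 * deriv H (y \<bullet> y) * (y \<bullet> v))) (at y)"
proof -
  have "((\<lambda>y. y \<bullet> y) has_derivative (\<lambda>v. y \<bullet> v + v \<bullet> y)) (at y)"
    by (rule has_derivative_inner[OF has_derivative_ident has_derivative_ident])
  moreover have "(H has_derivative (\<lambda>t. deriv H (y \<bullet> y) * t)) (at (y \<bullet> y))"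
    using analytic_real_has_derivative[OF assms(1) V[OF assms(2)]] by (simp add: has_field_derivative_def)
  ultimately have "((\<lambda>y. H (y \<bullet> y)) has_derivative (\<lambda>v. deriv H (y \<bullet> y) * (y \<bullet> v + v \<bullet> y))) (at y)"
    by (rule has_derivative_compose)
  then show ?thesis by (simp add: inner_commute mult_ac flip: mult_2)
qed

lemma G_has_derivative: "y \<in> U \<Longrightarrow> (G has_derivative G' y) (at y)"
  unfolding G_def[abs_def] G'_def[abs_def]
  by (rule has_derivative_scaleR[OF radial_has_derivative[OF K] Q(2)])

lemma G'_has_derivative:
  assumes y: "y \<in> U"
  shows "((\<lambda>y. G' y u) has_derivative G'' y u) (at y)"
proof -
  have "((\<lambda>y. y \<bullet> u) has_derivative (\<lambda>w. w \<bullet> u)) (at y)"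
    by (rule has_derivative_inner_left[OF has_derivative_ident])
  from has_derivative_mult[OF radial_has_derivative[OF analytic_real_deriv[OF K] y] this]
  have "((\<lambda>y. deriv K (y \<bullet> y) * (y \<bullet> u)) has_derivative
      (\<lambda>w. deriv K (y \<bullet> y) * (w \<bullet> u) + 2 * deriv (deriv K) (y \<bullet> y) * (y \<bullet> w) * (y \<bullet> u))) (at y)" .
  from has_derivative_mult_right[OF this, of 2]
  have "((\<lambda>y. 2 * deriv K (y \<bullet> y) * (y \<bullet> u)) has_derivative
      (\<lambda>w. 2 * (2 * deriv (deriv K) (y \<bullet> y) * (y \<bullet> w) * (y \<bullet> u) + deriv K (y \<bullet> y) * (w \<bullet> u)))) (at y)"
    by (simp add: mult.assoc add.commute)
  from has_derivative_add[OF has_derivative_scaleR[OF radial_has_derivative[OF K y] Q(3)] has_derivative_scaleR[OF this Q(2)]]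
  show ?thesis unfolding G'_def[abs_def] G''_def[abs_def] .
qed

end

section \<open>Homogeneous maps and Euler relations\<close>

locale homogeneous_map =
  fixes P :: "'a::euclidean_space \<Rightarrow> 'b::euclidean_space" and k :: nat
  assumes smooth: "smooth_on UNIV P" and hom: "P (t *\<^sub>R x) = t ^ k *\<^sub>R P x" and k2: "k \<ge> 2"
begin

definition DP :: "'a \<Rightarrow> 'a \<Rightarrow> 'b" where "DP x = frechet_derivative P (at x)"

definition D2P :: "'a \<Rightarrow> 'a \<Rightarrow> 'a \<Rightarrow> 'b" where
  "D2P x u = frechet_derivative (\<lambda>y. DP y u) (at x)"

lemma P_has_derivative: "(P has_derivative DP x) (at x)"
  unfolding DP_def by (rule smooth_on_has_derivative[OF smooth UNIV_I])

lemma DP_has_derivative: "((\<lambda>y. DP y u) has_derivative D2P x u) (at x)"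
  unfolding D2P_def
  by (rule smooth_on_has_derivative[OF smooth_on_derivative[OF open_UNIV smooth P_has_derivative] UNIV_I])

lemma parametrised_graph: "parametrised UNIV (\<lambda>x. (x, P x)) (\<lambda>x v. (v, DP x v)) (\<lambda>x u v. (0, D2P x u v)) fst"
proof (rule parametrised.intro)
  show "smooth_on UNIV (\<lambda>x. (x, P x))" by (rule smooth_on_Pair[OF open_UNIV smooth_on_ident smooth])
  show "((\<lambda>x. (x, P x)) has_derivative (\<lambda>v. (v, DP x v))) (at x)" for x
    by (rule has_derivative_Pair[OF has_derivative_ident P_has_derivative])
  show "((\<lambda>x. (u, DP x u)) has_derivative (\<lambda>v. (0, D2P x u v))) (at x)" for x u
    by (rule has_derivative_Pair[OF has_derivative_const DP_has_derivative])
  show "bounded_linear fst" by (rule bounded_linear_fst)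
qed auto

lemma linear_DP: "linear (DP x)"
  using P_has_derivative has_derivative_linear by blast

lemma linear_D2P: "linear (D2P x u)"
  using DP_has_derivative has_derivative_linear by blast

text \<open>Borrowed from the graph of \<open>P\<close>, viewed as a parametrised
  submanifold.\<close>

lemma linear_D2P_left: "linear (\<lambda>u. D2P x u v)"
  using linear_compose[OF parametrised.linear_X''_left[OF parametrised_graph UNIV_I] linear_snd]
  by (simp add: o_def)

lemma DP_ray: "DP (t *\<^sub>R x) x = (real k * t ^ (k - 1)) *\<^sub>R P x"
proof -
  have l: "((\<lambda>s. s *\<^sub>R x) has_derivative (\<lambda>s. s *\<^sub>R x)) (at t)"
    by (auto intro!: derivative_eq_intros)
  have "((\<lambda>s. P (s *\<^sub>R x)) has_derivative (\<lambda>s. DP (t *\<^sub>R x) (s *\<^sub>R x))) (at t)"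
    by (rule has_derivative_compose[OF l P_has_derivative])
  moreover have "((\<lambda>s. P (s *\<^sub>R x)) has_derivative (\<lambda>s. (s * (real k * t ^ (k - 1))) *\<^sub>R P x)) (at t)"
    unfolding hom by (auto intro!: derivative_eq_intros simp: mult_ac)
  ultimately have "DP (t *\<^sub>R x) (1 *\<^sub>R x) = (1 * (real k * t ^ (k - 1))) *\<^sub>R P x"
    using has_derivative_unique by metis
  then show ?thesis by simp
qed

text \<open>\<open>t = 1\<close> gives the radial second derivative on the sphere;
  \<open>t = 0\<close> shows that second derivatives vanish at the centre when
  \<open>k \<ge> 3\<close>.\<close>

lemma D2P_ray: "D2P (t *\<^sub>R x) x x = (real k * real (k - 1) * t ^ (k - 2)) *\<^sub>R P x"
proof -
  have l: "((\<lambda>s. s *\<^sub>R x) has_derivative (\<lambda>s. s *\<^sub>R x)) (at t)"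
    by (auto intro!: derivative_eq_intros)
  have "((\<lambda>s. DP (s *\<^sub>R x) x) has_derivative (\<lambda>s. D2P (t *\<^sub>R x) x (s *\<^sub>R x))) (at t)"
    by (rule has_derivative_compose[OF l DP_has_derivative])
  moreover have "((\<lambda>s. DP (s *\<^sub>R x) x) has_derivative (\<lambda>s. (s * (real k * (real (k - 1) * t ^ (k - 1 - 1)))) *\<^sub>R P x)) (at t)"
    unfolding DP_ray by (auto intro!: derivative_eq_intros simp: mult_ac)
  ultimately have "D2P (t *\<^sub>R x) x (1 *\<^sub>R x) = (1 * (real k * (real (k - 1) * t ^ (k - 1 - 1)))) *\<^sub>R P x"
    using has_derivative_unique by metis
  then show ?thesis by (simp add: mult.assoc numeral_2_eq_2)
qed

lemma DP_scale:
  assumes r: "r \<noteq> 0"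
  shows "DP (r *\<^sub>R x) v = r ^ (k - 1) *\<^sub>R DP x v"
proof -
  have l: "((\<lambda>y. r *\<^sub>R y) has_derivative (\<lambda>v. r *\<^sub>R v)) (at x)"
    by (auto intro!: derivative_eq_intros)
  have "((\<lambda>y. P (r *\<^sub>R y)) has_derivative (\<lambda>v. DP (r *\<^sub>R x) (r *\<^sub>R v))) (at x)"
    by (rule has_derivative_compose[OF l P_has_derivative])
  moreover have "((\<lambda>y. P (r *\<^sub>R y)) has_derivative (\<lambda>v. r ^ k *\<^sub>R DP x v)) (at x)"
    unfolding hom by (rule has_derivative_scaleR_right[OF P_has_derivative])
  ultimately have "DP (r *\<^sub>R x) (r *\<^sub>R v) = r ^ k *\<^sub>R DP x v"
    using has_derivative_unique by metis
  then have "r *\<^sub>R DP (r *\<^sub>R x) v = r *\<^sub>R (r ^ (k - 1) *\<^sub>R DP x v)"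
    using k2 by (simp add: linear_cmul[OF linear_DP] power_eq_if[of r k])
  then show ?thesis by (rule scaleR_left_imp_eq[OF r])
qed

lemma D2P_scale:
  assumes r: "r \<noteq> 0"
  shows "D2P (r *\<^sub>R x) u v = r ^ (k - 2) *\<^sub>R D2P x u v"
proof -
  have l: "((\<lambda>y. r *\<^sub>R y) has_derivative (\<lambda>v. r *\<^sub>R v)) (at x)"
    by (auto intro!: derivative_eq_intros)
  have "((\<lambda>y. DP (r *\<^sub>R y) u) has_derivative (\<lambda>v. D2P (r *\<^sub>R x) u (r *\<^sub>R v))) (at x)"
    by (rule has_derivative_compose[OF l DP_has_derivative])
  moreover have "((\<lambda>y. DP (r *\<^sub>R y) u) has_derivative (\<lambda>v. r ^ (k - 1) *\<^sub>R D2P x u v)) (at x)"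
    unfolding DP_scale[OF r] by (rule has_derivative_scaleR_right[OF DP_has_derivative])
  ultimately have "D2P (r *\<^sub>R x) u (r *\<^sub>R v) = r ^ (k - 1) *\<^sub>R D2P x u v"
    using has_derivative_unique by metis
  moreover have "r ^ (k - 1) = r * r ^ (k - 2)"
    using k2 by (metis Suc_1 Suc_diff_le diff_Suc_Suc One_nat_def power_Suc)
  ultimately have "r *\<^sub>R D2P (r *\<^sub>R x) u v = r *\<^sub>R (r ^ (k - 2) *\<^sub>R D2P x u v)"
    by (simp add: linear_cmul[OF linear_D2P])
  then show ?thesis by (rule scaleR_left_imp_eq[OF r])
qed

lemma P_0: "P 0 = 0" using hom[of 0 0] k2 by (simp add: power_0_left)

lemma D2P_0: "k \<ge> 3 \<Longrightarrow> D2P 0 v v = 0"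
  using D2P_ray[of 0 v] by simp

end

section \<open>Homogeneous maps between spheres\<close>

locale homogeneous_sphere_map = homogeneous_map +
  assumes unit: "norm x = 1 \<Longrightarrow> norm (P x) = 1"
begin

lemma P_inner_self: "P x \<bullet> P x = (x \<bullet> x) ^ k"
proof (cases "x = 0")
  case True
  then show ?thesis using P_0 k2 by simp
next
  case False
  have "P x = norm x ^ k *\<^sub>R P ((1 / norm x) *\<^sub>R x)" using False by (simp flip: hom)
  moreover have "norm (P ((1 / norm x) *\<^sub>R x)) = 1" using False by (intro unit) simp
  ultimately have "P x \<bullet> P x = (norm x ^ k)\<^sup>2" by (simp add: norm_eq_1 power2_eq_square)
  then show ?thesis by (simp add: power2_norm_eq_inner[symmetric] power_mult[symmetric] mult.commute)
qed

lemma P_inner_DP: "P x \<bullet> DP x v = real k * (x \<bullet> x) ^ (k - 1) * (x \<bullet> v)"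
proof -
  have a: "((\<lambda>x. P x \<bullet> P x) has_derivative (\<lambda>v. P x \<bullet> DP x v + DP x v \<bullet> P x)) (at x)"
    by (rule has_derivative_inner[OF P_has_derivative P_has_derivative])
  have b: "((\<lambda>x. P x \<bullet> P x) has_derivative (\<lambda>v. real k * (x \<bullet> v + v \<bullet> x) * (x \<bullet> x) ^ (k - 1))) (at x)"
    unfolding P_inner_self
    by (rule has_derivative_power[OF has_derivative_inner[OF has_derivative_ident has_derivative_ident]])
  have "P x \<bullet> DP x v + DP x v \<bullet> P x = real k * (x \<bullet> v + v \<bullet> x) * (x \<bullet> x) ^ (k - 1)"
    by (rule fun_cong[OF has_derivative_unique[OF a b]])
  then show ?thesis by (simp add: inner_commute mult_ac)
qed

text \<open>A second differentiation of the norm identity. It fixes the component of the Hessian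
  along \<open>P x\<close> in terms of the stretching of \<open>v\<close>.\<close>

lemma DP_inner_self:
  assumes x: "norm x = 1" and v: "v \<bullet> x = 0"
  shows "DP x v \<bullet> DP x v + P x \<bullet> D2P x v v = real k * (v \<bullet> v)"
proof -
  have a: "((\<lambda>y. P y \<bullet> DP y v) has_derivative (\<lambda>w. P x \<bullet> D2P x v w + DP x w \<bullet> DP x v)) (at x)"
    by (rule has_derivative_inner[OF P_has_derivative DP_has_derivative])
  have b: "((\<lambda>y. P y \<bullet> DP y v) has_derivative
     (\<lambda>w. real k * (x \<bullet> x) ^ (k - 1) * (w \<bullet> v) + real k * (real (k - 1) * (x \<bullet> w + w \<bullet> x) * (x \<bullet> x) ^ (k - 1 - 1)) * (x \<bullet> v))) (at x)"
    unfolding P_inner_DP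
    by (intro has_derivative_mult has_derivative_mult_right has_derivative_power has_derivative_inner
        has_derivative_ident has_derivative_inner_left)
  have "P x \<bullet> D2P x v v + DP x v \<bullet> DP x v =
     real k * (x \<bullet> x) ^ (k - 1) * (v \<bullet> v) + real k * (real (k - 1) * (x \<bullet> v + v \<bullet> x) * (x \<bullet> x) ^ (k - 1 - 1)) * (x \<bullet> v)"
    by (rule fun_cong[OF has_derivative_unique[OF a b]])
  then show ?thesis using x v by (simp add: norm_eq_1 inner_commute)
qed

end

subsection \<open>Radial projection to the sphere\<close>

text \<open>The power \<open>u^(-j/2)\<close>, written with \<open>exp\<close> and \<open>ln\<close>
  so that its analyticity follows by composition.\<close>

definition inv_norm_power :: "nat \<Rightarrow> real \<Rightarrow> real" where
  "inv_norm_power j u = exp (- (real j / 2) * ln u)"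

lemma analytic_inv_norm_power: "analytic_real {0<..} (inv_norm_power j)"
proof -
  have "analytic_real {0<..} (\<lambda>u. - (real j / 2) * ln u)"
    by (rule analytic_real_compose[where g="\<lambda>v. - (real j / 2) * v", OF analytic_real_const_mult[of UNIV] analytic_real_ln]) simp
  then show ?thesis unfolding inv_norm_power_def[abs_def]
    by (rule analytic_real_compose[where g=exp, OF analytic_real_exp[of UNIV]]) simp
qed

lemma inv_norm_power_1: "inv_norm_power j 1 = 1"
  by (simp add: inv_norm_power_def)

lemma deriv_inv_norm_power_1: "deriv (inv_norm_power j) 1 = - real j / 2"
  unfolding inv_norm_power_def[abs_def]
  by (rule DERIV_imp_deriv) (auto intro!: derivative_eq_intros)

lemma inv_norm_power_inner:
  assumes "y \<noteq> (0 :: 'a::euclidean_space)"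
  shows "inv_norm_power j (y \<bullet> y) = (1 / norm y) ^ j"
proof -
  have "ln (y \<bullet> y) = 2 * ln (norm y)"
    using assms by (simp add: power2_norm_eq_inner[symmetric] ln_realpow)
  then have "inv_norm_power j (y \<bullet> y) = exp (real j * - ln (norm y))"
    by (simp add: inv_norm_power_def)
  also have "\<dots> = (1 / norm y) ^ j"
    unfolding exp_of_nat_mult using assms by (simp add: exp_minus divide_inverse)
  finally show ?thesis .
qed

lemma radial_multiple_id: "radial_multiple (UNIV - {0}) {0<..} (inv_norm_power j) (\<lambda>x. x :: 'a::euclidean_space) (\<lambda>_ v. v) (\<lambda>_ _ _. 0)"
  by unfold_locales (auto simp: analytic_inv_norm_power smooth_on_ident)

text \<open>One inclusion differentiates \<open>g t \<bullet> g t = 1\<close>. For the other, the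
  line through \<open>x\<close> with velocity \<open>v\<close> is normalised; the differential of
  normalisation at \<open>x\<close> fixes tangent vectors.\<close>

lemma tangent_space_sphere:
  fixes x :: "'a::euclidean_space"
  assumes x: "norm x = 1"
  shows "tangent_space (sphere 0 1) x = {v. v \<bullet> x = 0}"
proof (rule subset_antisym; rule subsetI)
  fix v assume "v \<in> tangent_space (sphere 0 1) x"
  then obtain e g where e: "e > 0" "g ` {-e<..<e} \<subseteq> sphere 0 1" "g 0 = x"
      "(g has_vector_derivative v) (at (0::real))"
    unfolding tangent_space_def by auto
  have g': "(g has_derivative (\<lambda>t. t *\<^sub>R v)) (at 0)"
    using e(4) by (simp add: has_vector_derivative_def)
  have "((\<lambda>t. g t \<bullet> g t) has_derivative (\<lambda>t. g 0 \<bullet> (t *\<^sub>R v) + (t *\<^sub>R v) \<bullet> g 0)) (at 0)"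
    by (rule has_derivative_inner[OF g' g'])
  moreover have "((\<lambda>t. g t \<bullet> g t) has_derivative (\<lambda>t. 0)) (at 0)"
  proof (rule has_derivative_transform_within_open[OF has_derivative_const[of 1], where s="{-e<..<e}"])
    show "1 = g t \<bullet> g t" if "t \<in> {-e<..<e}" for t
    proof -
      have "norm (g t) = 1" using e(2) that by (auto simp: image_subset_iff)
      then show ?thesis by (simp add: norm_eq_1)
    qed
  qed (use e in auto)
  ultimately have "g 0 \<bullet> (1 *\<^sub>R v) + (1 *\<^sub>R v) \<bullet> g 0 = 0"
    using has_derivative_unique by metis
  then show "v \<in> {v. v \<bullet> x = 0}" by (simp add: e(3) inner_commute)
next
  fix v assume "v \<in> {v. v \<bullet> x = 0}"
  then have v: "v \<bullet> x = 0" by simp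
  interpret N: radial_multiple "UNIV - {0}" "{0<..}" "inv_norm_power 1" "\<lambda>x. x :: 'a" "\<lambda>_ v. v" "\<lambda>_ _ _. 0"
    by (rule radial_multiple_id)
  let ?l = "\<lambda>t::real. t *\<^sub>R v + x"
  have nz: "?l t \<in> UNIV - {0}" for t
  proof -
    have "?l t \<bullet> x = 1" using x v by (simp add: inner_add_left norm_eq_1)
    then show ?thesis by (metis DiffI UNIV_I inner_zero_left singletonD zero_neq_one)
  qed
  have "smooth_on {-1<..<1} (\<lambda>t. N.G (?l t))"
    by (rule smooth_on_affine_arg[OF bounded_linear_scaleR_left _ nz N.smooth_G]) simp
  moreover have "N.G (?l t) \<in> sphere 0 1" for t
    using nz[of t] unfolding N.G_def by (simp add: inv_norm_power_inner)
  moreover have "N.G (?l 0) = x" using x unfolding N.G_def by (simp add: norm_eq_1 inv_norm_power_1)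
  moreover have "((\<lambda>t. N.G (?l t)) has_vector_derivative v) (at 0)"
  proof -
    have l': "(?l has_derivative (\<lambda>t. t *\<^sub>R v)) (at 0)" by (auto intro!: derivative_eq_intros)
    have "((\<lambda>t. N.G (?l t)) has_derivative (\<lambda>t. N.G' (?l 0) (t *\<^sub>R v))) (at 0)"
      by (rule has_derivative_compose[OF l' N.G_has_derivative[OF nz]])
    moreover have "N.G' (?l 0) (t *\<^sub>R v) = t *\<^sub>R v" for t
      using x v unfolding N.G'_def by (simp add: norm_eq_1 inv_norm_power_1 inner_commute)
    ultimately show ?thesis by (simp add: has_vector_derivative_def)
  qed
  ultimately show "v \<in> tangent_space (sphere 0 1) x"
    unfolding tangent_space_def
    by (intro CollectI exI[of _ 1] conjI exI[of _ "\<lambda>t. N.G (?l t)"]) auto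
qed


section \<open>Minimality of graphs and of Lawson-Osserman spheres\<close>

text \<open>Normalising the orthogonal images \<open>X' x v\<close> turns the trace into a sum with
  weights \<open>1 / w v\<close>, free of square roots. \<open>T\<close> is allowed to be a proper
  subspace because \<open>X'\<close> may kill directions.\<close>

theorem (in parametrised) mean_curvature_vector_eq_0_iff_weighted:
  assumes x: "x \<in> U" "pr (X x) = x" and N: "subspace (tangent_space N (X x))"
    and B: "span B = T" "range (X' x) = X' x ` T"
    and w: "\<And>v. v \<in> B \<Longrightarrow> w v > 0"
      "\<And>u v. u \<in> B \<Longrightarrow> v \<in> B \<Longrightarrow> X' x u \<bullet> X' x v = (if u = v then w v else 0)"
    and pr: "\<And>v. v \<in> B \<Longrightarrow> pr (X' x v) = v"
  shows "mean_curvature_vector N (X ` U) (X x) = 0 \<longleftrightarrow>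
    (\<forall>\<nu>\<in>normal_space N (X ` U) (X x). (\<Sum>v\<in>B. (1 / w v) *\<^sub>R X'' x v v) \<bullet> \<nu> = 0)"
proof -
  let ?g = "\<lambda>v. (1 / sqrt (w v)) *\<^sub>R X' x v"
  note sc = orthonormal_basis_scaled_image[OF bounded_linear.linear[OF linear_X'[OF x(1)]] B(1) w, unfolded B(2)[symmetric]]
  have E: "orthonormal_basis_of (tangent_space (X ` U) (X x)) (?g ` B)"
    unfolding tangent_space_eq[OF x] by (rule sc(1))
  have "X'' x (pr (?g v)) (pr (?g v)) = (1 / w v) *\<^sub>R X'' x v v" if v: "v \<in> B" for v
  proof -
    have "pr (?g v) = (1 / sqrt (w v)) *\<^sub>R v"
      using linear_cmul[OF bounded_linear.linear[OF linear_pr]] pr[OF v] by simp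
    moreover have "X'' x (a *\<^sub>R v) (a *\<^sub>R v) = (a * a) *\<^sub>R X'' x v v" for a
      using linear_cmul[OF linear_X''_left[OF x(1)]] linear_cmul[OF bounded_linear.linear[OF linear_X''[OF x(1)]]]
      by simp
    moreover have "(1 / sqrt (w v)) * (1 / sqrt (w v)) = 1 / w v" using w(1)[OF v] by simp
    ultimately show ?thesis by simp
  qed
  then have "(\<Sum>e\<in>?g ` B. X'' x (pr e) (pr e)) = (\<Sum>v\<in>B. (1 / w v) *\<^sub>R X'' x v v)"
    by (subst sum.reindex[OF sc(2)]) (auto intro!: sum.cong)
  then show ?thesis using mean_curvature_vector_eq_0_iff[OF x N E] by simp
qed

text \<open>The shear that subtracts \<open>F x\<close> from the second component flattens the whole
  graph, so a single chart suffices.\<close>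

lemma smooth_submanifold_graph:
  fixes F :: "'a::euclidean_space \<Rightarrow> 'b::euclidean_space"
  assumes U: "open U" and F: "smooth_on U F"
  shows "smooth_submanifold DIM('a) ((\<lambda>x. (x, F x)) ` U)"
  unfolding smooth_submanifold_def
proof
  fix z assume z: "z \<in> (\<lambda>x. (x, F x)) ` U"
  define V :: "('a \<times> 'b) set" where "V = U \<times> UNIV"
  define L :: "('a \<times> 'b) set" where "L = range (\<lambda>x. (x, 0))"
  define \<Phi> \<Psi> where "\<Phi> z = (fst z, snd z + (- 1) *\<^sub>R F (fst z))" and "\<Psi> z = (fst z, snd z + F (fst z))" for z
  have V: "open V" unfolding V_def using U by (intro open_Times) auto
  have sF: "smooth_on V (\<lambda>z. F (fst z))"
    by (rule smooth_on_linear_arg[OF bounded_linear_fst V _ F]) (auto simp: V_def)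
  have "smooth_on V (\<lambda>z. (- 1) *\<^sub>R F (fst z))"
    by (rule smooth_on_linear_image[OF bounded_linear_scaleR_right V sF])
  then have s\<Phi>: "smooth_on V \<Phi>" unfolding \<Phi>_def[abs_def]
    by (rule smooth_on_Pair[OF V smooth_on_bounded_linear[OF bounded_linear_fst]
          smooth_on_add[OF V smooth_on_bounded_linear[OF bounded_linear_snd]]])
  have s\<Psi>: "smooth_on V \<Psi>" unfolding \<Psi>_def[abs_def]
    by (rule smooth_on_Pair[OF V smooth_on_bounded_linear[OF bounded_linear_fst]
          smooth_on_add[OF V smooth_on_bounded_linear[OF bounded_linear_snd] sF]])
  have hom: "homeomorphism V V \<Phi> \<Psi>"
    by (rule homeomorphismI[OF smooth_on_imp_continuous_on[OF s\<Phi>] smooth_on_imp_continuous_on[OF s\<Psi>]])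
      (auto simp: V_def \<Phi>_def \<Psi>_def)
  have lin: "linear (\<lambda>x. (x, 0 :: 'b))" by (rule linearI) auto
  have subL: "subspace L" unfolding L_def by (rule linear_subspace_image[OF lin subspace_UNIV])
  have dimL: "dim L = DIM('a)"
    unfolding L_def using dim_image_eq[OF lin, of UNIV] by (simp add: inj_on_def dim_UNIV)
  have "\<Phi> ` (V \<inter> (\<lambda>x. (x, F x)) ` U) = V \<inter> L"
  proof (rule subset_antisym; rule subsetI)
    fix y assume "y \<in> \<Phi> ` (V \<inter> (\<lambda>x. (x, F x)) ` U)"
    then show "y \<in> V \<inter> L" by (auto simp: \<Phi>_def V_def L_def)
  next
    fix y assume "y \<in> V \<inter> L"
    then obtain x where x: "x \<in> U" "y = (x, 0)" by (auto simp: V_def L_def)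
    then have "y = \<Phi> (x, F x)" by (simp add: \<Phi>_def)
    then show "y \<in> \<Phi> ` (V \<inter> (\<lambda>x. (x, F x)) ` U)" using x by (auto simp: V_def)
  qed
  moreover have "z \<in> V" using z by (auto simp: V_def)
  ultimately show "\<exists>U' V \<Phi> \<Psi> L. open U' \<and> z \<in> U' \<and> open V \<and> homeomorphism U' V \<Phi> \<Psi> \<and>
        smooth_on U' \<Phi> \<and> smooth_on V \<Psi> \<and> subspace (L :: ('a \<times> 'b) set) \<and> dim L = DIM('a) \<and>
        \<Phi> ` (U' \<inter> (\<lambda>x. (x, F x)) ` U) = V \<inter> L"
    using V hom s\<Phi> s\<Psi> subL dimL by blast
qed

section \<open>Hessian traces of harmonic sphere maps\<close>

locale harmonic_sphere_map = homogeneous_sphere_map P k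
  for P :: "'a::euclidean_space \<Rightarrow> 'b::euclidean_space" and k +
  assumes polynomial: "b \<in> Basis \<Longrightarrow> real_polynomial_function (\<lambda>x. P x \<bullet> b)"
    and harmonic: "(\<Sum>b\<in>Basis. D2P x b b) = 0"
begin

text \<open>The data that the singular value decomposition of the differential at a point \<open>x\<close> of the
  sphere provides: \<open>B\<close> spans the singular space of \<open>s\<close>, \<open>C\<close> the kernel.\<close>

definition singular_bases :: "nat \<Rightarrow> nat \<Rightarrow> real \<Rightarrow> 'a \<Rightarrow> 'a set \<Rightarrow> 'a set \<Rightarrow> bool" where
  "singular_bases n p s x B C \<longleftrightarrow> orthonormal_basis_of {v. v \<bullet> x = 0} (B \<union> C) \<and> B \<inter> C = {} \<and>
    card B = p \<and> card (B \<union> C) = n \<and>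
    (\<forall>v\<in>B. \<forall>u. u \<bullet> x = 0 \<longrightarrow> DP x v \<bullet> DP x u = s\<^sup>2 * (v \<bullet> u)) \<and> (\<forall>v\<in>C. DP x v = 0)"

lemma singular_basesD:
  assumes "singular_bases n p s x B C"
  shows "orthonormal_basis_of {v. v \<bullet> x = 0} (B \<union> C)" "B \<inter> C = {}" "card B = p" "card C + p = n"
    "finite B" "finite C" "\<And>v. v \<in> B \<union> C \<Longrightarrow> v \<bullet> x = 0"
    "\<And>u v. u \<in> B \<union> C \<Longrightarrow> v \<in> B \<union> C \<Longrightarrow> u \<bullet> v = (if u = v then 1 else 0)"
    "\<And>v u. v \<in> B \<Longrightarrow> u \<bullet> x = 0 \<Longrightarrow> DP x v \<bullet> DP x u = s\<^sup>2 * (v \<bullet> u)" "\<And>v. v \<in> C \<Longrightarrow> DP x v = 0"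
proof -
  show o: "orthonormal_basis_of {v. v \<bullet> x = 0} (B \<union> C)" and d: "B \<inter> C = {}" and cB: "card B = p"
    and "\<And>v u. v \<in> B \<Longrightarrow> u \<bullet> x = 0 \<Longrightarrow> DP x v \<bullet> DP x u = s\<^sup>2 * (v \<bullet> u)" "\<And>v. v \<in> C \<Longrightarrow> DP x v = 0"
    using assms unfolding singular_bases_def by blast+
  show f: "finite B" "finite C" using orthonormal_basis_of_finite[OF o] by auto
  have "card (B \<union> C) = n" using assms unfolding singular_bases_def by blast
  then show "card C + p = n" using card_Un_disjoint[OF f d] cB by simp
  show "v \<bullet> x = 0" if "v \<in> B \<union> C" for v using o that unfolding orthonormal_basis_of_def by blast
  show "u \<bullet> v = (if u = v then 1 else 0)" if "u \<in> B \<union> C" "v \<in> B \<union> C" for u v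
    by (rule orthonormal_basis_of_inner[OF o that])
qed

lemma DP_singular_bases:
  assumes s: "singular_bases n p s x B C" and "u \<in> B \<union> C" "v \<in> B \<union> C"
  shows "DP x u \<bullet> DP x v = (if u = v \<and> v \<in> B then s\<^sup>2 else 0)"
proof -
  note d = singular_basesD[OF s]
  show ?thesis
  proof (cases "u \<in> B")
    case True
    then show ?thesis using d(9)[OF True d(7)[OF assms(3)]] d(8)[OF assms(2,3)] by auto
  next
    case False
    then show ?thesis using d(10)[of u] assms(2) by auto
  qed
qed

lemma orthonormal_basis_UNIV_insert:
  assumes x: "norm x = 1" and s: "singular_bases n p s x B C"
  shows "orthonormal_basis_of UNIV (insert x (B \<union> C))" and "x \<notin> B \<union> C"
proof -
  have ox: "orthonormal_basis_of (span {x}) {x}"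
    unfolding orthonormal_basis_of_def using x by (simp add: span_superset)
  have o: "u \<bullet> v = 0" if "u \<in> span {x}" "v \<in> {v. v \<bullet> x = 0}" for u v
    using that by (auto simp: span_singleton inner_commute)
  have dec: "\<exists>u\<in>span {x}. v - u \<in> {v. v \<bullet> x = 0}" for v
    by (rule bexI[of _ "(v \<bullet> x) *\<^sub>R x"])
      (use x in \<open>simp_all add: inner_diff_left norm_eq_1 span_base span_scale\<close>)
  note un = orthonormal_basis_of_Un[OF ox singular_basesD(1)[OF s] o subspace_UNIV subset_UNIV subset_UNIV dec]
  show "orthonormal_basis_of UNIV (insert x (B \<union> C))" using un(1) by simp
  show "x \<notin> B \<union> C" using un(2) by auto
qed

text \<open>The Laplacian of \<open>P\<close>, evaluated in an orthonormal basis adapted to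
  \<open>x\<close>, with the radial entry given by Euler's relation.\<close>

lemma sum_D2P:
  assumes x: "norm x = 1" and s: "singular_bases n p s x B C"
  shows "(real k * real (k - 1)) *\<^sub>R P x + (\<Sum>v\<in>B. D2P x v v) + (\<Sum>v\<in>C. D2P x v v) = 0"
proof -
  note d = singular_basesD[OF s] and ins = orthonormal_basis_UNIV_insert[OF x s]
  have Basis: "orthonormal_basis_of UNIV (Basis :: 'a set)"
    unfolding orthonormal_basis_of_def
    by (auto simp: span_Basis pairwise_def orthogonal_def inner_Basis)
  have "0 = (\<Sum>b\<in>Basis. D2P x b b)" using harmonic by simp
  also have "\<dots> = (\<Sum>b\<in>insert x (B \<union> C). D2P x b b)"
    by (rule trace_orthonormal_bases[OF Basis ins(1) linear_D2P_left linear_D2P])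
  also have "\<dots> = D2P x x x + ((\<Sum>v\<in>B. D2P x v v) + (\<Sum>v\<in>C. D2P x v v))"
    using ins(2) d by (simp add: sum.union_disjoint)
  finally show ?thesis using D2P_ray[of 1 x] by (simp add: add.assoc)
qed

text \<open>By \<open>DP_inner_self\<close> the component along \<open>P x\<close> is
  \<open>k\<close> minus the squared stretching, which is \<open>s^2\<close> on \<open>B\<close> and
  0 on \<open>C\<close>.\<close>

lemma P_inner_sum_D2P:
  assumes x: "norm x = 1" and s: "singular_bases n p s x B C"
  shows "P x \<bullet> (\<Sum>v\<in>B. D2P x v v) = real p * (real k - s\<^sup>2)"
    and "P x \<bullet> (\<Sum>v\<in>C. D2P x v v) = real (card C) * real k"
proof -
  note d = singular_basesD[OF s]
  have e: "P x \<bullet> D2P x v v = real k - (if v \<in> B then s\<^sup>2 else 0)" if "v \<in> B \<union> C" for v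
    using DP_inner_self[OF x d(7)[OF that]] d(8)[OF that that] DP_singular_bases[OF s that that] by simp
  show "P x \<bullet> (\<Sum>v\<in>B. D2P x v v) = real p * (real k - s\<^sup>2)"
    unfolding inner_sum_right using e d(3) by simp
  have "P x \<bullet> D2P x v v = real k" if "v \<in> C" for v
    using e[of v] that d(2) by (auto split: if_splits)
  then show "P x \<bullet> (\<Sum>v\<in>C. D2P x v v) = real (card C) * real k"
    unfolding inner_sum_right by simp
qed

text \<open>Pair the adapted form of harmonicity with the unit vector \<open>P x\<close>.\<close>

lemma singular_value_formula:
  assumes x: "norm x = 1" and s: "singular_bases n p s x B C"
  shows "real p * s\<^sup>2 = real k * (real k + real n - 1)"
proof -
  have "P x \<bullet> ((real k * real (k - 1)) *\<^sub>R P x + (\<Sum>v\<in>B. D2P x v v) + (\<Sum>v\<in>C. D2P x v v)) = 0"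
    unfolding sum_D2P[OF x s] by simp
  then have "real k * real (k - 1) + real p * (real k - s\<^sup>2) + real (card C) * real k = 0"
    using P_inner_sum_D2P[OF x s] unit[OF x] by (simp add: inner_add_right norm_eq_1)
  moreover have "real (card C) = real n - real p" using singular_basesD(4)[OF s] by linarith
  ultimately show ?thesis using k2 by (simp add: of_nat_diff algebra_simps)
qed

text \<open>With \<open>c\<close> and \<open>\<sigma>\<close> the cosine and sine of the angle, both
  components are extended with degree 0 of homogeneity; the punctured space then covers
  \<open>M_graph\<close> without charts.\<close>

definition sphere_param :: "real \<Rightarrow> real \<Rightarrow> 'a \<Rightarrow> 'a \<times> 'b" where
  "sphere_param c \<sigma> y = (c *\<^sub>R radial_multiple.G (inv_norm_power 1) (\<lambda>x. x) y,
     \<sigma> *\<^sub>R radial_multiple.G (inv_norm_power k) P y)"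

lemma sphere_param_eq:
  assumes "y \<noteq> 0"
  shows "sphere_param c \<sigma> y = (c *\<^sub>R ((1 / norm y) *\<^sub>R y), \<sigma> *\<^sub>R P ((1 / norm y) *\<^sub>R y))"
proof -
  interpret N: radial_multiple "UNIV - {0}" "{0<..}" "inv_norm_power 1" "\<lambda>x. x :: 'a" "\<lambda>_ v. v" "\<lambda>_ _ _. 0"
    by (rule radial_multiple_id)
  interpret M: radial_multiple "UNIV - {0}" "{0<..}" "inv_norm_power k" P DP D2P
    by unfold_locales (auto simp: analytic_inv_norm_power intro: smooth P_has_derivative DP_has_derivative)
  show ?thesis
    unfolding sphere_param_def N.G_def M.G_def hom inv_norm_power_inner[OF assms] by simp
qed

text \<open>Minimality in the sphere splits the harmonicity of \<open>P\<close> into two separate equations, on the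
  singular space and on the kernel of the differential.\<close>

theorem sum_D2P_of_minimal:
  assumes x: "norm x = 1" and sb: "singular_bases n p s x B C" and s: "s \<noteq> 0"
    and c: "c > 0" "\<sigma> > 0" "c\<^sup>2 + \<sigma>\<^sup>2 = 1"
    and minimal: "mean_curvature_vector (sphere 0 1) (sphere_param c \<sigma> ` (UNIV - {0})) (sphere_param c \<sigma> x) = 0"
  shows "(\<Sum>v\<in>B. D2P x v v) = (real p * (real k - s\<^sup>2)) *\<^sub>R P x"
    and "(\<Sum>v\<in>C. D2P x v v) = (real (card C) * real k) *\<^sub>R P x"
proof -
  note d = singular_basesD[OF sb]
  interpret N: radial_multiple "UNIV - {0}" "{0<..}" "inv_norm_power 1" "\<lambda>x. x :: 'a" "\<lambda>_ v. v" "\<lambda>_ _ _. 0"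
    by (rule radial_multiple_id)
  interpret M: radial_multiple "UNIV - {0}" "{0<..}" "inv_norm_power k" P DP D2P
    by unfold_locales (auto simp: analytic_inv_norm_power intro: smooth P_has_derivative DP_has_derivative)
  let ?X = "sphere_param c \<sigma>" and ?U = "UNIV - {0 :: 'a}"
  let ?X' = "\<lambda>y v. (c *\<^sub>R N.G' y v, \<sigma> *\<^sub>R M.G' y v)"
  let ?X'' = "\<lambda>y u v. (c *\<^sub>R N.G'' y u v, \<sigma> *\<^sub>R M.G'' y u v)"
  \<comment> \<open>On the image the first component is \<open>c\<close> times a unit vector, so
    this returns the representative on the sphere.\<close>
  let ?pr = "\<lambda>z :: 'a \<times> 'b. (1 / c) *\<^sub>R fst z"
  interpret X: parametrised ?U ?X ?X' ?X'' ?pr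
  proof (rule parametrised.intro)
    show "smooth_on ?U ?X" unfolding sphere_param_def[abs_def]
      by (intro smooth_on_Pair smooth_on_linear_image[OF bounded_linear_scaleR_right] N.smooth_G M.smooth_G) auto
    show "(?X has_derivative ?X' y) (at y)" if "y \<in> ?U" for y unfolding sphere_param_def[abs_def]
      by (intro has_derivative_Pair has_derivative_scaleR_right N.G_has_derivative M.G_has_derivative that)
    show "((\<lambda>y. ?X' y u) has_derivative ?X'' y u) (at y)" if "y \<in> ?U" for y u
      by (intro has_derivative_Pair has_derivative_scaleR_right N.G'_has_derivative M.G'_has_derivative that)
    show "bounded_linear ?pr"
      by (intro bounded_linear_compose[OF bounded_linear_scaleR_right bounded_linear_fst])
    show "?pr (?X y) \<in> ?U" if "y \<in> ?U" for y using that c by (simp add: sphere_param_eq)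
    show "?X (?pr (?X y)) = ?X y" if "y \<in> ?U" for y using that c by (simp add: sphere_param_eq)
  qed auto
  have xU: "x \<in> ?U" using x by auto
  have xx: "x \<bullet> x = 1" using x by (simp add: norm_eq_1)
  have Xx: "?X x = (c *\<^sub>R x, \<sigma> *\<^sub>R P x)" using sphere_param_eq[of x c \<sigma>] xU x by simp
  have prx: "?pr (?X x) = x" using c by (simp add: Xx)
  have PP: "P x \<bullet> P x = 1" using unit[OF x] by (simp add: norm_eq_1)
  have nX: "norm (?X x) = 1"
    using c(3) by (simp add: norm_eq_1 Xx xx PP power2_eq_square)
  have TN: "tangent_space (sphere 0 1) (?X x) = {v. v \<bullet> ?X x = 0}" by (rule tangent_space_sphere[OF nX])
  have sTN: "subspace (tangent_space (sphere 0 1) (?X x))"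
    unfolding TN by (auto simp: subspace_def inner_add_left)
  have X't: "?X' x v = (c *\<^sub>R v, \<sigma> *\<^sub>R DP x v)" if "v \<bullet> x = 0" for v
    using that xx unfolding N.G'_def M.G'_def
    by (simp add: inv_norm_power_1[unfolded One_nat_def] inner_commute inv_norm_power_1)
  have X'x: "?X' x x = 0"
    using xx DP_ray[of 1 x] unfolding N.G'_def M.G'_def
    by (simp add: inv_norm_power_1 deriv_inv_norm_power_1 scaleR_left_distrib[symmetric] zero_prod_def del: One_nat_def)
  have X''t: "?X'' x v v = (- (c * (v \<bullet> v)) *\<^sub>R x, \<sigma> *\<^sub>R (D2P x v v - (real k * (v \<bullet> v)) *\<^sub>R P x))" if "v \<bullet> x = 0" for v
    using that xx unfolding N.G''_def M.G''_def
    by (simp add: inv_norm_power_1 deriv_inv_norm_power_1 inner_commute scaleR_minus_left del: One_nat_def)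
  have T: "span (B \<union> C) = {v. v \<bullet> x = 0}" using d(1) unfolding orthonormal_basis_of_def by blast
  note lin = bounded_linear.linear[OF X.linear_X'[OF xU]]
  have rng: "range (?X' x) = ?X' x ` {v. v \<bullet> x = 0}"
  proof (rule subset_antisym; rule subsetI)
    fix z assume "z \<in> range (?X' x)"
    then obtain u where u: "z = ?X' x u" by blast
    have "?X' x (u - (u \<bullet> x) *\<^sub>R x) = ?X' x u - (u \<bullet> x) *\<^sub>R ?X' x x"
      unfolding linear_diff[OF lin] linear_cmul[OF lin] ..
    then have "z = ?X' x (u - (u \<bullet> x) *\<^sub>R x)" unfolding X'x u scaleR_zero_right diff_zero by (rule sym)
    moreover have "u - (u \<bullet> x) *\<^sub>R x \<in> {v. v \<bullet> x = 0}" using xx by (simp add: inner_diff_left)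
    ultimately show "z \<in> ?X' x ` {v. v \<bullet> x = 0}" by (rule image_eqI)
  qed auto
  \<comment> \<open>Squared lengths of the tangent vectors \<open>?X' x v\<close>; they exceed the
    square of \<open>c\<close> exactly on the stretched directions.\<close>
  define w where "w v = (if v \<in> B then c\<^sup>2 + \<sigma>\<^sup>2 * s\<^sup>2 else c\<^sup>2)" for v
  have w0: "w v > 0" for v using c s by (simp add: w_def add_pos_nonneg)
  have ww: "?X' x u \<bullet> ?X' x v = (if u = v then w v else 0)" if "u \<in> B \<union> C" "v \<in> B \<union> C" for u v
    unfolding X't[OF d(7)[OF that(1)]] X't[OF d(7)[OF that(2)]]
    using d(8)[OF that] DP_singular_bases[OF sb that] by (auto simp: w_def power2_eq_square)
  have prX': "?pr (?X' x v) = v" if "v \<in> B \<union> C" for v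
    unfolding X't[OF d(7)[OF that]] using c by simp
  define a where "a = (\<Sum>v\<in>B \<union> C. 1 / w v)"
  define Y where "Y = (\<Sum>v\<in>B \<union> C. (1 / w v) *\<^sub>R (D2P x v v - real k *\<^sub>R P x))"
  have Z: "(\<Sum>v\<in>B \<union> C. (1 / w v) *\<^sub>R ?X'' x v v) = (- (c * a) *\<^sub>R x, \<sigma> *\<^sub>R Y)"
  proof -
    have "(1 / w v) *\<^sub>R ?X'' x v v = ((- c * (1 / w v)) *\<^sub>R x, \<sigma> *\<^sub>R ((1 / w v) *\<^sub>R (D2P x v v - real k *\<^sub>R P x)))" if "v \<in> B \<union> C" for v
      unfolding X''t[OF d(7)[OF that]] using d(8)[OF that that] by (simp add: mult.commute)
    then have "(\<Sum>v\<in>B \<union> C. (1 / w v) *\<^sub>R ?X'' x v v) =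
        (\<Sum>v\<in>B \<union> C. ((- c * (1 / w v)) *\<^sub>R x, \<sigma> *\<^sub>R ((1 / w v) *\<^sub>R (D2P x v v - real k *\<^sub>R P x))))"
      by (rule sum.cong[OF refl])
    also have "\<dots> = (- (c * a) *\<^sub>R x, \<sigma> *\<^sub>R Y)"
      unfolding sum_prod a_def Y_def scaleR_sum_right sum_distrib_left sum_negf[symmetric] scaleR_sum_left by simp
    finally show ?thesis .
  qed
  have crit: "(- (c * a) *\<^sub>R x, \<sigma> *\<^sub>R Y) \<bullet> \<nu> = 0"
    if "\<nu> \<in> normal_space (sphere 0 1) (?X ` ?U) (?X x)" for \<nu>
    using X.mean_curvature_vector_eq_0_iff_weighted[OF xU prx sTN T rng w0 ww prX'] minimal that
    unfolding Z by blast
  have Y: "Y = - a *\<^sub>R P x"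
  proof -
    have "(Y + a *\<^sub>R P x) \<bullet> \<eta> = 0" for \<eta>
    proof -
      \<comment> \<open>For any \<open>\<eta>\<close>, the adjoint of the tangential differential
        together with a radial correction yields a first component that makes \<open>\<nu>\<close>
        normal. So \<open>\<eta>\<close> is arbitrary in the criticality equation.\<close>
      define \<xi> where "\<xi> = (\<Sum>v\<in>B \<union> C. (DP x v \<bullet> \<eta>) *\<^sub>R v) + (P x \<bullet> \<eta>) *\<^sub>R x"
      define \<nu> where "\<nu> = ((- \<sigma> / c) *\<^sub>R \<xi>, \<eta>)"
      have x\<xi>: "x \<bullet> \<xi> = P x \<bullet> \<eta>"
        unfolding \<xi>_def inner_add_right inner_sum_right using d(7) xx by (simp add: inner_commute)
      have u\<xi>: "u \<bullet> \<xi> = DP x u \<bullet> \<eta>" if u: "u \<bullet> x = 0" for u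
      proof -
        have e: "u = (\<Sum>v\<in>B \<union> C. (u \<bullet> v) *\<^sub>R v)"
          by (rule orthonormal_basis_of_expand[OF d(1)]) (use u in simp)
        have "DP x u = (\<Sum>v\<in>B \<union> C. (u \<bullet> v) *\<^sub>R DP x v)"
          by (subst e) (simp add: linear_sum[OF linear_DP] linear_cmul[OF linear_DP])
        then show ?thesis using u unfolding \<xi>_def inner_add_right inner_sum_right
          by (simp add: inner_sum_left mult.commute)
      qed
      have "\<nu> \<in> normal_space (sphere 0 1) (?X ` ?U) (?X x)"
        unfolding normal_space_def TN X.tangent_space_eq[OF xU prx] rng
      proof (intro CollectI conjI ballI)
        show "\<nu> \<bullet> ?X x = 0"
          using c x\<xi> by (simp add: \<nu>_def Xx inner_commute)
        fix z assume "z \<in> ?X' x ` {v. v \<bullet> x = 0}"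
        then obtain u where "z = ?X' x u" "u \<bullet> x = 0" by blast
        then show "\<nu> \<bullet> z = 0" using X't[of u] u\<xi>[of u] c by (simp add: \<nu>_def inner_commute)
      qed
      from crit[OF this] have "\<sigma> * (a * (P x \<bullet> \<eta>) + Y \<bullet> \<eta>) = 0"
        using c x\<xi> by (simp add: \<nu>_def distrib_left)
      then show ?thesis using c by (simp add: inner_add_left add.commute)
    qed
    then have "Y + a *\<^sub>R P x = 0" by (metis inner_eq_zero_iff)
    then show ?thesis by (simp add: eq_neg_iff_add_eq_0)
  qed
  define w1 where "w1 = c\<^sup>2 + \<sigma>\<^sup>2 * s\<^sup>2"
  define A1 A0 where "A1 = (\<Sum>v\<in>B. D2P x v v)" and "A0 = (\<Sum>v\<in>C. D2P x v v)"
  have Cw: "w v = c\<^sup>2" if "v \<in> C" for v using that d(2) by (auto simp: w_def)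
  have "Y = (\<Sum>v\<in>B. (1 / w v) *\<^sub>R (D2P x v v - real k *\<^sub>R P x)) + (\<Sum>v\<in>C. (1 / w v) *\<^sub>R (D2P x v v - real k *\<^sub>R P x))"
    unfolding Y_def using d(2,5,6) by (simp add: sum.union_disjoint)
  also have "(\<Sum>v\<in>B. (1 / w v) *\<^sub>R (D2P x v v - real k *\<^sub>R P x)) = (1 / w1) *\<^sub>R (A1 - (real p * real k) *\<^sub>R P x)"
    unfolding A1_def d(3)[symmetric] by (simp add: w_def w1_def sum_subtractf scaleR_sum_right[symmetric] sum_constant_scaleR)
  also have "(\<Sum>v\<in>C. (1 / w v) *\<^sub>R (D2P x v v - real k *\<^sub>R P x)) = (1 / c\<^sup>2) *\<^sub>R (A0 - (real (card C) * real k) *\<^sub>R P x)"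
    unfolding A0_def by (simp add: Cw sum_subtractf scaleR_sum_right[symmetric] sum_constant_scaleR)
  finally have Yeq: "(1 / w1) *\<^sub>R (A1 - (real p * real k) *\<^sub>R P x) + (1 / c\<^sup>2) *\<^sub>R (A0 - (real (card C) * real k) *\<^sub>R P x) = - a *\<^sub>R P x"
    unfolding Y by simp
  have A0: "A0 = - (real k * real (k - 1)) *\<^sub>R P x - A1"
    using sum_D2P[OF x sb] unfolding A1_def A0_def add_eq_0_iff by simp
  \<comment> \<open>Harmonicity makes \<open>A0 + A1\<close> a multiple of \<open>P x\<close>,
    minimality does the same for \<open>A1\<close> and \<open>A0\<close> with weights
    \<open>1 / w1\<close> and \<open>1 / c^2\<close>. These weights differ, so each of
    \<open>A0\<close> and \<open>A1\<close> is a multiple of \<open>P x\<close>.\<close>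
  define g where "g = 1 / w1 - 1 / c\<^sup>2"
  have g: "g \<noteq> 0"
    using c s by (simp add: g_def w1_def divide_eq_eq)
  have "\<exists>\<mu>. g *\<^sub>R A1 = \<mu> *\<^sub>R P x"
  proof
    show "g *\<^sub>R A1 = (- a + (real p * real k) / w1 + (real k * real (k - 1) + real (card C) * real k) / c\<^sup>2) *\<^sub>R P x"
      using Yeq unfolding A0 g_def by (simp add: algebra_simps add_divide_distrib)
  qed
  then obtain \<mu> where "g *\<^sub>R A1 = \<mu> *\<^sub>R P x" by blast
  then have "g *\<^sub>R A1 = g *\<^sub>R ((\<mu> / g) *\<^sub>R P x)" using g by simp
  then have A1: "A1 = (\<mu> / g) *\<^sub>R P x" by (rule scaleR_left_imp_eq[OF g])
  \<comment> \<open>For a vector parallel to the unit vector \<open>P x\<close> the factor is its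
    inner product with \<open>P x\<close>, already computed.\<close>
  have multiple: "A = (P x \<bullet> A) *\<^sub>R P x" if "A = t *\<^sub>R P x" for A t
    using that PP by simp
  note ip = P_inner_sum_D2P[OF x sb, folded A1_def A0_def]
  show "(\<Sum>v\<in>B. D2P x v v) = (real p * (real k - s\<^sup>2)) *\<^sub>R P x"
    using multiple[OF A1] ip(1) unfolding A1_def by simp
  have "A0 = (- (real k * real (k - 1)) - \<mu> / g) *\<^sub>R P x" unfolding A0 A1 by (simp add: scaleR_left_diff_distrib)
  from multiple[OF this] show "(\<Sum>v\<in>C. D2P x v v) = (real (card C) * real k) *\<^sub>R P x"
    using ip(2) unfolding A0_def by simp
qed

end


section \<open>The minimal surface system for radial multiples\<close>

context harmonic_sphere_map
begin

text \<open>Differentiates \<open>K (exp (2 * \<tau>)) = exp (- \<kappa> * \<tau>) * \<phi>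
  \<tau>\<close> once and twice in \<open>\<tau>\<close>, which trades derivatives of
  \<open>K\<close> at the squared radius for \<open>\<phi>\<close>, \<open>\<psi>\<close> and the
  field.\<close>

lemma profile_derivatives:
  assumes K: "analytic_real {0..<u1} K" and field: "\<And>\<tau>. exp (2 * \<tau>) < u1 \<Longrightarrow>
      K (exp (2 * \<tau>)) = exp (- \<kappa> * \<tau>) * \<phi> \<tau> \<and> (\<phi> has_real_derivative \<psi> \<tau>) (at \<tau>) \<and>
      (\<psi> has_real_derivative f \<tau>) (at \<tau>)"
    and \<tau>: "exp (2 * \<tau>) < u1"
  shows "2 * exp (2 * \<tau>) * deriv K (exp (2 * \<tau>)) = exp (- \<kappa> * \<tau>) * (\<psi> \<tau> - \<kappa> * \<phi> \<tau>)"
    and "4 * (exp (2 * \<tau>))\<^sup>2 * deriv (deriv K) (exp (2 * \<tau>)) + 4 * exp (2 * \<tau>) * deriv K (exp (2 * \<tau>)) =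
      exp (- \<kappa> * \<tau>) * (f \<tau> - 2 * \<kappa> * \<psi> \<tau> + \<kappa>\<^sup>2 * \<phi> \<tau>)"
proof -
  define S where "S = {\<tau>. exp (2 * \<tau>) < u1}"
  have S: "open S" unfolding S_def by (intro open_Collect_less continuous_intros)
  have e: "((\<lambda>t. exp (2 * t)) has_real_derivative 2 * exp (2 * t)) (at t)" for t :: real
    by (auto intro!: derivative_eq_intros)
  have first: "2 * exp (2 * t) * deriv K (exp (2 * t)) = exp (- \<kappa> * t) * (\<psi> t - \<kappa> * \<phi> t)" if t: "t \<in> S" for t
  proof -
    have m: "exp (2 * t) \<in> {0..<u1}" using t by (simp add: S_def)
    have "((\<lambda>t. K (exp (2 * t))) has_real_derivative deriv K (exp (2 * t)) * (2 * exp (2 * t))) (at t)"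
      by (rule DERIV_chain2[OF analytic_real_has_derivative[OF K m] e])
    then have a: "((\<lambda>t. exp (- \<kappa> * t) * \<phi> t) has_real_derivative deriv K (exp (2 * t)) * (2 * exp (2 * t))) (at t)"
      by (rule has_field_derivative_transform_within_open[OF _ S t]) (use field in \<open>simp add: S_def\<close>)
    have "((\<lambda>t. exp (- \<kappa> * t) * \<phi> t) has_real_derivative exp (- \<kappa> * t) * (\<psi> t - \<kappa> * \<phi> t)) (at t)"
      using field[of t] t by (auto intro!: derivative_eq_intros simp: S_def algebra_simps)
    from DERIV_unique[OF a this] show ?thesis by (simp add: mult_ac)
  qed
  have \<tau>S: "\<tau> \<in> S" using \<tau> by (simp add: S_def)
  show "2 * exp (2 * \<tau>) * deriv K (exp (2 * \<tau>)) = exp (- \<kappa> * \<tau>) * (\<psi> \<tau> - \<kappa> * \<phi> \<tau>)"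
    by (rule first[OF \<tau>S])
  have m: "exp (2 * \<tau>) \<in> {0..<u1}" using \<tau> by simp
  have k: "((\<lambda>t. deriv K (exp (2 * t))) has_real_derivative deriv (deriv K) (exp (2 * \<tau>)) * (2 * exp (2 * \<tau>))) (at \<tau>)"
    by (rule DERIV_chain2[OF analytic_real_has_derivative[OF analytic_real_deriv[OF K] m] e])
  have "((\<lambda>t. 2 * exp (2 * t) * deriv K (exp (2 * t))) has_real_derivative
      4 * (exp (2 * \<tau>))\<^sup>2 * deriv (deriv K) (exp (2 * \<tau>)) + 4 * exp (2 * \<tau>) * deriv K (exp (2 * \<tau>))) (at \<tau>)"
    by (rule DERIV_cong[OF DERIV_mult[OF DERIV_cmult[OF e, of 2] k]]) (simp add: power2_eq_square)
  then have a: "((\<lambda>t. exp (- \<kappa> * t) * (\<psi> t - \<kappa> * \<phi> t)) has_real_derivative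
      4 * (exp (2 * \<tau>))\<^sup>2 * deriv (deriv K) (exp (2 * \<tau>)) + 4 * exp (2 * \<tau>) * deriv K (exp (2 * \<tau>))) (at \<tau>)"
    by (rule has_field_derivative_transform_within_open[OF _ S \<tau>S first])
  have "((\<lambda>t. exp (- \<kappa> * t) * (\<psi> t - \<kappa> * \<phi> t)) has_real_derivative
      exp (- \<kappa> * \<tau>) * (f \<tau> - 2 * \<kappa> * \<psi> \<tau> + \<kappa>\<^sup>2 * \<phi> \<tau>)) (at \<tau>)"
    using field[OF \<tau>] by (auto intro!: derivative_eq_intros simp: algebra_simps power2_eq_square)
  from DERIV_unique[OF a this]
  show "4 * (exp (2 * \<tau>))\<^sup>2 * deriv (deriv K) (exp (2 * \<tau>)) + 4 * exp (2 * \<tau>) * deriv K (exp (2 * \<tau>)) =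
      exp (- \<kappa> * \<tau>) * (f \<tau> - 2 * \<kappa> * \<psi> \<tau> + \<kappa>\<^sup>2 * \<phi> \<tau>)" .
qed

text \<open>The basis formed by \<open>x\<close>, \<open>B\<close> and \<open>C\<close> diagonalises
  the metric of the graph, and each group of second derivatives sums to a multiple of
  \<open>P x\<close>. The system therefore collapses to one scalar equation, the profile
  equation.\<close>

theorem minimal_radial_graph:
  assumes k3: "k \<ge> 3" 
    and sing: "\<And>x. norm x = 1 \<Longrightarrow> \<exists>B C. singular_bases n p s x B C \<and>
       (\<Sum>v\<in>B. D2P x v v) = (real p * (real k - s\<^sup>2)) *\<^sub>R P x \<and>
       (\<Sum>v\<in>C. D2P x v v) = (real (card C) * real k) *\<^sub>R P x"
    and prof: "profile_ODE (real n) (real p) (s\<^sup>2) (real k - 1)"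
    and u1: "u1 > 1" and K: "analytic_real {0..<u1} K"
    and field: "\<And>\<tau>. exp (2 * \<tau>) < u1 \<Longrightarrow>
      K (exp (2 * \<tau>)) = exp (- (real k - 1) * \<tau>) * \<phi> \<tau> \<and> (\<phi> has_real_derivative \<psi> \<tau>) (at \<tau>) \<and>
      (\<psi> has_real_derivative profile_ODE.field (real n) (real p) (s\<^sup>2) (\<phi> \<tau>) (\<psi> \<tau>)) (at \<tau>)"
  shows "minimal_submanifold DIM('a) UNIV ((\<lambda>y. (y, K (y \<bullet> y) *\<^sub>R P y)) ` ball 0 1)"
proof -
  interpret ODE: profile_ODE "real n" "real p" "s\<^sup>2" "real k - 1" by (rule prof)
  have dom: "y \<bullet> y \<in> {0..<u1}" if "y \<in> ball 0 1" for y :: 'a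
  proof -
    have "y \<bullet> y = (norm y)\<^sup>2" by (simp add: power2_norm_eq_inner)
    also have "\<dots> \<le> 1" using that by (simp add: power_le_one)
    finally show ?thesis using u1 by simp
  qed
  interpret F: radial_multiple "ball 0 1" "{0..<u1}" K P DP D2P
    by (rule radial_multiple.intro[OF open_ball dom K smooth P_has_derivative DP_has_derivative])
  let ?X = "\<lambda>y. (y, F.G y)"
  interpret X: parametrised "ball 0 1" ?X "\<lambda>y v. (v, F.G' y v)" "\<lambda>y u v. (0, F.G'' y u v)" fst
  proof (rule parametrised.intro)
    show "smooth_on (ball 0 1) ?X" by (rule smooth_on_Pair[OF open_ball smooth_on_ident F.smooth_G])
    show "(?X has_derivative (\<lambda>v. (v, F.G' y v))) (at y)" if "y \<in> ball 0 1" for y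
      by (rule has_derivative_Pair[OF has_derivative_ident F.G_has_derivative[OF that]])
    show "((\<lambda>y. (u, F.G' y u)) has_derivative (\<lambda>v. (0, F.G'' y u v))) (at y)" if "y \<in> ball 0 1" for y u
      by (rule has_derivative_Pair[OF has_derivative_const F.G'_has_derivative[OF that]])
    show "bounded_linear fst" by (rule bounded_linear_fst)
  qed auto
  have sub: "subspace (tangent_space UNIV (?X y))" for y
    by (simp add: tangent_space_UNIV)
  have H: "mean_curvature_vector UNIV (?X ` ball 0 1) (?X y) = 0" if y: "y \<in> ball 0 1" for y
  proof (cases "y = 0")
    case True
    obtain E where E: "orthonormal_basis_of (tangent_space (?X ` ball 0 1) (?X y)) E"
      using orthonormal_basis_of_exists[OF X.subspace_tangent[OF y]] by auto
    \<comment> \<open>At the centre \<open>P\<close> and its second derivatives vanish since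
      \<open>k \<ge> 3\<close>, and the other terms contain \<open>y\<close>.\<close>
    have "F.G'' y v v = 0" for v
      unfolding F.G''_def True by (simp add: D2P_0[OF k3] P_0)
    then show ?thesis
      using X.mean_curvature_vector_eq_0_iff[OF y _ sub E] by (simp add: inner_sum_left flip: zero_prod_def)
  next
    case False
    define r where "r = norm y"
    define x where "x = (1 / r) *\<^sub>R y"
    define \<tau> where "\<tau> = ln r"
    have r: "r > 0" "r < 1" using False y by (auto simp: r_def)
    have yx: "y = r *\<^sub>R x" using r by (simp add: x_def)
    have "norm x = 1" using r by (simp add: x_def r_def)
    then have x: "norm x = 1" "x \<bullet> x = 1" by (simp_all add: norm_eq_1)
    have yy: "y \<bullet> y = exp (2 * \<tau>)"
      using r by (simp add: \<tau>_def exp_double) (simp add: r_def power2_norm_eq_inner)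
    have r2: "exp (2 * \<tau>) = r\<^sup>2" using r by (simp add: \<tau>_def exp_double)
    have \<tau>: "exp (2 * \<tau>) < u1" using dom[OF y] yy by simp
    define e where "e = exp (- (real k - 1) * \<tau>)"
    have re: "r ^ (k - 1) * e = 1"
    proof -
      have "r ^ (k - 1) = exp (real (k - 1) * \<tau>)" using r by (simp add: \<tau>_def exp_of_nat_mult)
      then have "r ^ (k - 1) * e = exp ((real k - 1) * \<tau> + - (real k - 1) * \<tau>)"
        using k2 unfolding exp_add e_def by (simp add: of_nat_diff)
      also have "(real k - 1) * \<tau> + - (real k - 1) * \<tau> = 0" by (simp add: algebra_simps)
      finally show ?thesis by simp
    qed
    \<comment> \<open>\<open>e\<close> is \<open>r\<close> to the power \<open>1 - k\<close>, so
      this is \<open>1 / r\<close>: the common scale of all second derivatives.\<close>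
    define \<epsilon> where "\<epsilon> = r ^ (k - 2) * e"
    have rk: "r ^ (k - 1) = r * r ^ (k - 2)" "r ^ k = r\<^sup>2 * r ^ (k - 2)"
    proof -
      define m where "m = k - 2"
      have "k = Suc (Suc m)" using k2 by (simp add: m_def)
      then show "r ^ (k - 1) = r * r ^ (k - 2)" "r ^ k = r\<^sup>2 * r ^ (k - 2)"
        by (simp_all add: power2_eq_square)
    qed
    define a where "a = \<phi> \<tau>"
    define b where "b = \<psi> \<tau>"
    define f where "f = ODE.field a b"
    define K0 K1 K2 where "K0 = K (y \<bullet> y)" and "K1 = deriv K (y \<bullet> y)" and "K2 = deriv (deriv K) (y \<bullet> y)"
    have k0: "K0 = e * a" using field[OF \<tau>] by (simp add: K0_def yy e_def a_def)
    note pd = profile_derivatives[OF K field \<tau>]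
    have k1: "2 * r\<^sup>2 * K1 = e * (b - (real k - 1) * a)"
      using pd(1) by (simp add: K1_def yy e_def a_def b_def r2)
    have k2': "4 * (r\<^sup>2)\<^sup>2 * K2 + 4 * r\<^sup>2 * K1 = e * (f - 2 * (real k - 1) * b + (real k - 1)\<^sup>2 * a)"
      using pd(2) by (simp add: K1_def K2_def yy e_def a_def b_def f_def r2)
    have Py: "P y = r ^ k *\<^sub>R P x" unfolding yx by (rule hom)
    have DPy: "DP y v = r ^ (k - 1) *\<^sub>R DP x v" for v unfolding yx by (rule DP_scale) (use r in simp)
    have D2Py: "D2P y u v = r ^ (k - 2) *\<^sub>R D2P x u v" for u v unfolding yx by (rule D2P_scale) (use r in simp)
    have DPx: "DP x x = real k *\<^sub>R P x" using DP_ray[of 1 x] by simp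
    have D2Px: "D2P x x x = (real k * (real k - 1)) *\<^sub>R P x" using D2P_ray[of 1 x] k2 by (simp add: of_nat_diff)
    have yxx: "y \<bullet> x = r" using x by (simp add: yx)
    \<comment> \<open>The radial slope, that is the derivative of \<open>r \<phi> (log r)\<close> in
      \<open>r\<close>.\<close>
    have G'x: "F.G' y x = (a + b) *\<^sub>R P x"
    proof -
      have "F.G' y x = (K0 * r ^ (k - 1) * real k + 2 * K1 * r * r ^ k) *\<^sub>R P x"
        unfolding F.G'_def DPy DPx Py yxx K0_def K1_def by (simp add: scaleR_left_distrib)
      also have "K0 * r ^ (k - 1) * real k + 2 * K1 * r * r ^ k = r ^ (k - 1) * (K0 * real k + 2 * r\<^sup>2 * K1)"
        unfolding rk by (simp add: algebra_simps power2_eq_square)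
      also have "\<dots> = (r ^ (k - 1) * e) * (a + b)" unfolding k0 k1 by (simp add: algebra_simps)
      finally show ?thesis unfolding re by simp
    qed
    have G'v: "F.G' y v = a *\<^sub>R DP x v" if "v \<bullet> x = 0" for v
    proof -
      have "F.G' y v = (r ^ (k - 1) * e * a) *\<^sub>R DP x v"
        unfolding F.G'_def DPy K0_def[symmetric] k0 using that by (simp add: yx inner_commute mult_ac)
      then show ?thesis unfolding re by simp
    qed
    have G''x: "F.G'' y x x = (\<epsilon> * (f + b)) *\<^sub>R P x"
    proof -
      have "F.G'' y x x = (K0 * r ^ (k - 2) * (real k * (real k - 1)) + 2 * K1 * r * (r ^ (k - 1) * real k) +
          (2 * K1 * r * (r ^ (k - 1) * real k) + 2 * (2 * K2 * r * r + K1) * r ^ k)) *\<^sub>R P x"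
        unfolding F.G''_def DPy DPx Py yxx D2Py D2Px K0_def[symmetric] K1_def[symmetric] K2_def[symmetric] x(2)
        by (simp only: scaleR_left_distrib scaleR_scaleR mult_1_left mult_1_right mult_ac)
      also have "K0 * r ^ (k - 2) * (real k * (real k - 1)) + 2 * K1 * r * (r ^ (k - 1) * real k) +
          (2 * K1 * r * (r ^ (k - 1) * real k) + 2 * (2 * K2 * r * r + K1) * r ^ k) =
          r ^ (k - 2) * (K0 * (real k * (real k - 1)) + (2 * real k - 1) * (2 * r\<^sup>2 * K1) + (4 * (r\<^sup>2)\<^sup>2 * K2 + 4 * r\<^sup>2 * K1))"
        unfolding rk by (simp add: algebra_simps power2_eq_square)
      also have "\<dots> = \<epsilon> * (f + b)"
        unfolding k0 k1 k2' \<epsilon>_def by (simp add: algebra_simps power2_eq_square)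
      finally show ?thesis .
    qed
    have G''v: "F.G'' y v v = \<epsilon> *\<^sub>R (a *\<^sub>R D2P x v v + (b - (real k - 1) * a) *\<^sub>R P x)" if "v \<bullet> x = 0" "v \<bullet> v = 1" for v
    proof -
      have "F.G'' y v v = (K0 * r ^ (k - 2)) *\<^sub>R D2P x v v + (2 * K1 * r ^ k) *\<^sub>R P x"
        unfolding F.G''_def DPy Py D2Py K0_def[symmetric] K1_def[symmetric] K2_def[symmetric]
        using that by (simp add: yx inner_commute)
      also have "2 * K1 * r ^ k = r ^ (k - 2) * (2 * r\<^sup>2 * K1)" unfolding rk by simp
      finally show ?thesis unfolding k0 k1 \<epsilon>_def by (simp add: scaleR_add_right mult_ac)
    qed
    obtain B C where sb: "singular_bases n p s x B C"
      and sB: "(\<Sum>v\<in>B. D2P x v v) = (real p * (real k - s\<^sup>2)) *\<^sub>R P x"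
      and sC: "(\<Sum>v\<in>C. D2P x v v) = (real (card C) * real k) *\<^sub>R P x"
      using sing[OF x(1)] by blast
    note d = singular_basesD[OF sb] and ins = orthonormal_basis_UNIV_insert[OF x(1) sb]
    \<comment> \<open>The metric of the graph in the radial, the stretched and the unstretched
      directions.\<close>
    define w where "w v = (if v = x then 1 + (a + b)\<^sup>2 else if v \<in> B then 1 + s\<^sup>2 * a\<^sup>2 else 1)" for v
    have w0: "w v > 0" for v by (simp add: w_def add_pos_nonneg)
    have PP: "P x \<bullet> P x = 1" using unit[OF x(1)] by (simp add: norm_eq_1)
    have PDP: "P x \<bullet> DP x v = 0" if "v \<bullet> x = 0" for v
      using P_inner_DP[of x v] that by (simp add: inner_commute)
    have ww: "(u, F.G' y u) \<bullet> (v, F.G' y v) = (if u = v then w v else 0)"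
      if uv: "u \<in> insert x (B \<union> C)" "v \<in> insert x (B \<union> C)" for u v
    proof -
      have o: "u \<bullet> v = (if u = v then 1 else 0)" by (rule orthonormal_basis_of_inner[OF ins(1) uv])
      consider "u = x" "v = x" | "u = x" "v \<in> B \<union> C" | "u \<in> B \<union> C" "v = x" | "u \<in> B \<union> C" "v \<in> B \<union> C"
        using uv by blast
      then show ?thesis
      proof cases
        case 1
        then show ?thesis using x PP by (simp add: G'x w_def power2_eq_square)
      next
        case 2
        then show ?thesis using o d(7)[OF 2(2)] ins(2) by (auto simp: G'x G'v PDP)
      next
        case 3
        then show ?thesis using o d(7)[OF 3(1)] ins(2) by (auto simp: G'x G'v PDP inner_commute)
      next
        case 4
        then have "u \<noteq> x" "v \<noteq> x" using ins(2) by auto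
        then show ?thesis using o DP_singular_bases[OF sb 4]
          by (auto simp: G'v[OF d(7)[OF 4(1)]] G'v[OF d(7)[OF 4(2)]] w_def power2_eq_square)
      qed
    qed
    have T: "span (insert x (B \<union> C)) = UNIV" using ins(1) unfolding orthonormal_basis_of_def by blast
    have bterm: "(1 / w v) *\<^sub>R F.G'' y v v = (\<epsilon> / w v) *\<^sub>R (a *\<^sub>R D2P x v v + (b - (real k - 1) * a) *\<^sub>R P x)" if "v \<in> B \<union> C" for v
      unfolding G''v[OF d(7)[OF that] d(8)[OF that that, simplified]] by simp
    have wB: "w v = 1 + s\<^sup>2 * a\<^sup>2" if "v \<in> B" for v
      using that ins(2) by (auto simp: w_def)
    have wx: "w x = 1 + (a + b)\<^sup>2" by (simp add: w_def)
    have wC: "w v = 1" if "v \<in> C" for v using that ins(2) d(2) by (auto simp: w_def)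
    have SB: "(\<Sum>v\<in>B. (1 / w v) *\<^sub>R F.G'' y v v) = (\<epsilon> * (ODE.q a * (real p * (a + b - s\<^sup>2 * a)))) *\<^sub>R P x"
    proof -
      have "(\<Sum>v\<in>B. (1 / w v) *\<^sub>R F.G'' y v v) = (\<epsilon> * ODE.q a) *\<^sub>R (\<Sum>v\<in>B. a *\<^sub>R D2P x v v + (b - (real k - 1) * a) *\<^sub>R P x)"
        unfolding scaleR_sum_right
      proof (rule sum.cong[OF refl])
        fix v assume v: "v \<in> B"
        show "(1 / w v) *\<^sub>R F.G'' y v v = (\<epsilon> * ODE.q a) *\<^sub>R (a *\<^sub>R D2P x v v + (b - (real k - 1) * a) *\<^sub>R P x)"
          unfolding bterm[OF UnI1[OF v]] unfolding wB[OF v] ODE.q_def by simp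
      qed
      also have "(\<Sum>v\<in>B. a *\<^sub>R D2P x v v + (b - (real k - 1) * a) *\<^sub>R P x) = (real p * (a + b - s\<^sup>2 * a)) *\<^sub>R P x"
        unfolding sum.distrib scaleR_sum_right[symmetric] sB sum_constant_scaleR d(3)
        by (simp add: algebra_simps flip: scaleR_left_distrib)
      finally show ?thesis by (simp add: mult.assoc)
    qed
    have SC: "(\<Sum>v\<in>C. (1 / w v) *\<^sub>R F.G'' y v v) = (\<epsilon> * (real (card C) * (a + b))) *\<^sub>R P x"
    proof -
      have "(\<Sum>v\<in>C. (1 / w v) *\<^sub>R F.G'' y v v) = \<epsilon> *\<^sub>R (\<Sum>v\<in>C. a *\<^sub>R D2P x v v + (b - (real k - 1) * a) *\<^sub>R P x)"
        unfolding scaleR_sum_right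
      proof (rule sum.cong[OF refl])
        fix v assume v: "v \<in> C"
        show "(1 / w v) *\<^sub>R F.G'' y v v = \<epsilon> *\<^sub>R (a *\<^sub>R D2P x v v + (b - (real k - 1) * a) *\<^sub>R P x)"
          unfolding bterm[OF UnI2[OF v]] unfolding wC[OF v] by simp
      qed
      also have "(\<Sum>v\<in>C. a *\<^sub>R D2P x v v + (b - (real k - 1) * a) *\<^sub>R P x) = (real (card C) * (a + b)) *\<^sub>R P x"
        unfolding sum.distrib scaleR_sum_right[symmetric] sC sum_constant_scaleR
        by (simp add: algebra_simps flip: scaleR_left_distrib)
      finally show ?thesis by simp
    qed
    have "(\<Sum>v\<in>insert x (B \<union> C). (1 / w v) *\<^sub>R F.G'' y v v) =
        (\<epsilon> * ((f + b) / (1 + (a + b)\<^sup>2) + (ODE.q a * (real p * (a + b - s\<^sup>2 * a)) + real (card C) * (a + b)))) *\<^sub>R P x"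
    proof -
      have "(\<Sum>v\<in>insert x (B \<union> C). (1 / w v) *\<^sub>R F.G'' y v v) = (1 / w x) *\<^sub>R F.G'' y x x +
         ((\<Sum>v\<in>B. (1 / w v) *\<^sub>R F.G'' y v v) + (\<Sum>v\<in>C. (1 / w v) *\<^sub>R F.G'' y v v))"
        using ins(2) d(2,5,6) by (simp add: sum.union_disjoint)
      then show ?thesis unfolding SB SC G''x wx by (simp add: algebra_simps flip: scaleR_left_distrib)
    qed
    \<comment> \<open>This is the definition of \<open>field\<close>, divided by the squared length
      of the radial tangent vector.\<close>
    moreover have "(f + b) / (1 + (a + b)\<^sup>2) + (ODE.q a * (real p * (a + b - s\<^sup>2 * a)) + real (card C) * (a + b)) = 0"
    proof -
      have c: "real (card C) = real n - real p" using d(4) by linarith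
      have "f + b = - (((real n - real p + real p * ODE.q a) * b + (real n - real p + (1 - s\<^sup>2) * real p * ODE.q a) * a) * (1 + (a + b)\<^sup>2))"
        by (simp add: f_def ODE.field_def)
      moreover have "1 + (a + b)\<^sup>2 \<noteq> 0" by (metis add_pos_nonneg less_irrefl zero_le_power2 zero_less_one)
      ultimately have "(f + b) / (1 + (a + b)\<^sup>2) = - ((real n - real p + real p * ODE.q a) * b + (real n - real p + (1 - s\<^sup>2) * real p * ODE.q a) * a)"
        by simp
      then show ?thesis unfolding c by (simp add: algebra_simps)
    qed
    ultimately have zero: "(\<Sum>v\<in>insert x (B \<union> C). (1 / w v) *\<^sub>R F.G'' y v v) = 0" by simp
    have "(\<Sum>v\<in>insert x (B \<union> C). (1 / w v) *\<^sub>R (0 :: 'a, F.G'' y v v)) = 0"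
    proof -
      have "(\<Sum>v\<in>insert x (B \<union> C). (1 / w v) *\<^sub>R (0 :: 'a, F.G'' y v v)) =
         (\<Sum>v\<in>insert x (B \<union> C). (0, (1 / w v) *\<^sub>R F.G'' y v v))" by simp
      also have "\<dots> = (0, 0)" unfolding sum_prod zero by simp
      finally show ?thesis by (simp add: zero_prod_def)
    qed
    then show ?thesis
      using X.mean_curvature_vector_eq_0_iff_weighted[OF y _ sub T _ w0 ww] by (simp flip: zero_prod_def)
  qed
  have eq: "(\<lambda>y. (y, K (y \<bullet> y) *\<^sub>R P y)) = ?X" by (simp add: F.G_def fun_eq_iff)
  show ?thesis
    unfolding minimal_submanifold_def eq
    using smooth_submanifold_UNIV smooth_submanifold_graph[OF open_ball F.smooth_G] H by blast
qed

end


section \<open>Lawson-Osserman maps\<close>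

text \<open>Two derivatives within the sphere may differ on the normal line, but the chain rule
  along a curve in the sphere compares them on tangent vectors.\<close>

lemma sphere_differential_eq:
  fixes f P :: "'a::euclidean_space \<Rightarrow> 'b::euclidean_space"
  assumes x: "norm x = 1" and P: "(P has_derivative P') (at x)" and f: "\<And>y. norm y = 1 \<Longrightarrow> f y = P y"
    and v: "v \<bullet> x = 0"
  shows "sphere_differential f x v = P' v"
proof -
  let ?S = "sphere 0 1 :: 'a set"
  have fP: "(f has_derivative P') (at x within ?S)"
    by (rule has_derivative_transform[OF _ _ has_derivative_at_withinI[OF P]]) (use x f in auto)
  then have fD: "(f has_derivative sphere_differential f x) (at x within ?S)"
    unfolding sphere_differential_def using frechet_derivative_works differentiableI by blast
  have "v \<in> tangent_space ?S x" using tangent_space_sphere[OF x] v by simp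
  then obtain e g where e: "e > 0" "g ` {-e<..<e} \<subseteq> ?S" "g 0 = x"
      "(g has_vector_derivative v) (at (0::real))"
    unfolding tangent_space_def by auto
  have at: "at 0 within {-e<..<e} = at (0 :: real)" using e(1) by (intro at_within_open) auto
  have g': "(g has_derivative (\<lambda>t. t *\<^sub>R v)) (at 0 within {-e<..<e})"
    unfolding at using e(4) by (simp add: has_vector_derivative_def)
  have c: "((\<lambda>t. f (g t)) has_derivative (\<lambda>t. D (t *\<^sub>R v))) (at 0)" if "(f has_derivative D) (at x within ?S)" for D
    using has_derivative_in_compose[OF g', of f D] has_derivative_subset[OF that e(2)] e(3) by (simp add: at)
  have "sphere_differential f x (1 *\<^sub>R v) = P' (1 *\<^sub>R v)"
    using has_derivative_unique[OF c[OF fD] c[OF fP]] by metis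
  then show ?thesis by simp
qed

lemma singular_space_cong:
  assumes "\<And>v. v \<in> T \<Longrightarrow> A v = A' v"
  shows "singular_space T A s = singular_space T A' s"
  unfolding singular_space_def using assms by auto

lemma spherical_harmonic_extension:
  fixes f :: "'a::euclidean_space \<Rightarrow> 'b::euclidean_space"
  assumes harm: "\<forall>b\<in>Basis. spherical_harmonic k (\<lambda>x. f x \<bullet> b)" and k: "k \<ge> 2"
    and f: "\<And>x. norm x = 1 \<Longrightarrow> norm (f x) = 1"
  shows "\<exists>P. harmonic_sphere_map P k \<and> (\<forall>x. norm x = 1 \<longrightarrow> f x = P x)"
proof -
  have "\<forall>b\<in>Basis. \<exists>p. real_polynomial_function p \<and> (\<forall>t x. p (t *\<^sub>R x) = t ^ k * p x) \<and>
      (\<forall>x. laplacian p x = 0) \<and> (\<forall>x\<in>sphere 0 1. f x \<bullet> b = p x)"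
    using harm unfolding spherical_harmonic_def by blast
  then obtain p where p: "\<And>b. b \<in> Basis \<Longrightarrow> real_polynomial_function (p b)"
    "\<And>b t x. b \<in> Basis \<Longrightarrow> p b (t *\<^sub>R x) = t ^ k * p b x" "\<And>b x. b \<in> Basis \<Longrightarrow> laplacian (p b) x = 0"
    "\<And>b x. b \<in> Basis \<Longrightarrow> norm x = 1 \<Longrightarrow> f x \<bullet> b = p b x"
    by (metis mem_sphere_0)
  define P where "P x = (\<Sum>b\<in>Basis. p b x *\<^sub>R b)" for x
  have Pb: "P x \<bullet> b = p b x" if "b \<in> Basis" for x b
    using that by (simp add: P_def inner_sum_left inner_Basis if_distrib cong: if_cong)
  have fP: "f x = P x" if "norm x = 1" for x
    by (rule euclidean_eqI) (simp add: Pb p(4) that)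
  interpret homogeneous_sphere_map P k
  proof
    show "smooth_on UNIV P" unfolding P_def[abs_def]
      by (intro smooth_on_sum smooth_on_scaleR smooth_on_real_polynomial smooth_on_const p(1) open_UNIV)
    show "P (t *\<^sub>R x) = t ^ k *\<^sub>R P x" for t x
      by (rule euclidean_eqI) (simp add: Pb p(2))
    show "norm (P x) = 1" if "norm x = 1" for x using f[OF that] fP[OF that] by simp
  qed (rule k)
  have "(\<Sum>b\<in>Basis. D2P x b b) = 0" for x
  proof (rule euclidean_eqI)
    fix c :: 'b assume c: "c \<in> Basis"
    have pc: "p c = (\<lambda>y. P y \<bullet> c)" using Pb[OF c] by auto
    have d1: "frechet_derivative (p c) (at y) = (\<lambda>v. DP y v \<bullet> c)" for y
      unfolding pc by (rule frechet_derivative_at[symmetric]) (rule has_derivative_inner_left[OF P_has_derivative])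
    have d2: "frechet_derivative (\<lambda>y. DP y b \<bullet> c) (at x) = (\<lambda>v. D2P x b v \<bullet> c)" for b
      by (rule frechet_derivative_at[symmetric]) (rule has_derivative_inner_left[OF DP_has_derivative])
    have "(\<Sum>b\<in>Basis. D2P x b b \<bullet> c) = 0"
      using p(3)[OF c, of x] unfolding laplacian_def d1 d2 .
    then show "(\<Sum>b\<in>Basis. D2P x b b) \<bullet> c = 0 \<bullet> c" by (simp add: inner_sum_left)
  qed
  then have "harmonic_sphere_map P k"
    by unfold_locales (simp_all add: Pb p(1))
  then show ?thesis using fP by blast
qed

text \<open>Transfers the hypotheses on \<open>f\<close> to \<open>P\<close>: on tangent vectors the
  differentials agree, and \<open>M_graph\<close> is the image of \<open>sphere_param\<close>.
  \<open>singular_value_formula\<close> identifies the square of the singular value at each point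
  with that of \<open>lam\<close>.\<close>

lemma LOMSE_of_type_bases:
  fixes f :: "'a::euclidean_space \<Rightarrow> 'b::euclidean_space"
  assumes f: "LOMSE_of_type n p k f" and P: "harmonic_sphere_map P k"
    and fP: "\<And>x. norm x = 1 \<Longrightarrow> f x = P x" and x: "norm x = 1"
    and L: "lam\<^sup>2 = real k * (real k + real n - 1) / real p" and p: "p > 0"
  shows "\<exists>B C. harmonic_sphere_map.singular_bases P n p lam x B C \<and>
    (\<Sum>v\<in>B. homogeneous_map.D2P P x v v) = (real p * (real k - lam\<^sup>2)) *\<^sub>R P x \<and>
    (\<Sum>v\<in>C. homogeneous_map.D2P P x v v) = (real (card C) * real k) *\<^sub>R P x"
proof -
  interpret harmonic_sphere_map P k by (rule P)
  define T where "T = {v. v \<bullet> x = 0}"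
  have TT: "tangent_space (sphere 0 1) x = T" unfolding T_def by (rule tangent_space_sphere[OF x])
  have xs: "x \<in> sphere 0 1" using x by simp
  have n: "DIM('a) = n + 1" and LOM: "LOM f" using f unfolding LOMSE_of_type_def LOMSE_def by blast+
  have dT: "dim T = n"
  proof -
    have "T = {v. x \<bullet> v = 0}" by (auto simp: T_def inner_commute)
    moreover have "x \<noteq> 0" using x by auto
    ultimately show ?thesis using dim_hyperplane[of x] n by simp
  qed
  have sd: "sphere_differential f x v = DP x v" if "v \<in> T" for v
    by (rule sphere_differential_eq[OF x P_has_derivative fP]) (use that in \<open>simp_all add: T_def\<close>)
  have ss: "singular_space T (sphere_differential f x) m = singular_space T (DP x) m" for m
    by (rule singular_space_cong) (rule sd)
  have sv: "singular_value T (sphere_differential f x) m \<longleftrightarrow> singular_value T (DP x) m" for m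
    unfolding singular_value_def ss ..
  have "LOMSE f" and mult: "\<forall>x\<in>sphere 0 1. \<exists>s. s \<noteq> 0 \<and>
      singular_value (tangent_space (sphere 0 1) x) (sphere_differential f x) s \<and>
      dim (singular_space (tangent_space (sphere 0 1) x) (sphere_differential f x) s) = p"
    using f unfolding LOMSE_of_type_def by simp_all
  then have "\<forall>x\<in>sphere 0 1. \<forall>s t. s \<noteq> 0 \<longrightarrow> t \<noteq> 0 \<longrightarrow>
      singular_value (tangent_space (sphere 0 1) x) (sphere_differential f x) s \<longrightarrow>
      singular_value (tangent_space (sphere 0 1) x) (sphere_differential f x) t \<longrightarrow> s = t"
    unfolding LOMSE_def by simp
  note uniq = this[rule_format, OF xs, unfolded TT sv]
  obtain s where s: "s \<noteq> 0" "singular_value T (DP x) s" "dim (singular_space T (DP x) s) = p"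
    using bspec[OF mult xs] unfolding TT sv ss by blast
  have s0: "s > 0" using s by (simp add: singular_value_def)
  have sT: "subspace T" by (auto simp: T_def subspace_def inner_add_left)
  obtain B C where BC: "singular_bases n p s x B C"
    using singular_decomposition[OF sT linear_DP s0, of x] uniq[OF _ s(1) _ s(2)] s(3) dT
    unfolding singular_bases_def T_def by auto
  have "s\<^sup>2 = lam\<^sup>2" unfolding L singular_value_formula[OF x BC, symmetric] using p by simp
  obtain \<theta> where \<theta>: "0 < \<theta>" "\<theta> < pi / 2" "minimal_submanifold (DIM('a) - 1) (sphere 0 1) (M_graph f \<theta>)"
    using LOM unfolding LOM_def by blast
  have cs: "cos \<theta> > 0" "sin \<theta> > 0" using \<theta> by (auto intro: cos_gt_zero sin_gt_zero2)
  have X1: "sphere_param (cos \<theta>) (sin \<theta>) z = (cos \<theta> *\<^sub>R z, sin \<theta> *\<^sub>R f z)" if "norm z = 1" for z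
  proof -
    have "z \<noteq> 0" using that by auto
    from sphere_param_eq[OF this] show ?thesis using that fP[OF that] by simp
  qed
  have img: "sphere_param (cos \<theta>) (sin \<theta>) ` (UNIV - {0}) = M_graph f \<theta>"
  proof (rule subset_antisym; rule subsetI)
    fix z assume "z \<in> sphere_param (cos \<theta>) (sin \<theta>) ` (UNIV - {0})"
    then obtain y where y: "y \<noteq> 0" "z = sphere_param (cos \<theta>) (sin \<theta>) y" by blast
    let ?y = "(1 / norm y) *\<^sub>R y"
    have ny: "norm ?y = 1" using y by simp
    have "z = (cos \<theta> *\<^sub>R ?y, sin \<theta> *\<^sub>R f ?y)" unfolding y(2) sphere_param_eq[OF y(1)] fP[OF ny] ..
    then show "z \<in> M_graph f \<theta>" unfolding M_graph_def using ny by (intro image_eqI[of _ _ ?y]) auto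
  next
    fix z assume "z \<in> M_graph f \<theta>"
    then obtain y where y: "norm y = 1" "z = (cos \<theta> *\<^sub>R y, sin \<theta> *\<^sub>R f y)" unfolding M_graph_def by auto
    then show "z \<in> sphere_param (cos \<theta>) (sin \<theta>) ` (UNIV - {0})"
      using X1[OF y(1)] by (intro image_eqI[of _ _ y]) auto
  qed
  have "sphere_param (cos \<theta>) (sin \<theta>) x \<in> M_graph f \<theta>"
    unfolding img[symmetric] using x by (intro imageI) auto
  then have "mean_curvature_vector (sphere 0 1) (sphere_param (cos \<theta>) (sin \<theta>) ` (UNIV - {0})) (sphere_param (cos \<theta>) (sin \<theta>) x) = 0"
    using \<theta>(3) unfolding img minimal_submanifold_def by blast
  note sums = sum_D2P_of_minimal[OF x BC s(1) cs sin_cos_squared_add2 this]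
  have "singular_bases n p lam x B C" using BC unfolding singular_bases_def \<open>s\<^sup>2 = lam\<^sup>2\<close> .
  then show ?thesis using sums unfolding \<open>s\<^sup>2 = lam\<^sup>2\<close> by blast
qed

theorem mainTheorem7:
  fixes f :: "'a::euclidean_space \<Rightarrow> 'b::euclidean_space"
    and n p k :: nat and lam \<phi>0 :: real
  assumes "LOMSE_of_type n p k f"
    and "(n = 3 \<and> p = 2 \<and> k \<ge> 4) \<or> (n = 5 \<and> p = 4 \<and> k \<ge> 6)"
    and "lam\<^sup>2 = real k * (real k + real n - 1) / real p"
    and "\<phi>0 = sqrt ((real p - real n * inverse (lam\<^sup>2)) / (real n - real p))"
  shows "\<exists>\<epsilon>>0. \<forall>\<phi>\<in>{\<phi>0<..<\<phi>0 + \<epsilon>}.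
           \<exists>F. analytic_Dirichlet_solution (\<lambda>x. \<phi> *\<^sub>R f x) F"
proof -
  have np: "0 < p" "p < n" "k \<ge> 4" using assms(2) by auto
  have harm: "\<forall>b\<in>Basis. spherical_harmonic k (\<lambda>x. f x \<bullet> b)" and LOM: "LOM f"
    using assms(1) unfolding LOMSE_of_type_def LOMSE_def by blast+
  have "norm (f x) = 1" if "norm x = 1" for x
    using LOM that unfolding LOM_def smooth_map_def by (auto simp: image_subset_iff)
  then obtain P where P: "harmonic_sphere_map P k" and fP: "\<And>x. norm x = 1 \<Longrightarrow> f x = P x"
    using spherical_harmonic_extension[OF harm] np by auto
  interpret harmonic_sphere_map P k by (rule P)
  have pL: "real p * lam\<^sup>2 = real k * (real k + real n - 1)" using assms(3) np by simp
  interpret ODE: profile_spiral "real n" "real p" "lam\<^sup>2" "real k - 1"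
  proof
    show "real p * lam\<^sup>2 = (real k - 1 + 1) * (real k - 1 + real n)" by (simp add: pL algebra_simps)
    \<comment> \<open>With \<open>m = k (k + n - 1)\<close> the goal is
      \<open>16 m < 24 (m - 3)\<close>, or \<open>m > 9\<close>, for \<open>n = 3\<close>, and
      \<open>36 m < 40 (m - 5)\<close>, or \<open>m > 50\<close>, for \<open>n = 5\<close>. The
      lower bounds on \<open>k\<close> give \<open>m \<ge> 24\<close> and
      \<open>m \<ge> 60\<close>.\<close>
    consider "n = 3" "k \<ge> 4" | "n = 5" "k \<ge> 6" using assms(2) by auto
    then show "(real n + 1)\<^sup>2 * (real p * lam\<^sup>2) < 8 * real n * (real p * lam\<^sup>2 - real n)"
    proof cases
      case 1
      then have "4 * (2 + 4) \<le> real k * (2 + real k)" by (intro mult_mono) auto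
      then show ?thesis unfolding pL 1 by (simp add: power2_eq_square add.commute)
    next
      case 2
      then have "6 * (4 + 6) \<le> real k * (4 + real k)" by (intro mult_mono) auto
      then show ?thesis unfolding pL 2 by (simp add: power2_eq_square add.commute)
    qed
  qed (use np in auto)
  have rest: "ODE.rest = \<phi>0"
  proof -
    have "(real p * lam\<^sup>2 - real n) / ((real n - real p) * lam\<^sup>2) = (real p - real n * inverse (lam\<^sup>2)) / (real n - real p)"
      using np ODE.L_pos by (simp add: divide_simps)
    then show ?thesis unfolding ODE.rest_def assms(4) by simp
  qed
  have "real k - 1 = real (k - 1)" using np by (simp add: of_nat_diff)
  from ODE.radial_profile[OF this] obtain \<Phi> where \<Phi>: "\<Phi> > \<phi>0" "\<And>x. x \<in> {\<phi>0<..<\<Phi>} \<Longrightarrow> \<exists>K u \<phi> \<psi>. u > 1 \<and>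
    analytic_real {0..<u} K \<and> \<phi> 0 = x \<and>
    (\<forall>\<tau>. exp (2 * \<tau>) < u \<longrightarrow> K (exp (2 * \<tau>)) = exp (- (real k - 1) * \<tau>) * \<phi> \<tau> \<and>
       (\<phi> has_real_derivative \<psi> \<tau>) (at \<tau>) \<and> (\<psi> has_real_derivative ODE.field (\<phi> \<tau>) (\<psi> \<tau>)) (at \<tau>))"
    unfolding rest by blast
  have "\<exists>F. analytic_Dirichlet_solution (\<lambda>x. c *\<^sub>R f x) F" if c: "c \<in> {\<phi>0<..<\<Phi>}" for c
  proof -
    obtain K u \<phi> \<psi> where K: "u > 1" "analytic_real {0..<u} K" "\<phi> 0 = c"
      "\<And>\<tau>. exp (2 * \<tau>) < u \<Longrightarrow> K (exp (2 * \<tau>)) = exp (- (real k - 1) * \<tau>) * \<phi> \<tau> \<and>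
       (\<phi> has_real_derivative \<psi> \<tau>) (at \<tau>) \<and> (\<psi> has_real_derivative ODE.field (\<phi> \<tau>) (\<psi> \<tau>)) (at \<tau>)"
      using \<Phi>(2)[OF c] by blast
    define F where "F y = K (y \<bullet> y) *\<^sub>R P y" for y
    have dom: "y \<bullet> y \<in> {0..<u}" if "y \<in> cball 0 1" for y :: 'a
    proof -
      have "y \<bullet> y = (norm y)\<^sup>2" by (simp add: power2_norm_eq_inner)
      also have "\<dots> \<le> 1" using that by (simp add: power_le_one)
      finally show ?thesis using K(1) by simp
    qed
    have "continuous_on {0..<u} K"
      using analytic_real_isCont[OF K(2)] by (intro continuous_at_imp_continuous_on) auto
    then have "continuous_on (cball 0 1) (\<lambda>y :: 'a. K (y \<bullet> y))"
      by (rule continuous_on_compose2) (use dom in \<open>auto intro!: continuous_intros\<close>)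
    then have "continuous_on (cball 0 1) F"
      unfolding F_def[abs_def]
      by (intro continuous_on_scaleR continuous_on_subset[OF smooth_on_imp_continuous_on[OF smooth]]) auto
    moreover have "real_analytic_on (ball 0 1) F"
      unfolding F_def[abs_def]
      by (rule real_analytic_on_radial_times_polynomial[OF K(2) _ polynomial]) (use dom in auto)
    moreover have "F x = c *\<^sub>R f x" if "x \<in> sphere 0 1" for x
    proof -
      \<comment> \<open>The boundary is time 0, where the translated orbit takes the prescribed
        value \<open>c\<close>.\<close>
      have "x \<bullet> x = exp (2 * 0)" using that by (simp add: norm_eq_1)
      then have "K (x \<bullet> x) = c" using K(1) K(4)[of 0] K(3) by simp
      then show ?thesis using fP[of x] that by (simp add: F_def)
    qed
    moreover have "minimal_submanifold DIM('a) UNIV ((\<lambda>x. (x, F x)) ` ball 0 1)"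
      unfolding F_def
    proof (rule minimal_radial_graph[OF _ _ ODE.profile_ODE_axioms K(1,2) K(4)])
      show "\<exists>B C. singular_bases n p lam x B C \<and> (\<Sum>v\<in>B. D2P x v v) = (real p * (real k - lam\<^sup>2)) *\<^sub>R P x \<and>
         (\<Sum>v\<in>C. D2P x v v) = (real (card C) * real k) *\<^sub>R P x" if "norm x = 1" for x
        by (rule LOMSE_of_type_bases[OF assms(1) P fP that assms(3) np(1)])
    qed (use np in auto)
    ultimately show ?thesis unfolding analytic_Dirichlet_solution_def by blast
  qed
  then show ?thesis using \<Phi>(1) by (intro exI[of _ "\<Phi> - \<phi>0"]) auto
qed

end
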